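(* If $\mathbf{A}$ is a finite left nilpotent algebra and $\mathbf{A}^{|A|}$ does not have a nontrivial strongly abelian quotient algebra, then $\mathbf{A}$ is a spread of its type $\mathbf{2}$ minimal sets.
   Context: Left nilpotent: $[1,\dots,[1,[1,1]]\dots]=0$ for a sufficiently long expression in the term condition commutator. Strongly abelian is in the sense of tame congruence theory. Type $\mathbf{2}$ minimal sets are the $\langle\alpha,\beta\rangle$-minimal sets for prime quotients $\alpha\prec\beta$ of $\mathrm{Con}(\mathbf{A})$ of type $\mathbf{2}$. $A$ is a spread of a collection $\mathcal U$ of subsets if $A=p(U_1,\dots,U_k)$ for some polynomial $p$ of $\mathbf{A}$ and (not necessarily distinct) $U_i\in\mathcal U$. *)

theory Defs
  imports Main "HOL-Library.FuncSet"
begin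

(* An algebra of signature ar: carrier A, basic operation F i of arity ar i
   (F i is only meaningful on lists of length ar i over A). *)
definition algebra :: "('i \<Rightarrow> nat) \<Rightarrow> 'a set \<Rightarrow> ('i \<Rightarrow> 'a list \<Rightarrow> 'a) \<Rightarrow> bool" where
  "algebra ar A F \<longleftrightarrow> A \<noteq> {} \<and>
     (\<forall>i xs. length xs = ar i \<longrightarrow> set xs \<subseteq> A \<longrightarrow> F i xs \<in> A)"

inductive_set term_ops :: "('i \<Rightarrow> nat) \<Rightarrow> ('i \<Rightarrow> 'a list \<Rightarrow> 'a) \<Rightarrow> (nat \<times> ('a list \<Rightarrow> 'a)) set"
  for ar F where
  proj: "j < n \<Longrightarrow> (n, \<lambda>xs. xs ! j) \<in> term_ops ar F"
| app: "(\<And>j. j < ar i \<Longrightarrow> (n, g j) \<in> term_ops ar F) \<Longrightarrow>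
        (n, \<lambda>xs. F i (map (\<lambda>j. g j xs) [0..<ar i])) \<in> term_ops ar F"

inductive_set polys :: "('i \<Rightarrow> nat) \<Rightarrow> 'a set \<Rightarrow> ('i \<Rightarrow> 'a list \<Rightarrow> 'a) \<Rightarrow> (nat \<times> ('a list \<Rightarrow> 'a)) set"
  for ar A F where
  proj: "j < n \<Longrightarrow> (n, \<lambda>xs. xs ! j) \<in> polys ar A F"
| const: "c \<in> A \<Longrightarrow> (n, \<lambda>xs. c) \<in> polys ar A F"
| app: "(\<And>j. j < ar i \<Longrightarrow> (n, g j) \<in> polys ar A F) \<Longrightarrow>
        (n, \<lambda>xs. F i (map (\<lambda>j. g j xs) [0..<ar i])) \<in> polys ar A F"

definition congruence :: "('i \<Rightarrow> nat) \<Rightarrow> 'a set \<Rightarrow> ('i \<Rightarrow> 'a list \<Rightarrow> 'a) \<Rightarrow> 'a rel \<Rightarrow> bool" where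
  "congruence ar A F \<theta> \<longleftrightarrow> equiv A \<theta> \<and>
     (\<forall>i xs ys. length xs = ar i \<longrightarrow> list_all2 (\<lambda>x y. (x, y) \<in> \<theta>) xs ys \<longrightarrow>
        (F i xs, F i ys) \<in> \<theta>)"

definition centralizes :: "('i \<Rightarrow> nat) \<Rightarrow> ('i \<Rightarrow> 'a list \<Rightarrow> 'a) \<Rightarrow> 'a rel \<Rightarrow> 'a rel \<Rightarrow> 'a rel \<Rightarrow> bool" where
  "centralizes ar F \<alpha> \<beta> \<delta> \<longleftrightarrow>
     (\<forall>k t xs xs' ys ys'. (k, t) \<in> term_ops ar F \<longrightarrow> length xs + length ys = k \<longrightarrow>
        list_all2 (\<lambda>x y. (x, y) \<in> \<alpha>) xs xs' \<longrightarrow>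
        list_all2 (\<lambda>x y. (x, y) \<in> \<beta>) ys ys' \<longrightarrow>
        (t (xs @ ys), t (xs @ ys')) \<in> \<delta> \<longrightarrow> (t (xs' @ ys), t (xs' @ ys')) \<in> \<delta>)"

definition commutator :: "('i \<Rightarrow> nat) \<Rightarrow> 'a set \<Rightarrow> ('i \<Rightarrow> 'a list \<Rightarrow> 'a) \<Rightarrow> 'a rel \<Rightarrow> 'a rel \<Rightarrow> 'a rel" where
  "commutator ar A F \<alpha> \<beta> = \<Inter>{\<delta>. congruence ar A F \<delta> \<and> centralizes ar F \<alpha> \<beta> \<delta>}"

fun left_comm_series :: "('i \<Rightarrow> nat) \<Rightarrow> 'a set \<Rightarrow> ('i \<Rightarrow> 'a list \<Rightarrow> 'a) \<Rightarrow> nat \<Rightarrow> 'a rel" where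
  "left_comm_series ar A F 0 = A \<times> A"
| "left_comm_series ar A F (Suc k) = commutator ar A F (A \<times> A) (left_comm_series ar A F k)"

definition left_nilpotent :: "('i \<Rightarrow> nat) \<Rightarrow> 'a set \<Rightarrow> ('i \<Rightarrow> 'a list \<Rightarrow> 'a) \<Rightarrow> bool" where
  "left_nilpotent ar A F \<longleftrightarrow> (\<exists>k. left_comm_series ar A F k = Id_on A)"

definition strongly_abelian :: "('i \<Rightarrow> nat) \<Rightarrow> 'a set \<Rightarrow> ('i \<Rightarrow> 'a list \<Rightarrow> 'a) \<Rightarrow> bool" where
  "strongly_abelian ar B F \<longleftrightarrow>
     (\<forall>k t a b e cs ds. (Suc k, t) \<in> term_ops ar F \<longrightarrow> a \<in> B \<longrightarrow> b \<in> B \<longrightarrow> e \<in> B \<longrightarrow>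
        length cs = k \<longrightarrow> length ds = k \<longrightarrow> set cs \<subseteq> B \<longrightarrow> set ds \<subseteq> B \<longrightarrow>
        t (a # cs) = t (b # ds) \<longrightarrow> t (e # cs) = t (e # ds))"

definition rep :: "'a set \<Rightarrow> 'a" where
  "rep X = (SOME x. x \<in> X)"

definition quot_ops :: "('i \<Rightarrow> 'a list \<Rightarrow> 'a) \<Rightarrow> 'a rel \<Rightarrow> 'i \<Rightarrow> 'a set list \<Rightarrow> 'a set" where
  "quot_ops F \<theta> i Xs = \<theta> `` {F i (map rep Xs)}"

definition pow_carrier :: "'j set \<Rightarrow> 'a set \<Rightarrow> ('j \<Rightarrow> 'a) set" where
  "pow_carrier I A = PiE I (\<lambda>_. A)"

definition pow_ops :: "('i \<Rightarrow> 'a list \<Rightarrow> 'a) \<Rightarrow> 'j set \<Rightarrow> 'i \<Rightarrow> ('j \<Rightarrow> 'a) list \<Rightarrow> ('j \<Rightarrow> 'a)" where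
  "pow_ops F I i fs = restrict (\<lambda>j. F i (map (\<lambda>f. f j) fs)) I"

definition has_nontrivial_sa_quotient :: "('i \<Rightarrow> nat) \<Rightarrow> 'b set \<Rightarrow> ('i \<Rightarrow> 'b list \<Rightarrow> 'b) \<Rightarrow> bool" where
  "has_nontrivial_sa_quotient ar B G \<longleftrightarrow>
     (\<exists>\<theta>. congruence ar B G \<theta> \<and> (\<exists>X\<in>B // \<theta>. \<exists>Y\<in>B // \<theta>. X \<noteq> Y) \<and>
          strongly_abelian ar (B // \<theta>) (quot_ops G \<theta>))"

definition prime_quotient :: "('i \<Rightarrow> nat) \<Rightarrow> 'a set \<Rightarrow> ('i \<Rightarrow> 'a list \<Rightarrow> 'a) \<Rightarrow> 'a rel \<Rightarrow> 'a rel \<Rightarrow> bool" where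
  "prime_quotient ar A F \<alpha> \<beta> \<longleftrightarrow> congruence ar A F \<alpha> \<and> congruence ar A F \<beta> \<and> \<alpha> \<subset> \<beta> \<and>
     \<not> (\<exists>\<gamma>. congruence ar A F \<gamma> \<and> \<alpha> \<subset> \<gamma> \<and> \<gamma> \<subset> \<beta>)"

definition U_sets :: "('i \<Rightarrow> nat) \<Rightarrow> 'a set \<Rightarrow> ('i \<Rightarrow> 'a list \<Rightarrow> 'a) \<Rightarrow> 'a rel \<Rightarrow> 'a rel \<Rightarrow> 'a set set" where
  "U_sets ar A F \<alpha> \<beta> = {(\<lambda>x. p [x]) ` A | p. (Suc 0, p) \<in> polys ar A F \<and>
      (\<exists>(x, y)\<in>\<beta>. (p [x], p [y]) \<notin> \<alpha>)}"

definition min_sets :: "('i \<Rightarrow> nat) \<Rightarrow> 'a set \<Rightarrow> ('i \<Rightarrow> 'a list \<Rightarrow> 'a) \<Rightarrow> 'a rel \<Rightarrow> 'a rel \<Rightarrow> 'a set set" where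
  "min_sets ar A F \<alpha> \<beta> = {U \<in> U_sets ar A F \<alpha> \<beta>. \<forall>V\<in>U_sets ar A F \<alpha> \<beta>. V \<subseteq> U \<longrightarrow> V = U}"

definition is_trace :: "'a rel \<Rightarrow> 'a rel \<Rightarrow> 'a set \<Rightarrow> 'a set \<Rightarrow> bool" where
  "is_trace \<alpha> \<beta> U N \<longleftrightarrow> (\<exists>b\<in>U. N = U \<inter> \<beta> `` {b}) \<and> (\<exists>x\<in>N. \<exists>y\<in>N. (x, y) \<notin> \<alpha>)"

(* polynomial clone of the algebra (A|_N) / (alpha|_N), carrier N // (alpha \<inter> N\<times>N) *)
definition induced_clone :: "('i \<Rightarrow> nat) \<Rightarrow> 'a set \<Rightarrow> ('i \<Rightarrow> 'a list \<Rightarrow> 'a) \<Rightarrow> 'a rel \<Rightarrow> 'a set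
     \<Rightarrow> (nat \<times> ('a set list \<Rightarrow> 'a set)) set" where
  "induced_clone ar A F \<alpha> N = {(n, \<lambda>Xs. (\<alpha> \<inter> N \<times> N) `` {p (map rep Xs)}) | n p.
      (n, p) \<in> polys ar A F \<and> (\<forall>xs. length xs = n \<longrightarrow> set xs \<subseteq> N \<longrightarrow> p xs \<in> N)}"

definition affine_op :: "('b \<Rightarrow> 'b \<Rightarrow> 'b) \<Rightarrow> ('b \<Rightarrow> 'b) list \<Rightarrow> 'b \<Rightarrow> 'b list \<Rightarrow> 'b" where
  "affine_op pl ks c xs = foldr (\<lambda>(k, x) acc. pl (k x) acc) (zip ks xs) c"

(* the algebra on Q with polynomial clone C is polynomially equivalent to a vector space:
   an abelian group (Q,+,0,-) together with a field K of its endomorphisms (the scalars),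
   whose polynomial clone (the affine operations) agrees with C on Q *)
definition poly_equiv_vector_space :: "'b set \<Rightarrow> (nat \<times> ('b list \<Rightarrow> 'b)) set \<Rightarrow> bool" where
  "poly_equiv_vector_space Q C \<longleftrightarrow>
    (\<exists>pl z ng K.
      z \<in> Q \<and> (\<forall>x\<in>Q. \<forall>y\<in>Q. pl x y \<in> Q) \<and> (\<forall>x\<in>Q. ng x \<in> Q) \<and>
      (\<forall>x\<in>Q. \<forall>y\<in>Q. \<forall>w\<in>Q. pl (pl x y) w = pl x (pl y w)) \<and>
      (\<forall>x\<in>Q. \<forall>y\<in>Q. pl x y = pl y x) \<and>
      (\<forall>x\<in>Q. pl z x = x) \<and> (\<forall>x\<in>Q. pl (ng x) x = z) \<and>
      (\<forall>k\<in>K. \<forall>x\<in>Q. k x \<in> Q) \<and>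
      (\<forall>k\<in>K. \<forall>x\<in>Q. \<forall>y\<in>Q. k (pl x y) = pl (k x) (k y)) \<and>
      id \<in> K \<and> (\<lambda>x. z) \<in> K \<and>
      (\<forall>k\<in>K. \<forall>l\<in>K. (\<lambda>x. pl (k x) (l x)) \<in> K \<and> k \<circ> l \<in> K \<and> (\<forall>x\<in>Q. k (l x) = l (k x))) \<and>
      (\<forall>k\<in>K. (\<lambda>x. ng (k x)) \<in> K) \<and>
      (\<forall>k\<in>K. (\<exists>x\<in>Q. k x \<noteq> z) \<longrightarrow> (\<exists>l\<in>K. \<forall>x\<in>Q. l (k x) = x)) \<and>
      (\<forall>(n, f)\<in>C. \<exists>ks c. length ks = n \<and> set ks \<subseteq> K \<and> c \<in> Q \<and>
          (\<forall>xs. length xs = n \<longrightarrow> set xs \<subseteq> Q \<longrightarrow> f xs = affine_op pl ks c xs)) \<and>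
      (\<forall>n ks c. length ks = n \<longrightarrow> set ks \<subseteq> K \<longrightarrow> c \<in> Q \<longrightarrow>
          (\<exists>f. (n, f) \<in> C \<and>
             (\<forall>xs. length xs = n \<longrightarrow> set xs \<subseteq> Q \<longrightarrow> f xs = affine_op pl ks c xs))))"

definition type2 :: "('i \<Rightarrow> nat) \<Rightarrow> 'a set \<Rightarrow> ('i \<Rightarrow> 'a list \<Rightarrow> 'a) \<Rightarrow> 'a rel \<Rightarrow> 'a rel \<Rightarrow> bool" where
  "type2 ar A F \<alpha> \<beta> \<longleftrightarrow> prime_quotient ar A F \<alpha> \<beta> \<and>
     (\<exists>U\<in>min_sets ar A F \<alpha> \<beta>. \<exists>N. is_trace \<alpha> \<beta> U N \<and>
        poly_equiv_vector_space (N // (\<alpha> \<inter> N \<times> N)) (induced_clone ar A F \<alpha> N))"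

definition type2_min_sets :: "('i \<Rightarrow> nat) \<Rightarrow> 'a set \<Rightarrow> ('i \<Rightarrow> 'a list \<Rightarrow> 'a) \<Rightarrow> 'a set set" where
  "type2_min_sets ar A F = {U. \<exists>\<alpha> \<beta>. prime_quotient ar A F \<alpha> \<beta> \<and> type2 ar A F \<alpha> \<beta> \<and>
      U \<in> min_sets ar A F \<alpha> \<beta>}"

definition is_spread :: "('i \<Rightarrow> nat) \<Rightarrow> 'a set \<Rightarrow> ('i \<Rightarrow> 'a list \<Rightarrow> 'a) \<Rightarrow> 'a set set \<Rightarrow> bool" where
  "is_spread ar A F \<U> \<longleftrightarrow> (\<exists>k p Us. (k, p) \<in> polys ar A F \<and> length Us = k \<and> set Us \<subseteq> \<U> \<and>
      A = {p xs | xs. list_all2 (\<lambda>x U. x \<in> U) xs Us})"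

end

(* Left nilpotence enters only through rigidity: if a polynomial t(x, a) permutes a set U and a twin
   t(x, b) maps U into itself, then the twin permutes U too.  Rigidity passes to powers.

   In B = A^I, with card I = card A, consider the subalgebra D generated by the constants and by the
   functions from I into a single type 2 minimal set.  If the enumeration of A lies in D, then A is a
   spread.  Otherwise extend D to a maximal proper subalgebra M and let theta be a maximal congruence
   of which M is a union of classes, with a cover beta.  A (theta, beta)-minimal set V = e(B), where e
   has its constants in M, cannot lie inside M.  If V carries no quasigroup polynomial, then membership
   of e(f(x1, ..., xk)) in M depends on at most one of the variables, and these memberships determine
   theta, so that B/theta is strongly abelian.  If V does carry a quasigroup polynomial, then by
   rigidity the coordinate projections of V are type 2 minimal sets of A, polynomially isomorphic to
   one another, and V is contained in D, a contradiction. *)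

theory Submission
  imports Defs "HOL-Algebra.Ring" "HOL-Computational_Algebra.Computational_Algebra"
begin

section \<open>Finite skew fields\<close>

text \<open>Rigidity makes permutations insensitive to parameters: as long as a set is mapped into
  itself, constants may be moved into M, or exchanged for those of another coordinate of the power,
  and a permutation stays one. The exponent |A| is chosen because a single point of that power
  enumerates A. The obstacle is that the conclusion speaks of type 2, hence of a vector space over a
  field, while the power yields only a quasigroup polynomial. The congruences \<theta> and \<beta>
  of the power need not come from A, so a prime quotient of A is found anew, and the vector space is
  built from the quasigroup: a Malcev polynomial x - y + z, the addition it induces on a trace
  modulo the lower congruence, and suitable unary polynomials as scalars. These scalars form a
  finite division ring. That it is commutative is Wedderburn's theorem, which is why skew fields
  come first.\<close>

lemma finite_common_multiple:
  fixes N :: "'a :: semiring_gcd"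
  assumes "finite S" "\<And>p. p \<in> S \<Longrightarrow> p dvd N"
  shows "\<exists>L. (\<forall>p\<in>S. p dvd L) \<and> L dvd N \<and> L dvd \<Prod>S"
  using assms
proof (induction S rule: finite_induct)
  case (insert p S)
  then obtain L where L: "\<forall>p\<in>S. p dvd L" "L dvd N" "L dvd \<Prod>S" by auto
  have "lcm p L dvd p * L" by (rule lcm_least) simp_all
  also have "\<dots> dvd p * \<Prod>S" using L(3) by (rule mult_dvd_mono[OF dvd_refl])
  finally have "lcm p L dvd \<Prod>(insert p S)" using insert by simp
  then show ?case using L insert.prems
    by (intro exI[of _ "lcm p L"]) (auto intro: dvd_trans)
qed auto

text \<open>Already the real part of q - z exceeds q - 1: a complex number of modulus 1 other than 1
  has real part less than 1.\<close>

lemma norm_diff_root_of_unity: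
  fixes q :: real and z :: complex
  assumes "z ^ n = 1" "z \<noteq> 1" "n > 0"
  shows "cmod (of_real q - z) > q - 1"
proof -
  have "cmod z ^ n = 1" using assms(1) by (simp flip: norm_power)
  then have "cmod z = 1" using assms(3) power_eq_iff_eq_base[of n "cmod z" 1] by simp
  have "Re z < 1"
  proof (rule ccontr)
    assume "\<not> Re z < 1"
    then have "Re z = 1" using complex_Re_le_cmod[of z] \<open>cmod z = 1\<close> by simp
    moreover have "Im z = 0" using \<open>cmod z = 1\<close> \<open>Re z = 1\<close> by (simp add: cmod_def)
    ultimately show False using assms(2) by (simp add: complex_eq_iff)
  qed
  then show ?thesis using complex_Re_le_cmod[of "of_real q - z"] by simp
qed

lemma map_poly_of_int_mult:
  "map_poly (of_int :: int \<Rightarrow> 'a :: comm_ring_1) (p * q) = map_poly of_int p * map_poly of_int q"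
  by (intro poly_eqI) (simp add: coeff_map_poly coeff_mult)

lemma map_poly_of_int_prod:
  "map_poly (of_int :: int \<Rightarrow> 'a :: comm_ring_1) (prod f A) = (\<Prod>a\<in>A. map_poly of_int (f a))"
  by (induction A rule: infinite_finite_induct) (simp_all add: map_poly_of_int_mult)

lemma primitive_root_power_neq_1:
  fixes n d :: nat
  assumes "0 < d" "d < n"
  shows "cis (2 * pi / n) ^ d \<noteq> 1"
proof
  have inj: "inj_on (\<lambda>k. cis (2 * pi * real k / real n)) {..<n}"
    using bij_betw_roots_unity[of n] assms by (auto simp: bij_betw_def)
  assume "cis (2 * pi / n) ^ d = 1"
  then have "cis (2 * pi * real d / real n) = cis (2 * pi * real 0 / real n)"
    by (simp add: DeMoivre mult.commute)
  then have "d = 0" using inj_onD[OF inj, of d 0] assms by simp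
  then show False using assms by simp
qed

text \<open>\<open>\<Phi>\<close> below is the quotient of \<open>X\<^sup>n - 1\<close> by the least common multiple of the \<open>X\<^sup>d - 1\<close>; this is the
  cyclotomic polynomial, but it suffices to know that it has a root and that 1 is not one of them.\<close>

lemma cyclotomic_divisor:
  fixes q n :: nat
  assumes q: "q \<ge> 2" and n: "n \<ge> 2"
  obtains P :: nat where "P dvd q ^ n - 1" "P > q - 1"
    "\<And>d. d > 0 \<Longrightarrow> d dvd n \<Longrightarrow> d < n \<Longrightarrow> P dvd (q ^ n - 1) div (q ^ d - 1)"
proof -
  let ?f = "\<lambda>d. monom 1 d - 1 :: int poly"
  let ?D = "{d. d > 0 \<and> d dvd n \<and> d < n}"
  have fdvd: "?f d dvd ?f n" if dn: "d dvd n" for d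
  proof -
    obtain k where k: "n = d * k" using dn by (auto simp: dvd_def)
    have "(monom 1 d - 1) dvd (monom 1 d :: int poly) ^ k - 1"
      by (simp add: power_diff_1_eq)
    then show ?thesis by (simp add: k monom_power)
  qed
  have "finite ?D" using finite_divisors_nat[of n] n by (rule_tac finite_subset[of _ "{d. d dvd n}"]) auto
  \<comment> \<open>The third property keeps the roots of L among those of the X^d - 1, so a
    primitive n-th root of unity is not one of them and must be a root of the quotient
    \<Phi>.\<close>
  then obtain L where L: "\<And>d. d \<in> ?D \<Longrightarrow> ?f d dvd L" "L dvd ?f n" "L dvd \<Prod>(?f ` ?D)"
    using finite_common_multiple[of "?f ` ?D" "?f n"] fdvd by auto
  obtain \<Phi> where \<Phi>: "?f n = L * \<Phi>" using L(2) by (auto simp: dvd_def)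
  let ?c = "map_poly complex_of_int"
  have fc: "?c (?f d) = monom 1 d - 1" for d
    by (intro poly_eqI) (simp add: coeff_map_poly)
  have fcn: "monom 1 n - 1 = ?c L * ?c \<Phi>" using fc[of n] \<Phi> by (simp add: map_poly_of_int_mult)
  define \<zeta> where "\<zeta> = cis (2 * pi / n)"
  have \<zeta>n: "\<zeta> ^ n = 1" using n by (simp add: \<zeta>_def DeMoivre)
  have "poly (?c L) \<zeta> \<noteq> 0"
  proof
    assume 0: "poly (?c L) \<zeta> = 0"
    obtain r where "\<Prod>(?f ` ?D) = L * r" using L(3) by (auto simp: dvd_def)
    then have "poly (?c (\<Prod>(?f ` ?D))) \<zeta> = 0" using 0 by (simp add: map_poly_of_int_mult)
    moreover have "?c (\<Prod>(?f ` ?D)) = (\<Prod>g\<in>?f ` ?D. ?c g)"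
      by (rule map_poly_of_int_prod)
    ultimately have "\<exists>d\<in>?D. poly (monom 1 d - 1 :: complex poly) \<zeta> = 0"
      using \<open>finite ?D\<close> by (auto simp: poly_prod fc)
    then show False using primitive_root_power_neq_1[of _ n] by (auto simp: poly_monom \<zeta>_def)
  qed
  moreover have "poly (?c L * ?c \<Phi>) \<zeta> = 0" unfolding fcn[symmetric] using \<zeta>n by (simp add: poly_monom)
  ultimately have root: "poly (?c \<Phi>) \<zeta> = 0" by simp
  have fn0: "?f n \<noteq> 0"
  proof
    assume "?f n = 0"
    then have "poly (?f n) 2 = 0" by simp
    then have "(2::int) ^ n = 1" by (simp add: poly_monom)
    then show False using n power_increasing[of 1 n "2 :: int"] by simp
  qed
  then have "\<Phi> \<noteq> 0" "L \<noteq> 0" using \<Phi> by auto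
  \<comment> \<open>A nonzero integer has absolute value at least 1, so the leading coefficient
    cannot spoil a lower bound obtained from the roots.\<close>
  have lc: "cmod (lead_coeff (?c \<Phi>)) \<ge> 1"
  proof -
    have d: "degree (?c \<Phi>) = degree \<Phi>" by (rule map_poly_degree_eq) (use \<open>\<Phi> \<noteq> 0\<close> in simp)
    have "\<bar>lead_coeff \<Phi>\<bar> \<ge> 1" using \<open>\<Phi> \<noteq> 0\<close> by (smt (verit) leading_coeff_0_iff)
    then have "real_of_int \<bar>lead_coeff \<Phi>\<bar> \<ge> 1" by linarith
    then show ?thesis by (simp add: d coeff_map_poly)
  qed
  have c0: "?c \<Phi> \<noteq> 0" using lc by auto
  then have deg: "degree (?c \<Phi>) > 0" using root by (metis gr0I poly_0_coeff_0 degree_eq_zeroE poly_const_conv pCons_0_0)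
  obtain rt where rt: "smult (lead_coeff (?c \<Phi>)) (\<Prod>i<degree (?c \<Phi>). [:-rt i, 1:]) = ?c \<Phi>"
    by (rule complex_poly_decompose')
  have rt1: "cmod (of_nat q - rt i) > real q - 1" if "i < degree (?c \<Phi>)" for i
  proof -
    have r0: "poly (?c \<Phi>) (rt i) = 0"
      by (subst rt[symmetric]) (use that in \<open>auto simp: poly_prod\<close>)
    then have "poly (monom 1 n - 1) (rt i) = 0" unfolding fcn by simp
    then have rn: "rt i ^ n = 1" by (simp add: poly_monom)
    \<comment> \<open>X - 1 already divides L, so 1 as a root of \<Phi> would be a double root of
      X^n - 1, whose derivative at 1 is n.\<close>
    have "rt i \<noteq> 1"
    proof
      assume r1: "rt i = 1"
      obtain r where r: "L = ?f 1 * r" using L(1)[of 1] n by (auto simp: dvd_def)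
      have "poly (pderiv (monom 1 n - 1)) 1 = poly (pderiv (?c (?f 1) * ?c r * ?c \<Phi>)) 1"
        unfolding fcn r map_poly_of_int_mult ..
      also have "\<dots> = 0" using r0 unfolding fc r1 by (simp add: pderiv_mult poly_monom)
      finally show False using n by (simp add: pderiv_diff pderiv_monom poly_monom)
    qed
    then show ?thesis using norm_diff_root_of_unity[OF rn, of q] n by simp
  qed
  have "cmod (poly (?c \<Phi>) (of_nat q)) > real q - 1"
  proof -
    have "real q - 1 \<ge> 1" using q by simp
    \<comment> \<open>One factor exceeds q - 1, and the others are at least 1 because q \<ge>
      2.\<close>
    have "real q - 1 < cmod (of_nat q - rt 0)" using rt1 deg by simp
    also have "\<dots> = (\<Prod>i\<in>{0}. cmod (of_nat q - rt i))" by simp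
    also have "\<dots> \<le> (\<Prod>i<degree (?c \<Phi>). cmod (of_nat q - rt i))"
    proof (rule prod_mono2)
      fix i assume "i \<in> {..<degree (?c \<Phi>)} - {0}"
      then show "1 \<le> cmod (of_nat q - rt i)" using rt1[of i] \<open>real q - 1 \<ge> 1\<close> by simp
    qed (use deg in auto)
    also have "\<dots> \<le> cmod (lead_coeff (?c \<Phi>)) * (\<Prod>i<degree (?c \<Phi>). cmod (of_nat q - rt i))"
      using lc mult_right_mono[OF lc, of "\<Prod>i<degree (?c \<Phi>). cmod (of_nat q - rt i)"] by (simp add: prod_nonneg)
    also have "\<dots> = cmod (poly (?c \<Phi>) (of_nat q))"
      by (subst (3) rt[symmetric]) (simp add: norm_mult prod_norm poly_prod)
    finally show ?thesis .
  qed
  moreover have "poly (?c \<Phi>) (of_nat q) = of_int (poly \<Phi> (int q))"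
    by (simp add: poly_altdef map_poly_degree_eq \<open>\<Phi> \<noteq> 0\<close> coeff_map_poly)
  ultimately have big: "\<bar>poly \<Phi> (int q)\<bar> > int q - 1" by simp
  have fq: "poly (?f d) (int q) = int (q ^ d - 1)" for d
    using q by (simp add: poly_monom of_nat_diff)
  define P where "P = nat \<bar>poly \<Phi> (int q)\<bar>"
  have Pdvd: "P dvd m" if "poly \<Phi> (int q) dvd int m" for m
    using that by (simp add: P_def nat_dvd_iff)
  show ?thesis
  proof (rule that)
    have "poly (?f n) (int q) = poly L (int q) * poly \<Phi> (int q)" unfolding \<Phi> by simp
    then show "P dvd q ^ n - 1" unfolding fq by (intro Pdvd) simp
    show "P > q - 1" using big q unfolding P_def by linarith
    fix d assume d: "d > 0" "d dvd n" "d < n"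
    then obtain r where r: "L = ?f d * r" using L(1)[of d] by (auto simp: dvd_def)
    have "poly (?f n) (int q) = poly (?f d) (int q) * (poly r (int q) * poly \<Phi> (int q))"
      unfolding \<Phi> r by (simp add: mult_ac)
    then have eq: "int (q ^ n - 1) = int (q ^ d - 1) * (poly r (int q) * poly \<Phi> (int q))" unfolding fq .
    have "q ^ d - 1 > 0" using q d(1) one_less_power[of q d] by simp
    then have "int (q ^ d - 1) \<noteq> 0" by linarith
    then have "int ((q ^ n - 1) div (q ^ d - 1)) = poly r (int q) * poly \<Phi> (int q)"
      unfolding zdiv_int eq by (rule nonzero_mult_div_cancel_left)
    then show "P dvd (q ^ n - 1) div (q ^ d - 1)" by (intro Pdvd) simp
  qed
qed

section \<open>Division subrings, counting of subspaces, and the class equation\<close>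

locale finite_division_ring = ring R for R (structure) +
  assumes finR: "finite (carrier R)" and nontriv: "\<one> \<noteq> \<zero>"
    and left_inverse: "a \<in> carrier R \<Longrightarrow> a \<noteq> \<zero> \<Longrightarrow> \<exists>b\<in>carrier R. b \<otimes> a = \<one>"
begin

lemma no_zero_div:
  assumes "a \<in> carrier R" "b \<in> carrier R" "a \<otimes> b = \<zero>" "a \<noteq> \<zero>"
  shows "b = \<zero>"
proof -
  obtain c where c: "c \<in> carrier R" "c \<otimes> a = \<one>" using left_inverse assms(1,4) by blast
  have "b = (c \<otimes> a) \<otimes> b" using c assms(2) by simp
  also have "\<dots> = c \<otimes> (a \<otimes> b)" by (rule m_assoc[OF c(1) assms(1,2)])
  finally show ?thesis using assms(3) c(1) by simp
qed

lemma right_inverse: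
  assumes "a \<in> carrier R" "b \<in> carrier R" "b \<otimes> a = \<one>"
  shows "a \<otimes> b = \<one>"
proof -
  have "b \<noteq> \<zero>" using assms nontriv by auto
  then obtain c where c: "c \<in> carrier R" "c \<otimes> b = \<one>" using left_inverse assms(2) by blast
  have "c = c \<otimes> (b \<otimes> a)" using assms(3) c(1) by simp
  also have "\<dots> = (c \<otimes> b) \<otimes> a" by (rule m_assoc[symmetric, OF c(1) assms(2,1)])
  finally show ?thesis using c assms(1) by simp
qed

definition divsub :: "'a set \<Rightarrow> bool" where
  "divsub D \<longleftrightarrow> D \<subseteq> carrier R \<and> \<zero> \<in> D \<and> \<one> \<in> D \<and> (\<forall>a\<in>D. \<forall>b\<in>D. a \<ominus> b \<in> D \<and> a \<otimes> b \<in> D) \<and>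
     (\<forall>a\<in>D. \<forall>b\<in>carrier R. b \<otimes> a = \<one> \<longrightarrow> b \<in> D)"

definition subspace :: "'a set \<Rightarrow> 'a set \<Rightarrow> bool" where
  "subspace D S \<longleftrightarrow> S \<subseteq> carrier R \<and> \<zero> \<in> S \<and> (\<forall>a\<in>S. \<forall>b\<in>S. a \<ominus> b \<in> S) \<and> (\<forall>d\<in>D. \<forall>a\<in>S. d \<otimes> a \<in> S)"

lemma subspace_add:
  assumes "subspace D S" "a \<in> S" "b \<in> S"
  shows "a \<oplus> b \<in> S"
proof -
  have c: "a \<in> carrier R" "b \<in> carrier R" "\<zero> \<in> S" using assms by (auto simp: subspace_def)
  have "a \<ominus> (\<zero> \<ominus> b) \<in> S" using assms c by (auto simp: subspace_def)
  moreover have "a \<ominus> (\<zero> \<ominus> b) = a \<oplus> b" using c by (simp add: minus_eq)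
  ultimately show ?thesis by simp
qed

lemma minus_diff_diff:
  assumes "a \<in> carrier R" "b \<in> carrier R" "c \<in> carrier R" "d \<in> carrier R"
  shows "(a \<oplus> b) \<ominus> (c \<oplus> d) = (a \<ominus> c) \<oplus> (b \<ominus> d)"
  using assms by (simp add: minus_eq minus_add a_ac)

lemma l_distr_minus:
  assumes "a \<in> carrier R" "b \<in> carrier R" "c \<in> carrier R"
  shows "(a \<ominus> b) \<otimes> c = a \<otimes> c \<ominus> b \<otimes> c" "c \<otimes> (a \<ominus> b) = c \<otimes> a \<ominus> c \<otimes> b"
  using assms by (simp_all add: minus_eq l_distr r_distr l_minus r_minus)

lemma diff_zero:
  assumes "a \<in> carrier R" "b \<in> carrier R" "a \<ominus> b = \<zero>"
  shows "a = b"
proof -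
  have "a = (a \<ominus> b) \<oplus> b" using assms(1,2) by (simp add: minus_eq a_assoc l_neg)
  then show ?thesis using assms by simp
qed

text \<open>Dimension without bases: take a subspace T of S of largest size among those whose size
  is a power of |D|. A vector x of S outside T would give T + Dx, which is |D| times as
  large.\<close>

lemma card_subspace:
  assumes D: "divsub D" and S: "subspace D S"
  shows "\<exists>m. card S = card D ^ m"
proof -
  have DR: "D \<subseteq> carrier R" using D by (simp add: divsub_def)
  have SR: "S \<subseteq> carrier R" using S by (simp add: subspace_def)
  have finS: "finite S" using SR finR finite_subset by blast
  let ?P = "\<lambda>T. T \<subseteq> S \<and> subspace D T \<and> (\<exists>m. card T = card D ^ m)"
  have "?P {\<zero>}" using S DR by (auto simp: subspace_def minus_eq intro: exI[of _ 0])
  then have "\<exists>T. ?P T \<and> (\<forall>T'. ?P T' \<longrightarrow> card T' \<le> card T)"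
    by (rule ex_has_greatest_nat[where b = "Suc (card S)"]) (use card_mono[OF finS] in \<open>auto simp: less_Suc_eq_le\<close>)
  then obtain T m where T: "T \<subseteq> S" "subspace D T" "card T = card D ^ m"
    and max: "\<And>T'. ?P T' \<Longrightarrow> card T' \<le> card T" by blast
  have TR: "T \<subseteq> carrier R" using T SR by blast
  have "T = S"
  proof (rule ccontr)
    assume "T \<noteq> S"
    then obtain x where x: "x \<in> S" "x \<notin> T" using T by blast
    have xR: "x \<in> carrier R" using x SR by blast
    let ?g = "\<lambda>(t, d). t \<oplus> d \<otimes> x"
    let ?T = "?g ` (T \<times> D)"
    have inj: "inj_on ?g (T \<times> D)"
    proof (rule inj_onI, clarify)
      fix t d t' d' assume *: "t \<in> T" "d \<in> D" "t' \<in> T" "d' \<in> D" "t \<oplus> d \<otimes> x = t' \<oplus> d' \<otimes> x"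
      have c: "t \<in> carrier R" "t' \<in> carrier R" "d \<in> carrier R" "d' \<in> carrier R" using * TR DR by auto
      have "(t \<ominus> t') \<oplus> (d \<ominus> d') \<otimes> x = (t \<oplus> d \<otimes> x) \<ominus> (t' \<oplus> d' \<otimes> x)"
        using c xR by (simp add: l_distr_minus minus_diff_diff)
      also have "\<dots> = \<zero>" unfolding *(5) using c xR by (simp add: minus_eq r_neg)
      finally have z: "(t \<ominus> t') \<oplus> (d \<ominus> d') \<otimes> x = \<zero>" .
      \<comment> \<open>Otherwise dividing by d - d' would put x into T.\<close>
      have "d \<ominus> d' = \<zero>"
      proof (rule ccontr)
        assume nz: "d \<ominus> d' \<noteq> \<zero>"
        have dd: "d \<ominus> d' \<in> D" using * D by (auto simp: divsub_def)
        then obtain e where e: "e \<in> carrier R" "e \<otimes> (d \<ominus> d') = \<one>" using left_inverse nz DR by blast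
        then have eD: "e \<in> D" using D dd by (auto simp: divsub_def)
        have tt: "\<zero> \<ominus> (t \<ominus> t') \<in> T" using T(2) * by (auto simp: subspace_def)
        have "(d \<ominus> d') \<otimes> x = \<zero> \<ominus> (t \<ominus> t')"
          using minus_equality[of "(d \<ominus> d') \<otimes> x" "t \<ominus> t'"] z c xR a_comm[of "t \<ominus> t'" "(d \<ominus> d') \<otimes> x"]
          by (simp add: minus_eq[of \<zero>])
        then have "e \<otimes> ((d \<ominus> d') \<otimes> x) \<in> T" using tt T(2) eD by (auto simp: subspace_def)
        moreover have "e \<otimes> ((d \<ominus> d') \<otimes> x) = x"
          using e c xR by (simp flip: m_assoc)
        ultimately show False using x by simp
      qed
      moreover then have "t \<ominus> t' = \<zero>" using z c xR by simp
      ultimately show "t = t' \<and> d = d'" using c diff_zero by blast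
    qed
    have "finite T" using T(1) finS finite_subset by blast
    have "card ?T = card D ^ Suc m"
      using card_image[OF inj] T(3) by (simp add: card_cartesian_product mult.commute)
    moreover have "?T \<subseteq> S"
      using T(1) x(1) S subspace_add[OF S] by (auto simp: subspace_def)
    moreover have "subspace D ?T" unfolding subspace_def
    proof (intro conjI ballI)
      show "?T \<subseteq> carrier R" using TR DR xR by auto
      have "\<zero> = ?g (\<zero>, \<zero>)" using xR by simp
      moreover have "(\<zero>, \<zero>) \<in> T \<times> D" using T(2) D by (auto simp: subspace_def divsub_def)
      ultimately show "\<zero> \<in> ?T" by (rule image_eqI)
      fix a assume "a \<in> ?T"
      then obtain t d where a: "t \<in> T" "d \<in> D" "a = t \<oplus> d \<otimes> x" by auto
      then have c: "t \<in> carrier R" "d \<in> carrier R" using TR DR by auto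
      show "a \<ominus> b \<in> ?T" if bT: "b \<in> ?T" for b
      proof -
        obtain t' d' where b: "t' \<in> T" "d' \<in> D" "b = t' \<oplus> d' \<otimes> x" using bT by auto
        then have c': "t' \<in> carrier R" "d' \<in> carrier R" using TR DR by auto
        have "a \<ominus> b = ?g (t \<ominus> t', d \<ominus> d')"
          unfolding a b using c c' xR by (simp add: l_distr_minus minus_diff_diff)
        moreover have "(t \<ominus> t', d \<ominus> d') \<in> T \<times> D" using T(2) D a b by (auto simp: subspace_def divsub_def)
        ultimately show ?thesis by (rule image_eqI)
      qed
      show "e \<otimes> a \<in> ?T" if "e \<in> D" for e
      proof -
        have "e \<otimes> a = ?g (e \<otimes> t, e \<otimes> d)"
          unfolding a using c that DR xR by (auto simp: r_distr m_assoc)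
        moreover have "(e \<otimes> t, e \<otimes> d) \<in> T \<times> D" using T(2) D a that by (auto simp: subspace_def divsub_def)
        ultimately show ?thesis by (rule image_eqI)
      qed
    qed
    ultimately have le: "card ?T \<le> card T" by (intro max) blast
    have "card D \<ge> 2"
    proof -
      have "{\<zero>, \<one>} \<subseteq> D" using D by (auto simp: divsub_def)
      then have "card {\<zero>, \<one>} \<le> card D" using DR finR by (intro card_mono) (auto intro: finite_subset)
      then show ?thesis using nontriv by simp
    qed
    then show False using le \<open>card ?T = card D ^ Suc m\<close> T(3) by simp
  qed
  then show ?thesis using T(3) by blast
qed

definition commutant :: "'a set \<Rightarrow> 'a set" where
  "commutant S = {a \<in> carrier R. \<forall>x\<in>S. a \<otimes> x = x \<otimes> a}"

lemma divsub_commutant: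
  assumes S: "S \<subseteq> carrier R"
  shows "divsub (commutant S)"
  unfolding divsub_def
proof (intro conjI ballI impI)
  show "commutant S \<subseteq> carrier R" "\<zero> \<in> commutant S" "\<one> \<in> commutant S"
    using S by (auto simp: commutant_def)
next
  fix a b assume ab: "a \<in> commutant S" "b \<in> commutant S"
  then have c: "a \<in> carrier R" "b \<in> carrier R" by (auto simp: commutant_def)
  show "a \<ominus> b \<in> commutant S"
    using ab c S by (auto simp: commutant_def l_distr_minus subset_iff)
  have "(a \<otimes> b) \<otimes> x = x \<otimes> (a \<otimes> b)" if "x \<in> S" for x
  proof -
    have x: "x \<in> carrier R" "a \<otimes> x = x \<otimes> a" "b \<otimes> x = x \<otimes> b" using ab S that by (auto simp: commutant_def)
    have "(a \<otimes> b) \<otimes> x = a \<otimes> (x \<otimes> b)" using c x by (simp add: m_assoc)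
    also have "\<dots> = (x \<otimes> a) \<otimes> b" using c x by (simp flip: m_assoc)
    also have "\<dots> = x \<otimes> (a \<otimes> b)" using c x(1) by (simp add: m_assoc)
    finally show ?thesis .
  qed
  then show "a \<otimes> b \<in> commutant S" using c by (simp add: commutant_def)
next
  fix a b assume ab: "a \<in> commutant S" "b \<in> carrier R" "b \<otimes> a = \<one>"
  then have a: "a \<in> carrier R" by (simp add: commutant_def)
  have "b \<otimes> x = x \<otimes> b" if "x \<in> S" for x
  proof -
    have x: "x \<in> carrier R" "a \<otimes> x = x \<otimes> a" using ab S that by (auto simp: commutant_def)
    have "b \<otimes> x = b \<otimes> (x \<otimes> (a \<otimes> b))" using right_inverse[OF a ab(2,3)] x ab(2) by simp
    also have "\<dots> = b \<otimes> ((x \<otimes> a) \<otimes> b)" using x(1) a ab(2) by (simp add: m_assoc)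
    also have "\<dots> = b \<otimes> ((a \<otimes> x) \<otimes> b)" using x(2) by simp
    also have "\<dots> = (b \<otimes> a) \<otimes> (x \<otimes> b)" using x(1) a ab(2) by (simp add: m_assoc)
    finally show ?thesis using ab x by simp
  qed
  then show "b \<in> commutant S" using ab by (simp add: commutant_def)
qed

text \<open>The class equation uses the chain from the centre through the centralizer of an element
  to the whole ring; each is a left vector space over the earlier ones.\<close>

lemma subspace_commutant:
  assumes "S \<subseteq> S'" "S' \<subseteq> carrier R"
  shows "subspace (commutant S') (commutant S)"
proof -
  have "commutant S' \<subseteq> commutant S" using assms(1) by (auto simp: commutant_def)
  moreover have "divsub (commutant S)" using assms by (intro divsub_commutant) blast
  ultimately show ?thesis unfolding divsub_def subspace_def by blast
qed

text \<open>Witt's argument: the class equation of the multiplicative group, with \<open>q\<close> the order of the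
  centre, contradicts the divisibility properties of the value of the cyclotomic polynomial at \<open>q\<close>.\<close>

theorem wedderburn:
  assumes "a \<in> carrier R" "b \<in> carrier R"
  shows "a \<otimes> b = b \<otimes> a"
proof -
  define Z where "Z = commutant (carrier R)"
  define q where "q = card Z"
  have Z: "divsub Z" "Z \<subseteq> carrier R" "\<zero> \<in> Z" "\<one> \<in> Z"
    using divsub_commutant[of "carrier R"] by (auto simp: Z_def divsub_def)
  have finZ: "finite Z" using Z(2) finR finite_subset by blast
  have q2: "q \<ge> 2"
    using card_mono[OF finZ, of "{\<zero>, \<one>}"] Z nontriv by (simp add: q_def)
  have R0: "commutant {} = carrier R" by (auto simp: commutant_def)
  obtain n where n: "card (carrier R) = q ^ n"
    using card_subspace[OF Z(1) subspace_commutant[of "{}" "carrier R", folded Z_def]] R0 q_def by auto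
  have "Z = carrier R"
  proof (rule ccontr)
    assume neq: "Z \<noteq> carrier R"
    then have "card Z < card (carrier R)" using Z(2) finR by (intro psubset_card_mono) auto
    then have "q < q ^ n" using n by (simp add: q_def)
    then have n2: "n \<ge> 2" using q2 by (cases "n = 0"; cases "n = 1") auto
    obtain P where P: "P dvd q ^ n - 1" "P > q - 1"
      "\<And>d. d > 0 \<Longrightarrow> d dvd n \<Longrightarrow> d < n \<Longrightarrow> P dvd (q ^ n - 1) div (q ^ d - 1)"
      using cyclotomic_divisor[OF q2 n2] by blast
    let ?G = "carrier R - {\<zero>}"
    define iv where "iv g = (SOME h. h \<in> carrier R \<and> h \<otimes> g = \<one>)" for g
    have iv: "iv g \<in> carrier R" "iv g \<otimes> g = \<one>" if "g \<in> ?G" for g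
      using someI_ex[of "\<lambda>h. h \<in> carrier R \<and> h \<otimes> g = \<one>"] left_inverse[of g] that
      unfolding iv_def by blast+
    have iv': "g \<otimes> iv g = \<one>" if "g \<in> ?G" for g using right_inverse iv[OF that] that by blast
    have Gmult: "g \<otimes> h \<in> ?G" if "g \<in> ?G" "h \<in> ?G" for g h using that no_zero_div by auto
    have ivG: "iv g \<in> ?G" if "g \<in> ?G" for g using iv[OF that] that nontriv by auto
    define cj where "cj g x = g \<otimes> x \<otimes> iv g" for g x
    have cj_iff: "cj g x = y \<longleftrightarrow> g \<otimes> x = y \<otimes> g" if "g \<in> ?G" "x \<in> carrier R" "y \<in> carrier R" for g x y
    proof
      assume "cj g x = y"
      then have "y \<otimes> g = g \<otimes> x \<otimes> (iv g \<otimes> g)" using that iv[OF that(1)] by (auto simp: cj_def m_assoc)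
      then show "g \<otimes> x = y \<otimes> g" using that iv[OF that(1)] by simp
    next
      assume "g \<otimes> x = y \<otimes> g"
      then have "cj g x = y \<otimes> (g \<otimes> iv g)" using that iv[OF that(1)] by (auto simp: cj_def m_assoc)
      then show "cj g x = y" using that iv'[OF that(1)] by simp
    qed
    have cj_closed: "cj g x \<in> carrier R" if "g \<in> ?G" "x \<in> carrier R" for g x
      using that iv[OF that(1)] by (auto simp: cj_def)
    define K where "K x = (\<lambda>g. cj g x) ` ?G" for x
    \<comment> \<open>Orbit and stabilizer: each fibre of g \<mapsto> \<open>cj g x\<close> is a
      left coset of the group of nonzero elements commuting with x.\<close>
    have card_class: "card ?G = card (K x) * card (commutant {x} - {\<zero>})" if x: "x \<in> carrier R" for x
    proof -
      have fib: "card {g \<in> ?G. cj g x = y} = card (commutant {x} - {\<zero>})" if yK: "y \<in> K x" for y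
      proof -
        obtain g where g: "g \<in> ?G" "y = cj g x" using yK by (auto simp: K_def)
        have yR: "y \<in> carrier R" using g cj_closed x by simp
        have gx: "g \<otimes> x = y \<otimes> g" using cj_iff[OF g(1) x yR] g(2) by simp
        have "bij_betw (\<lambda>c. g \<otimes> c) (commutant {x} - {\<zero>}) {h \<in> ?G. cj h x = y}"
        proof (rule bij_betwI[where g = "\<lambda>h. iv g \<otimes> h"])
          show "(\<lambda>c. g \<otimes> c) \<in> commutant {x} - {\<zero>} \<rightarrow> {h \<in> ?G. cj h x = y}"
          proof
            fix c assume c: "c \<in> commutant {x} - {\<zero>}"
            then have cG: "c \<in> ?G" "c \<otimes> x = x \<otimes> c" by (auto simp: commutant_def)
            have "(g \<otimes> c) \<otimes> x = g \<otimes> (x \<otimes> c)" using cG g x by (auto simp: m_assoc)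
            also have "\<dots> = (g \<otimes> x) \<otimes> c" using cG g x by (auto simp: m_assoc)
            also have "\<dots> = y \<otimes> (g \<otimes> c)" unfolding gx using cG g x yR by (auto simp: m_assoc)
            finally show "g \<otimes> c \<in> {h \<in> ?G. cj h x = y}"
              using Gmult[OF g(1) cG(1)] cj_iff[OF _ x yR] by blast
          qed
          show "(\<lambda>h. iv g \<otimes> h) \<in> {h \<in> ?G. cj h x = y} \<rightarrow> commutant {x} - {\<zero>}"
          proof
            fix h assume h: "h \<in> {h \<in> ?G. cj h x = y}"
            then have hG: "h \<in> ?G" and hx: "h \<otimes> x = y \<otimes> h" using cj_iff[OF _ x yR] by auto
            have ig: "iv g \<in> carrier R" using iv(1)[OF g(1)] .
            have "iv g \<otimes> y = iv g \<otimes> (y \<otimes> (g \<otimes> iv g))" using iv'[OF g(1)] yR by simp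
            also have "\<dots> = iv g \<otimes> ((g \<otimes> x) \<otimes> iv g)" unfolding gx using g yR ig by (auto simp: m_assoc)
            also have "\<dots> = (iv g \<otimes> g) \<otimes> (x \<otimes> iv g)" using g x ig by (auto simp: m_assoc)
            finally have igy: "iv g \<otimes> y = x \<otimes> iv g" using iv(2)[OF g(1)] x ig by simp
            have "(iv g \<otimes> h) \<otimes> x = iv g \<otimes> (y \<otimes> h)" using hG hx x ig by (auto simp: m_assoc)
            also have "\<dots> = (iv g \<otimes> y) \<otimes> h" using hG yR ig by (auto simp: m_assoc)
            also have "\<dots> = x \<otimes> (iv g \<otimes> h)" unfolding igy using hG x ig by (auto simp: m_assoc)
            finally show "iv g \<otimes> h \<in> commutant {x} - {\<zero>}"
              using Gmult[OF ivG[OF g(1)] hG] by (auto simp: commutant_def)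
          qed
          show "iv g \<otimes> (g \<otimes> c) = c" if "c \<in> commutant {x} - {\<zero>}" for c
            using that g iv[OF g(1)] by (auto simp: commutant_def simp flip: m_assoc)
          show "g \<otimes> (iv g \<otimes> h) = h" if "h \<in> {h \<in> ?G. cj h x = y}" for h
            using that g iv[OF g(1)] iv'[OF g(1)] by (auto simp flip: m_assoc)
        qed
        then have "card (commutant {x} - {\<zero>}) = card {h \<in> ?G. cj h x = y}" by (rule bij_betw_same_card)
        then show ?thesis by (rule sym)
      qed
      have "card ?G = (\<Sum>y\<in>K x. card {g \<in> ?G. cj g x = y})"
        unfolding card_eq_sum K_def by (rule sum.image_gen) (simp add: finR)
      then show ?thesis using fib by simp
    qed
    have cardG: "card ?G = q ^ n - 1" using n finR by simp
    have Pclass: "P dvd card (K x)" if x: "x \<in> carrier R" "x \<notin> Z" for x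
    proof -
      let ?C = "commutant {x}"
      obtain d where d: "card ?C = q ^ d"
        using card_subspace[OF Z(1) subspace_commutant[of "{x}" "carrier R", folded Z_def]] x q_def by auto
      obtain m where m: "q ^ n = card ?C ^ m"
        using card_subspace[OF divsub_commutant[of "{x}"] subspace_commutant[of "{}" "{x}"]] x R0 n by auto
      have finC: "finite ?C" using finR by (auto simp: commutant_def)
      have z1: "\<zero> \<in> ?C" "\<one> \<in> ?C" using x by (auto simp: commutant_def)
      \<comment> \<open>The whole ring is a vector space over the centralizer, so q^n = (q^d)^m.
        Thus d divides n, as the property of P requires.\<close>
      have "n = d * m" using m q2 unfolding d by (simp flip: power_mult)
      have "?C \<noteq> carrier R"
      proof
        assume "?C = carrier R"
        then have "y \<otimes> x = x \<otimes> y" if "y \<in> carrier R" for y using that by (auto simp: commutant_def)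
        then have "x \<in> Z" using x(1) by (simp add: Z_def commutant_def)
        then show False using x(2) by simp
      qed
      then have "card ?C < card (carrier R)" using finR by (intro psubset_card_mono) (auto simp: commutant_def)
      then have dn: "d < n" using n d q2 by simp
      have "d \<noteq> 0" using \<open>n = d * m\<close> n2 by (cases "d = 0") auto
      have "P dvd (q ^ n - 1) div (q ^ d - 1)" using P(3)[of d] dn \<open>d \<noteq> 0\<close> \<open>n = d * m\<close> by simp
      moreover have "q ^ d - 1 > 0" using q2 \<open>d \<noteq> 0\<close> one_less_power[of q d] by simp
      moreover have "q ^ n - 1 = card (K x) * (q ^ d - 1)"
        using card_class[OF x(1)] finC z1 d unfolding cardG by simp
      ultimately show ?thesis by simp
    qed
    have Kself: "x \<in> K x" if "x \<in> carrier R" for x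
    proof -
      have "cj \<one> x = x" using cj_iff[of \<one> x x] that nontriv by simp
      then show ?thesis using nontriv unfolding K_def by (intro image_eqI[of _ _ \<one>]) auto
    qed
    have KZ: "K x \<inter> Z = {}" if x: "x \<in> carrier R" "x \<notin> Z" for x
    proof (rule ccontr)
      assume "K x \<inter> Z \<noteq> {}"
      then obtain g where g: "g \<in> ?G" "cj g x \<in> Z" by (auto simp: K_def)
      have y: "cj g x \<in> carrier R" using g Z by blast
      have "g \<otimes> x = cj g x \<otimes> g" using cj_iff[OF g(1) x(1) y] by simp
      also have "\<dots> = g \<otimes> cj g x" using g by (auto simp: Z_def commutant_def)
      finally have eq: "g \<otimes> x = g \<otimes> cj g x" .
      have "x = iv g \<otimes> (g \<otimes> x)" using iv[OF g(1)] g x by (auto simp flip: m_assoc)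
      also have "\<dots> = cj g x" unfolding eq using iv[OF g(1)] g y by (auto simp flip: m_assoc)
      finally show False using g x by simp
    qed
    have Ktrans: "y \<in> K x \<Longrightarrow> x \<in> carrier R \<Longrightarrow> K y = K x" for x y
    proof -
      have sub: "K y \<subseteq> K x" if y: "y \<in> K x" and x: "x \<in> carrier R" for x y
      proof
        fix z assume "z \<in> K y"
        then obtain h where h: "h \<in> ?G" "z = cj h y" by (auto simp: K_def)
        obtain g where g: "g \<in> ?G" "y = cj g x" using y by (auto simp: K_def)
        have yR: "y \<in> carrier R" and zR: "z \<in> carrier R" using g h cj_closed x by auto
        have 1: "g \<otimes> x = y \<otimes> g" "h \<otimes> y = z \<otimes> h"
          using cj_iff[OF g(1) x yR] cj_iff[OF h(1) yR zR] g h by auto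
        have "(h \<otimes> g) \<otimes> x = h \<otimes> (y \<otimes> g)" using g h x 1 by (auto simp: m_assoc)
        also have "\<dots> = (h \<otimes> y) \<otimes> g" using g h yR by (auto simp: m_assoc)
        also have "\<dots> = z \<otimes> (h \<otimes> g)" unfolding 1 using g h zR by (auto simp: m_assoc)
        finally have "cj (h \<otimes> g) x = z" using cj_iff[OF Gmult[OF h(1) g(1)] x zR] by simp
        then show "z \<in> K x" using Gmult[OF h(1) g(1)] by (auto simp: K_def)
      qed
      fix x y assume y: "y \<in> K x" and x: "x \<in> carrier R"
      obtain g where g: "g \<in> ?G" "y = cj g x" using y by (auto simp: K_def)
      have yR: "y \<in> carrier R" using g cj_closed x by auto
      have gx: "g \<otimes> x = y \<otimes> g" using cj_iff[OF g(1) x yR] g(2) by simp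
      have ig: "iv g \<in> carrier R" using iv(1)[OF g(1)] .
      have "iv g \<otimes> y = iv g \<otimes> (y \<otimes> (g \<otimes> iv g))" using iv'[OF g(1)] yR by simp
      also have "\<dots> = iv g \<otimes> ((g \<otimes> x) \<otimes> iv g)" unfolding gx using g yR ig by (auto simp: m_assoc)
      also have "\<dots> = (iv g \<otimes> g) \<otimes> (x \<otimes> iv g)" using g x ig by (auto simp: m_assoc)
      finally have "iv g \<otimes> y = x \<otimes> iv g" using iv(2)[OF g(1)] x ig by simp
      then have "cj (iv g) y = x" using cj_iff[OF ivG[OF g(1)] yR x] by simp
      then have "x \<in> K y" using ivG[OF g(1)] by (auto simp: K_def)
      then show "K y = K x" using sub y x yR by blast
    qed
    have KR: "K x \<subseteq> carrier R" if "x \<in> carrier R" for x using cj_closed that by (auto simp: K_def)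
    have un: "carrier R - Z = \<Union>(K ` (carrier R - Z))"
      using Kself KR KZ by blast
    have "P dvd card (\<Union>(K ` (carrier R - Z)))"
    proof (rule dvd_partition)
      show "finite (\<Union>(K ` (carrier R - Z)))" by (rule finite_subset[OF _ finR]) (use KR in blast)
      show "\<forall>c\<in>K ` (carrier R - Z). P dvd card c" using Pclass by auto
      show "\<forall>c1\<in>K ` (carrier R - Z). \<forall>c2\<in>K ` (carrier R - Z). c1 \<noteq> c2 \<longrightarrow> c1 \<inter> c2 = {}"
        using Ktrans by blast
    qed
    then have "P dvd card (carrier R - Z)" unfolding un[symmetric] .
    \<comment> \<open>P divides q^n - 1 and also the number of noncentral elements, hence their
      difference q - 1, although P is larger than that.\<close>
    moreover have "card (carrier R - Z) = (q ^ n - 1) - (q - 1)"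
      using card_Diff_subset[OF finZ Z(2)] n q2 by (simp add: q_def)
    moreover have "q - 1 \<le> q ^ n - 1" using \<open>q < q ^ n\<close> by linarith
    ultimately have "P dvd q - 1" using P(1) by (metis dvd_diffD1)
    then show False using P(2) q2 by (auto dest: dvd_imp_le)
  qed
  then show ?thesis using assms by (auto simp: Z_def commutant_def)
qed

end

text \<open>Two members of K may agree on Q and differ elsewhere, so the ring is built from their
  restrictions to Q. It is a finite division ring, and Wedderburn's theorem applies.\<close>

lemma finite_skew_field_commutes:
  fixes pl :: "'a \<Rightarrow> 'a \<Rightarrow> 'a"
  assumes fin: "finite Q" and z: "z \<in> Q" and pl: "\<And>x y. x \<in> Q \<Longrightarrow> y \<in> Q \<Longrightarrow> pl x y \<in> Q"
    and ng: "\<And>x. x \<in> Q \<Longrightarrow> ng x \<in> Q"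
    and assoc: "\<And>x y w. x \<in> Q \<Longrightarrow> y \<in> Q \<Longrightarrow> w \<in> Q \<Longrightarrow> pl (pl x y) w = pl x (pl y w)"
    and comm: "\<And>x y. x \<in> Q \<Longrightarrow> y \<in> Q \<Longrightarrow> pl x y = pl y x"
    and zero: "\<And>x. x \<in> Q \<Longrightarrow> pl z x = x" and neg: "\<And>x. x \<in> Q \<Longrightarrow> pl (ng x) x = z"
    and K: "\<And>k x. k \<in> K \<Longrightarrow> x \<in> Q \<Longrightarrow> k x \<in> Q"
    and hom: "\<And>k x y. k \<in> K \<Longrightarrow> x \<in> Q \<Longrightarrow> y \<in> Q \<Longrightarrow> k (pl x y) = pl (k x) (k y)"
    and K_id: "id \<in> K" and K_zero: "(\<lambda>x. z) \<in> K"
    and K_add: "\<And>k l. k \<in> K \<Longrightarrow> l \<in> K \<Longrightarrow> (\<lambda>x. pl (k x) (l x)) \<in> K"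
    and K_comp: "\<And>k l. k \<in> K \<Longrightarrow> l \<in> K \<Longrightarrow> k \<circ> l \<in> K"
    and K_neg: "\<And>k. k \<in> K \<Longrightarrow> (\<lambda>x. ng (k x)) \<in> K"
    and K_inv: "\<And>k x. k \<in> K \<Longrightarrow> x \<in> Q \<Longrightarrow> k x \<noteq> z \<Longrightarrow> \<exists>l\<in>K. \<forall>x\<in>Q. l (k x) = x"
    and kl: "k \<in> K" "l \<in> K" and x: "x \<in> Q"
  shows "k (l x) = l (k x)"
proof (cases "\<exists>y\<in>Q. y \<noteq> z")
  case False
  then show ?thesis using K kl x by metis
next
  case True
  then obtain y0 where y0: "y0 \<in> Q" "y0 \<noteq> z" by blast
  define r where "r = (\<lambda>k :: 'a \<Rightarrow> 'a. restrict k Q)"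
  define R where "R = \<lparr>carrier = r ` K, monoid.mult = (\<lambda>f g. r (\<lambda>x. f (g x))), monoid.one = r id,
    ring.zero = r (\<lambda>_. z), ring.add = (\<lambda>f g. r (\<lambda>x. pl (f x) (g x)))\<rparr>"
  have sim: "carrier R = r ` K" "monoid.mult R = (\<lambda>f g. r (\<lambda>x. f (g x)))" "\<one>\<^bsub>R\<^esub> = r id"
    "\<zero>\<^bsub>R\<^esub> = r (\<lambda>_. z)" "ring.add R = (\<lambda>f g. r (\<lambda>x. pl (f x) (g x)))"
    by (simp_all add: R_def)
  have req: "r f = r g \<longleftrightarrow> (\<forall>x\<in>Q. f x = g x)" for f g
    unfolding r_def by (metis restrict_apply' restrict_ext)
  have r_ap: "r f x = f x" if "x \<in> Q" for f x using that by (simp add: r_def)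
  have add_r: "r f \<oplus>\<^bsub>R\<^esub> r g = r (\<lambda>x. pl (f x) (g x))" for f g
    unfolding sim req by (simp add: r_ap)
  have mult_r: "r f \<otimes>\<^bsub>R\<^esub> r g = r (f \<circ> g)" if "g \<in> K" for f g
    unfolding sim req using K[OF that] by (simp add: r_ap)
  have rK: "r f \<in> carrier R" if "f \<in> K" for f using that by (simp add: sim)
  have kz: "f z = z" if "f \<in> K" for f
  proof -
    have fz: "f z \<in> Q" using K[OF that z] .
    have "f z = pl (f z) (f z)" using hom[OF that z z] zero[OF z] by simp
    then have "z = pl (ng (f z)) (pl (f z) (f z))" using neg[OF fz] by simp
    also have "\<dots> = pl (pl (ng (f z)) (f z)) (f z)" using assoc[OF ng[OF fz] fz fz] by simp
    also have "\<dots> = f z" using neg[OF fz] zero[OF fz] by simp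
    finally show ?thesis by simp
  qed
  have "abelian_group R"
  proof (rule abelian_groupI)
    show "\<zero>\<^bsub>R\<^esub> \<in> carrier R" using K_zero by (simp add: sim)
    fix f assume "f \<in> carrier R"
    then obtain f' where f: "f = r f'" "f' \<in> K" by (auto simp: sim)
    show "\<zero>\<^bsub>R\<^esub> \<oplus>\<^bsub>R\<^esub> f = f" unfolding f sim req using zero K[OF f(2)] z by (simp add: r_ap)
    have "r (\<lambda>x. ng (f' x)) \<oplus>\<^bsub>R\<^esub> f = \<zero>\<^bsub>R\<^esub>"
      unfolding f add_r unfolding sim req using neg K[OF f(2)] by simp
    then show "\<exists>g\<in>carrier R. g \<oplus>\<^bsub>R\<^esub> f = \<zero>\<^bsub>R\<^esub>" using rK[OF K_neg[OF f(2)]] by blast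
    fix g assume "g \<in> carrier R"
    then obtain g' where g: "g = r g'" "g' \<in> K" by (auto simp: sim)
    show "f \<oplus>\<^bsub>R\<^esub> g \<in> carrier R" unfolding f g add_r by (rule rK[OF K_add[OF f(2) g(2)]])
    show "f \<oplus>\<^bsub>R\<^esub> g = g \<oplus>\<^bsub>R\<^esub> f" unfolding f g add_r req using comm K f(2) g(2) by blast
    fix h assume "h \<in> carrier R"
    then obtain h' where h: "h = r h'" "h' \<in> K" by (auto simp: sim)
    show "f \<oplus>\<^bsub>R\<^esub> g \<oplus>\<^bsub>R\<^esub> h = f \<oplus>\<^bsub>R\<^esub> (g \<oplus>\<^bsub>R\<^esub> h)"
      unfolding f g h add_r req using assoc K f(2) g(2) h(2) by blast
  qed
  moreover have "Group.monoid R"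
  proof (rule monoidI)
    show "\<one>\<^bsub>R\<^esub> \<in> carrier R" using K_id by (simp add: sim)
    fix f assume "f \<in> carrier R"
    then obtain f' where f: "f = r f'" "f' \<in> K" by (auto simp: sim)
    show "\<one>\<^bsub>R\<^esub> \<otimes>\<^bsub>R\<^esub> f = f" unfolding f sim req using K[OF f(2)] by (simp add: r_ap)
    show "f \<otimes>\<^bsub>R\<^esub> \<one>\<^bsub>R\<^esub> = f" unfolding f sim req by (simp add: r_ap)
    fix g assume "g \<in> carrier R"
    then obtain g' where g: "g = r g'" "g' \<in> K" by (auto simp: sim)
    show "f \<otimes>\<^bsub>R\<^esub> g \<in> carrier R" unfolding f g mult_r[OF g(2)] by (rule rK[OF K_comp[OF f(2) g(2)]])
    fix h assume "h \<in> carrier R"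
    then obtain h' where h: "h = r h'" "h' \<in> K" by (auto simp: sim)
    show "f \<otimes>\<^bsub>R\<^esub> g \<otimes>\<^bsub>R\<^esub> h = f \<otimes>\<^bsub>R\<^esub> (g \<otimes>\<^bsub>R\<^esub> h)"
      unfolding f g h mult_r[OF g(2)] mult_r[OF h(2)] mult_r[OF K_comp[OF g(2) h(2)]] by (simp add: comp_assoc)
  qed
  ultimately have "ring R"
  proof (rule ringI)
    fix f g h assume "f \<in> carrier R" "g \<in> carrier R" "h \<in> carrier R"
    then obtain f' g' h' where f: "f = r f'" "f' \<in> K" and g: "g = r g'" "g' \<in> K" and h: "h = r h'" "h' \<in> K"
      by (auto simp: sim)
    show "(f \<oplus>\<^bsub>R\<^esub> g) \<otimes>\<^bsub>R\<^esub> h = f \<otimes>\<^bsub>R\<^esub> h \<oplus>\<^bsub>R\<^esub> g \<otimes>\<^bsub>R\<^esub> h"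
      unfolding f g h add_r mult_r[OF h(2)] by (simp add: comp_def)
    show "h \<otimes>\<^bsub>R\<^esub> (f \<oplus>\<^bsub>R\<^esub> g) = h \<otimes>\<^bsub>R\<^esub> f \<oplus>\<^bsub>R\<^esub> h \<otimes>\<^bsub>R\<^esub> g"
      unfolding f g h add_r mult_r[OF f(2)] mult_r[OF g(2)] mult_r[OF K_add[OF f(2) g(2)]] req
      using hom[OF h(2)] K f(2) g(2) by simp
  qed
  then interpret ring R .
  interpret finite_division_ring R
  proof
    have "carrier R \<subseteq> PiE Q (\<lambda>_. Q)" unfolding sim r_def using K by (auto simp: PiE_def)
    then show "finite (carrier R)" by (rule finite_subset) (simp add: finite_PiE fin)
    show "\<one>\<^bsub>R\<^esub> \<noteq> \<zero>\<^bsub>R\<^esub>"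
    proof
      assume "\<one>\<^bsub>R\<^esub> = \<zero>\<^bsub>R\<^esub>"
      then have "\<forall>x\<in>Q. id x = z" unfolding sim req .
      then show False using y0 by simp
    qed
    fix f assume fR: "f \<in> carrier R" "f \<noteq> \<zero>\<^bsub>R\<^esub>"
    then obtain f' where f: "f = r f'" "f' \<in> K" by (auto simp: sim)
    have "\<not> (\<forall>x\<in>Q. f' x = z)" using fR(2) unfolding f sim req .
    then obtain x' where "x' \<in> Q" "f' x' \<noteq> z" by blast
    then obtain h where h: "h \<in> K" "\<forall>x\<in>Q. h (f' x) = x" using K_inv[OF f(2)] by blast
    have "r h \<otimes>\<^bsub>R\<^esub> f = \<one>\<^bsub>R\<^esub>" unfolding f mult_r[OF f(2)] unfolding sim req using h(2) by simp
    then show "\<exists>g\<in>carrier R. g \<otimes>\<^bsub>R\<^esub> f = \<one>\<^bsub>R\<^esub>" using rK[OF h(1)] by blast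
  qed
  have "r k \<otimes>\<^bsub>R\<^esub> r l = r l \<otimes>\<^bsub>R\<^esub> r k" using wedderburn rK kl by blast
  then show ?thesis unfolding mult_r[OF kl(1)] mult_r[OF kl(2)] req using x by simp
qed

section \<open>Polynomial operations and rigidity\<close>

text \<open>An orbit in U enters its cycle after at most |U| steps, and the cycle has length at most
  |U|. The factorial of |U| is a multiple of every such length and not smaller than |U|, so this one
  exponent makes the iterate idempotent for all f and x.\<close>

lemma funpow_fact_idem:
  fixes f :: "'a \<Rightarrow> 'a"
  assumes "finite U" "f ` U \<subseteq> U" "x \<in> U"
  shows "(f ^^ fact (card U)) ((f ^^ fact (card U)) x) = (f ^^ fact (card U)) x"
proof -
  let ?m = "fact (card U) :: nat"
  have inU: "(f ^^ i) x \<in> U" for i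
    using assms by (induction i) auto
  have "\<not> inj_on (\<lambda>i. (f ^^ i) x) {..card U}"
  proof
    assume "inj_on (\<lambda>i. (f ^^ i) x) {..card U}"
    then have "card {..card U} \<le> card U"
      using inU by (intro card_inj_on_le[OF _ _ assms(1)]) auto
    then show False by simp
  qed
  then obtain i j where "i \<le> card U" "j \<le> card U" "i \<noteq> j" "(f ^^ i) x = (f ^^ j) x"
    by (auto simp: inj_on_def)
  then obtain i j where ij: "i < j" "j \<le> card U" "(f ^^ i) x = (f ^^ j) x"
    by (metis linorder_neqE_nat)
  define p where "p = j - i"
  have p: "0 < p" "p \<le> card U" using ij by (auto simp: p_def)
  have per: "(f ^^ (k + p)) x = (f ^^ k) x" if "i \<le> k" for k
  proof -
    have "(f ^^ (k + p)) x = (f ^^ ((k - i) + j)) x"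
      using that ij by (simp add: p_def)
    also have "\<dots> = (f ^^ (k - i)) ((f ^^ j) x)" by (simp only: funpow_add comp_apply)
    also have "\<dots> = (f ^^ (k - i)) ((f ^^ i) x)" using ij by simp
    also have "\<dots> = (f ^^ ((k - i) + i)) x" by (simp only: funpow_add comp_apply)
    also have "\<dots> = (f ^^ k) x" using that by simp
    finally show ?thesis .
  qed
  have per': "(f ^^ (k + l * p)) x = (f ^^ k) x" if "i \<le> k" for k l
    using that
  proof (induction l)
    case (Suc l)
    have "(f ^^ (k + Suc l * p)) x = (f ^^ ((k + l * p) + p)) x" by (simp add: add_ac)
    also have "\<dots> = (f ^^ (k + l * p)) x" using Suc.prems by (intro per) auto
    finally show ?case using Suc by simp
  qed simp
  have "p dvd ?m" using p by (intro dvd_fact) auto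
  then obtain l where l: "?m = l * p" by (metis dvd_def mult.commute)
  have "i \<le> ?m" using ij fact_ge_self[of "card U"] by linarith
  then have "(f ^^ (?m + ?m)) x = (f ^^ ?m) x" using per'[of ?m l] l by simp
  then show ?thesis by (simp add: funpow_add)
qed

lemma funpow_image:
  "f ` U \<subseteq> U \<Longrightarrow> (f ^^ m) ` U \<subseteq> U"
  by (induction m) auto

lemma funpow_fact_id:
  assumes "finite U" "bij_betw f U U" "x \<in> U"
  shows "(f ^^ fact (card U)) x = x"
proof -
  let ?g = "f ^^ fact (card U)"
  have "f ` U \<subseteq> U" using assms by (auto simp: bij_betw_def)
  then have "?g (?g x) = ?g x"
    using funpow_fact_idem[OF assms(1) _ assms(3)] by simp
  moreover have "?g x \<in> U"
    using funpow_image[OF \<open>f ` U \<subseteq> U\<close>] assms(3) by (rule subsetD[OF _ imageI])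
  moreover have "bij_betw ?g U U" using bij_betw_funpow[OF assms(2)] .
  ultimately show ?thesis using assms(3) by (auto simp: bij_betw_def inj_on_def)
qed

text \<open>A quasi-identity, and hence inherited by powers; \<open>rigid_perm\<close> below is the form in which it is applied.\<close>

definition rigid :: "('i \<Rightarrow> nat) \<Rightarrow> 'a set \<Rightarrow> ('i \<Rightarrow> 'a list \<Rightarrow> 'a) \<Rightarrow> bool" where
  "rigid ar X F \<longleftrightarrow> (\<forall>k t as bs x. (Suc k, t) \<in> polys ar {} F \<longrightarrow> length as = k \<longrightarrow> length bs = k \<longrightarrow>
     set as \<subseteq> X \<longrightarrow> set bs \<subseteq> X \<longrightarrow> x \<in> X \<longrightarrow> t (x # as) = x \<longrightarrow>
     t (t (x # bs) # as) = t (x # bs) \<longrightarrow> t (t (x # bs) # bs) = t (x # bs) \<longrightarrow> t (x # bs) = x)"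

definition subuniv :: "('i \<Rightarrow> nat) \<Rightarrow> ('i \<Rightarrow> 'a list \<Rightarrow> 'a) \<Rightarrow> 'a set \<Rightarrow> bool" where
  "subuniv ar F S \<longleftrightarrow> (\<forall>i xs. length xs = ar i \<longrightarrow> set xs \<subseteq> S \<longrightarrow> F i xs \<in> S)"

text \<open>Polynomials with constants in \<open>C\<close>, so term operations for \<open>C = {}\<close>. Values on lists of the wrong
  length are ignored, unlike in \<open>polys\<close>.\<close>

definition pol :: "('i \<Rightarrow> nat) \<Rightarrow> ('i \<Rightarrow> 'a list \<Rightarrow> 'a) \<Rightarrow> 'a set \<Rightarrow> nat \<Rightarrow> ('a list \<Rightarrow> 'a) \<Rightarrow> bool" where
  "pol ar F C n f \<longleftrightarrow> (\<exists>p. (n, p) \<in> polys ar C F \<and> (\<forall>xs. length xs = n \<longrightarrow> f xs = p xs))"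

definition upol :: "('i \<Rightarrow> nat) \<Rightarrow> ('i \<Rightarrow> 'a list \<Rightarrow> 'a) \<Rightarrow> 'a set \<Rightarrow> ('a \<Rightarrow> 'a) \<Rightarrow> bool" where
  "upol ar F C f \<longleftrightarrow> pol ar F C (Suc 0) (\<lambda>xs. f (xs ! 0))"

section \<open>Closure properties of polynomial operations\<close>

lemma pol_cong: "pol ar F C n f \<Longrightarrow> (\<And>xs. length xs = n \<Longrightarrow> g xs = f xs) \<Longrightarrow> pol ar F C n g"
  unfolding pol_def by fastforce

lemma pol_proj: "j < n \<Longrightarrow> pol ar F C n (\<lambda>xs. xs ! j)"
  unfolding pol_def by (rule exI[of _ "\<lambda>xs. xs ! j"]) (simp add: polys.proj)

lemma pol_const: "c \<in> C \<Longrightarrow> pol ar F C n (\<lambda>xs. c)"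
  unfolding pol_def by (rule exI[of _ "\<lambda>xs. c"]) (simp add: polys.const)

lemma pol_app:
  assumes "\<And>j. j < ar i \<Longrightarrow> pol ar F C n (g j)"
  shows "pol ar F C n (\<lambda>xs. F i (map (\<lambda>j. g j xs) [0..<ar i]))"
proof -
  have "\<forall>j. \<exists>p. j < ar i \<longrightarrow> (n, p) \<in> polys ar C F \<and> (\<forall>xs. length xs = n \<longrightarrow> g j xs = p xs)"
    using assms unfolding pol_def by blast
  then obtain p where p: "\<And>j. j < ar i \<Longrightarrow> (n, p j) \<in> polys ar C F"
    "\<And>j xs. j < ar i \<Longrightarrow> length xs = n \<Longrightarrow> g j xs = p j xs" by metis
  have "(n, \<lambda>xs. F i (map (\<lambda>j. p j xs) [0..<ar i])) \<in> polys ar C F"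
    using p(1) by (rule polys.app)
  moreover have "F i (map (\<lambda>j. g j xs) [0..<ar i]) = F i (map (\<lambda>j. p j xs) [0..<ar i])"
    if "length xs = n" for xs
    using p(2) that by (intro arg_cong[where f = "F i"] map_cong) auto
  ultimately show ?thesis unfolding pol_def by (intro exI[of _ "\<lambda>xs. F i (map (\<lambda>j. p j xs) [0..<ar i])"]) simp
qed

text \<open>The case \<open>cong\<close> is the price for ignoring lists of the wrong length: the
  property must pass to functions that agree on lists of length n.\<close>

lemma pol_induct [consumes 1, case_names proj const app cong]:
  assumes "pol ar F C n f"
    and "\<And>j. j < n \<Longrightarrow> P (\<lambda>xs. xs ! j)"
    and "\<And>c. c \<in> C \<Longrightarrow> P (\<lambda>xs. c)"
    and "\<And>i g. (\<And>j. j < ar i \<Longrightarrow> pol ar F C n (g j)) \<Longrightarrow> (\<And>j. j < ar i \<Longrightarrow> P (g j)) \<Longrightarrow>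
          P (\<lambda>xs. F i (map (\<lambda>j. g j xs) [0..<ar i]))"
    and "\<And>f g. P f \<Longrightarrow> (\<And>xs. length xs = n \<Longrightarrow> g xs = f xs) \<Longrightarrow> P g"
  shows "P f"
proof -
  obtain p where p: "(n, p) \<in> polys ar C F" "\<And>xs. length xs = n \<Longrightarrow> f xs = p xs"
    using assms(1) unfolding pol_def by blast
  have "P p" using p(1)
  proof (induction n' \<equiv> n p rule: polys.induct)
    case (proj j)
    then show ?case using assms(2) by simp
  next
    case (const c)
    then show ?case using assms(3) by simp
  next
    case (app i g)
    then show ?case by (intro assms(4)) (auto simp: pol_def)
  qed
  then show ?thesis using assms(5) p(2) by blast
qed

lemma pol_comp:
  assumes "pol ar F C m f" "\<And>j. j < m \<Longrightarrow> pol ar F C n (g j)"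
  shows "pol ar F C n (\<lambda>xs. f (map (\<lambda>j. g j xs) [0..<m]))"
  using assms(1)
proof (induction rule: pol_induct)
  case (proj j)
  show ?case by (rule pol_cong[OF assms(2)[OF proj]]) (use proj in simp)
next
  case (const c)
  then show ?case by (rule pol_const)
next
  case (app i h)
  show ?case using app(2) by (rule pol_app)
next
  case (cong f g)
  show ?case using cong(1) by (rule pol_cong) (use cong(2) in simp)
qed

lemma pol_mono: "pol ar F C n f \<Longrightarrow> C \<subseteq> C' \<Longrightarrow> pol ar F C' n f"
proof (induction rule: pol_induct)
  case (app i g)
  show ?case by (rule pol_app) (use app in blast)
next
  case (cong f g)
  show ?case by (rule pol_cong[of _ _ _ _ f]) (use cong in blast)+
qed (auto intro: pol_proj pol_const)

lemma pol_closed: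
  "pol ar F C n f \<Longrightarrow> subuniv ar F S \<Longrightarrow> C \<subseteq> S \<Longrightarrow> length xs = n \<Longrightarrow> set xs \<subseteq> S \<Longrightarrow> f xs \<in> S"
proof (induction rule: pol_induct)
  case (app i g)
  have "set (map (\<lambda>j. g j xs) [0..<ar i]) \<subseteq> S" using app by auto
  then show ?case using app.prems(1) unfolding subuniv_def by simp
qed (auto simp: subset_iff)

text \<open>Constants become arguments. With \<open>ls\<close> an enumeration of the algebra, a
  polynomial turns into a term operation with parameters; with \<open>ls\<close> a single element
  that generates everything over C, all constants are expressed through it.\<close>

lemma pol_param:
  assumes "pol ar F D n f" "length ls = m"
    and "\<And>c. c \<in> D \<Longrightarrow> \<exists>h. pol ar F C m h \<and> h ls = c"
  shows "\<exists>g. pol ar F C (m + n) g \<and> (\<forall>xs. length xs = n \<longrightarrow> f xs = g (ls @ xs))"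
  using assms(1)
proof (induction rule: pol_induct)
  case (proj j)
  show ?case
    by (rule exI[of _ "\<lambda>xs. xs ! (m + j)"]) (use proj assms(2) in \<open>auto intro: pol_proj simp: nth_append\<close>)
next
  case (const c)
  then obtain h where h: "pol ar F C m h" "h ls = c" using assms(3) by blast
  have "pol ar F C (m + n) (\<lambda>xs. h (map (\<lambda>j. xs ! j) [0..<m]))"
    by (rule pol_comp[OF h(1)]) (simp add: pol_proj)
  then have "pol ar F C (m + n) (\<lambda>xs. h (take m xs))"
  proof (rule pol_cong)
    fix xs :: "'b list" assume "length xs = m + n"
    then have "take m xs = map (\<lambda>j. xs ! j) [0..<m]" by (intro nth_equalityI) auto
    then show "h (take m xs) = h (map (\<lambda>j. xs ! j) [0..<m])" by simp
  qed
  then show ?case using h assms(2) by (intro exI[of _ "\<lambda>xs. h (take m xs)"]) simp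
next
  case (app i g)
  then have "\<forall>j. \<exists>h. j < ar i \<longrightarrow> pol ar F C (m + n) h \<and> (\<forall>xs. length xs = n \<longrightarrow> g j xs = h (ls @ xs))"
    by blast
  then obtain h where h: "\<And>j. j < ar i \<Longrightarrow> pol ar F C (m + n) (h j)"
    "\<And>j xs. j < ar i \<Longrightarrow> length xs = n \<Longrightarrow> g j xs = h j (ls @ xs)" by metis
  show ?case
    by (rule exI[of _ "\<lambda>xs. F i (map (\<lambda>j. h j xs) [0..<ar i])"], intro conjI pol_app h allI impI
        arg_cong[where f = "F i"] map_cong) (auto intro: h)
next
  case (cong f g)
  then show ?case by metis
qed

lemma pol_fix:
  assumes "pol ar F C (m + n) g" "length ls = m" "set ls \<subseteq> C"
  shows "pol ar F C n (\<lambda>xs. g (ls @ xs))"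
proof -
  have "pol ar F C n (\<lambda>xs. g (map (\<lambda>j. if j < m then ls ! j else xs ! (j - m)) [0..<m + n]))"
  proof (rule pol_comp[OF assms(1)])
    fix j assume "j < m + n"
    then show "pol ar F C n (\<lambda>xs. if j < m then ls ! j else xs ! (j - m))"
      using assms(2,3) by (cases "j < m") (auto intro!: pol_const pol_proj)
  qed
  then show ?thesis
  proof (rule pol_cong)
    fix xs :: "'b list" assume xs: "length xs = n"
    have "ls @ xs = map (\<lambda>j. if j < m then ls ! j else xs ! (j - m)) [0..<m + n]"
      using assms(2) xs by (intro nth_equalityI) (auto simp: nth_append)
    then show "g (ls @ xs) = g (map (\<lambda>j. if j < m then ls ! j else xs ! (j - m)) [0..<m + n])" by simp
  qed
qed

lemma list_map_nth: "length xs = n \<Longrightarrow> map (\<lambda>j. xs ! j) [0..<n] = xs"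
  using map_nth by blast

lemma upol_comp_pol: 
  assumes "upol ar F C f" "pol ar F C n g"
  shows "pol ar F C n (\<lambda>xs. f (g xs))"
  using pol_comp[of ar F C "Suc 0" "\<lambda>xs. f (xs ! 0)" n "\<lambda>_. g"] assms unfolding upol_def by simp

lemma upol_id: "upol ar F C (\<lambda>x. x)"
  unfolding upol_def by (simp add: pol_proj)

lemma upol_comp: "upol ar F C f \<Longrightarrow> upol ar F C g \<Longrightarrow> upol ar F C (\<lambda>x. f (g x))"
  using upol_comp_pol[of ar F C f "Suc 0" "\<lambda>xs. g (xs ! 0)"] unfolding upol_def by simp

lemma upol_const: "c \<in> C \<Longrightarrow> upol ar F C (\<lambda>x. c)"
  unfolding upol_def by (simp add: pol_const)

lemma upol_funpow: "upol ar F C f \<Longrightarrow> upol ar F C (f ^^ m)"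
proof (induction m)
  case 0
  then show ?case using upol_id[of ar F C] by (simp add: id_def)
next
  case (Suc m)
  then show ?case using upol_comp[of ar F C f "f ^^ m"] by (simp add: comp_def)
qed

lemma upol_mono: "upol ar F C f \<Longrightarrow> C \<subseteq> C' \<Longrightarrow> upol ar F C' f"
  unfolding upol_def by (rule pol_mono)

lemma upol_closed: "upol ar F C f \<Longrightarrow> subuniv ar F S \<Longrightarrow> C \<subseteq> S \<Longrightarrow> x \<in> S \<Longrightarrow> f x \<in> S"
  unfolding upol_def using pol_closed[of ar F C "Suc 0" "\<lambda>xs. f (xs ! 0)" S "[x]"] by simp

text \<open>Brings a variable at position i to the front, so that all else, including the
  overwritten entry, counts as a parameter for \<open>rigid_perm\<close>.\<close>

lemma pol_upd:
  assumes "pol ar F C n f" "upol ar F C p" "i < n"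
  shows "pol ar F C (Suc n) (\<lambda>xs. f ((tl xs)[i := p (hd xs)]))"
proof -
  have "pol ar F C (Suc n) (\<lambda>xs. f (map (\<lambda>j. if j = i then p (xs ! 0) else xs ! Suc j) [0..<n]))"
  proof (rule pol_comp[OF assms(1)])
    fix j assume "j < n"
    then show "pol ar F C (Suc n) (\<lambda>xs. if j = i then p (xs ! 0) else xs ! Suc j)"
      by (cases "j = i") (simp_all add: pol_proj upol_comp_pol[OF assms(2) pol_proj])
  qed
  then show ?thesis
  proof (rule pol_cong)
    fix xs :: "'b list" assume xs: "length xs = Suc n"
    have "(tl xs)[i := p (hd xs)] = map (\<lambda>j. if j = i then p (xs ! 0) else xs ! Suc j) [0..<n]"
      using xs assms(3) by (cases xs) (auto intro!: nth_equalityI simp: nth_list_update)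
    then show "f ((tl xs)[i := p (hd xs)]) = f (map (\<lambda>j. if j = i then p (xs ! 0) else xs ! Suc j) [0..<n])"
      by simp
  qed
qed

lemma pol_Cons_upol:
  assumes "pol ar F C (Suc n) t" "length as = n" "set as \<subseteq> C"
  shows "upol ar F C (\<lambda>x. t (x # as))"
proof -
  have "pol ar F C (Suc 0) (\<lambda>xs. t (map (\<lambda>j. if j = 0 then xs ! 0 else as ! (j - 1)) [0..<Suc n]))"
  proof (rule pol_comp[OF assms(1)])
    fix j assume "j < Suc n"
    then show "pol ar F C (Suc 0) (\<lambda>xs. if j = 0 then xs ! 0 else as ! (j - 1))"
      using assms(2,3) by (cases "j = 0") (auto intro!: pol_const pol_proj simp: subset_iff)
  qed
  moreover have "map (\<lambda>j. if j = 0 then x else as ! (j - 1)) [0..<Suc n] = x # as" for x :: 'b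
    using assms(2) by (intro nth_equalityI) (auto simp: nth_Cons' simp del: upt_Suc)
  ultimately show ?thesis unfolding upol_def by simp
qed

lemma upol_upd:
  assumes "pol ar F C n f" "upol ar F C p" "i < n" "length w = n" "set w \<subseteq> C"
  shows "upol ar F C (\<lambda>z. f (w[i := p z]))"
  using pol_Cons_upol[OF pol_upd[OF assms(1-3)] assms(4,5)] by simp

text \<open>The parameters stay variables, so the iterates for different parameters are instances of
  one operation, and rigidity can compare them.\<close>

lemma pol_iter:
  assumes "pol ar F C (Suc n) t"
  shows "pol ar F C (Suc n) (\<lambda>xs. ((\<lambda>x. t (x # tl xs)) ^^ m) (hd xs))"
proof (induction m)
  case 0
  show ?case by (rule pol_cong[OF pol_proj[of 0]]) (auto simp: length_Suc_conv)
next
  case (Suc m)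
  let ?h = "\<lambda>xs. ((\<lambda>x. t (x # tl xs)) ^^ m) (hd xs)"
  have "pol ar F C (Suc n) (\<lambda>xs. t (map (\<lambda>j. if j = 0 then ?h xs else xs ! j) [0..<Suc n]))"
  proof (rule pol_comp[OF assms])
    fix j assume "j < Suc n"
    then show "pol ar F C (Suc n) (\<lambda>xs. if j = 0 then ?h xs else xs ! j)"
      using Suc by (cases "j = 0") (auto intro!: pol_proj)
  qed
  then show ?case
  proof (rule pol_cong)
    fix xs :: "'b list" assume xs: "length xs = Suc n"
    have "?h xs # tl xs = map (\<lambda>j. if j = 0 then ?h xs else xs ! j) [0..<Suc n]"
      using xs by (cases xs) (auto intro!: nth_equalityI simp: nth_Cons' simp del: upt_Suc)
    then show "((\<lambda>x. t (x # tl xs)) ^^ Suc m) (hd xs) = t (map (\<lambda>j. if j = 0 then ?h xs else xs ! j) [0..<Suc n])"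
      by simp
  qed
qed

lemma pol_comp2:
  assumes "pol ar F C 2 f" "pol ar F C n a" "pol ar F C n b"
  shows "pol ar F C n (\<lambda>xs. f [a xs, b xs])"
proof -
  have "pol ar F C n (\<lambda>xs. f (map (\<lambda>j. ([a, b] ! j) xs) [0..<2]))"
    by (rule pol_comp[OF assms(1)]) (use assms(2,3) in \<open>auto simp: less_2_cases_iff\<close>)
  then show ?thesis by (simp add: upt_rec)
qed

lemma pol_comp3:
  assumes "pol ar F C 3 f" "pol ar F C n a" "pol ar F C n b" "pol ar F C n c"
  shows "pol ar F C n (\<lambda>xs. f [a xs, b xs, c xs])"
proof -
  have "pol ar F C n (\<lambda>xs. f (map (\<lambda>j. ([a, b, c] ! j) xs) [0..<3]))"
    by (rule pol_comp[OF assms(1)]) (use assms(2-4) in \<open>auto simp: less_Suc_eq numeral_3_eq_3\<close>)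
  then show ?thesis by (simp add: upt_rec)
qed

lemma pol_tl:
  assumes "pol ar F C n f"
  shows "pol ar F C (Suc n) (\<lambda>xs. f (tl xs))"
proof -
  have "pol ar F C (Suc n) (\<lambda>xs. f (map (\<lambda>j. xs ! Suc j) [0..<n]))"
    by (rule pol_comp[OF assms]) (simp add: pol_proj)
  then show ?thesis
  proof (rule pol_cong)
    fix xs :: "'b list" assume "length xs = Suc n"
    then have "tl xs = map (\<lambda>j. xs ! Suc j) [0..<n]" by (intro nth_equalityI) (auto simp: nth_tl)
    then show "f (tl xs) = f (map (\<lambda>j. xs ! Suc j) [0..<n])" by simp
  qed
qed

lemma pol_Cons:
  assumes "pol ar F C (Suc n) f" "pol ar F C m a" "\<And>j. j < n \<Longrightarrow> pol ar F C m (b j)"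
  shows "pol ar F C m (\<lambda>xs. f (a xs # map (\<lambda>j. b j xs) [0..<n]))"
proof -
  have "pol ar F C m (\<lambda>xs. f (map (\<lambda>j. (if j = 0 then a else b (j - 1)) xs) [0..<Suc n]))"
    by (rule pol_comp[OF assms(1)]) (use assms(2,3) in auto)
  moreover have "map (\<lambda>j. (if j = 0 then a else b (j - 1)) xs) [0..<Suc n] = a xs # map (\<lambda>j. b j xs) [0..<n]" for xs
    by (intro nth_equalityI) (auto simp: nth_Cons' simp del: upt_Suc)
  ultimately show ?thesis by simp
qed

section \<open>Congruences and unary polynomials; permutations under rigidity\<close>

lemma pol_congruence:
  "pol ar F X n f \<Longrightarrow> congruence ar X F \<theta> \<Longrightarrow> length xs = n \<Longrightarrow> list_all2 (\<lambda>x y. (x, y) \<in> \<theta>) xs ys \<Longrightarrow>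
     (f xs, f ys) \<in> \<theta>"
proof (induction rule: pol_induct)
  case (proj j)
  then show ?case by (auto simp: list_all2_conv_all_nth)
next
  case (const c)
  then show ?case unfolding congruence_def equiv_def refl_on_def by blast
next
  case (app i g)
  have "list_all2 (\<lambda>x y. (x, y) \<in> \<theta>) (map (\<lambda>j. g j xs) [0..<ar i]) (map (\<lambda>j. g j ys) [0..<ar i])"
    using app by (auto simp: list_all2_conv_all_nth)
  then show ?case using app.prems(1) unfolding congruence_def by simp
next
  case (cong f g)
  then show ?case using list_all2_lengthD by metis
qed

lemma upol_congruence:
  "upol ar F X f \<Longrightarrow> congruence ar X F \<theta> \<Longrightarrow> (x, y) \<in> \<theta> \<Longrightarrow> (f x, f y) \<in> \<theta>"
  unfolding upol_def using pol_congruence[of ar F X "Suc 0" "\<lambda>xs. f (xs ! 0)" \<theta> "[x]" "[y]"] by simp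

lemma congruence_refl: "congruence ar X F \<theta> \<Longrightarrow> x \<in> X \<Longrightarrow> (x, x) \<in> \<theta>"
  unfolding congruence_def equiv_def refl_on_def by blast

lemma congruence_sym: "congruence ar X F \<theta> \<Longrightarrow> (x, y) \<in> \<theta> \<Longrightarrow> (y, x) \<in> \<theta>"
  unfolding congruence_def equiv_def sym_def by blast

lemma congruence_trans: "congruence ar X F \<theta> \<Longrightarrow> (x, y) \<in> \<theta> \<Longrightarrow> (y, z) \<in> \<theta> \<Longrightarrow> (x, z) \<in> \<theta>"
  unfolding congruence_def equiv_def trans_def by blast

lemma congruence_in: "congruence ar X F \<theta> \<Longrightarrow> (x, y) \<in> \<theta> \<Longrightarrow> x \<in> X \<and> y \<in> X"
  unfolding congruence_def by (meson equiv_class_eq_iff)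

text \<open>The entries are changed one at a time. Reflexivity is asked of R only at values of f, so
  that R may be a congruence.\<close>

lemma coordinatewise:
  assumes "\<And>i w z z'. i < n \<Longrightarrow> length w = n \<Longrightarrow> set w \<subseteq> X \<Longrightarrow> (z, z') \<in> \<beta> \<Longrightarrow> R (f (w[i := z])) (f (w[i := z']))"
    and "\<And>x. x \<in> f ` {w. length w = n \<and> set w \<subseteq> X} \<Longrightarrow> R x x" and "\<And>x y z. R x y \<Longrightarrow> R y z \<Longrightarrow> R x z"
    and "list_all2 (\<lambda>x y. (x, y) \<in> \<beta>) w w'" "length w = n" "\<beta> \<subseteq> X \<times> X"
  shows "R (f w) (f w')"
proof -
  have len: "length w' = n" using assms list_all2_lengthD by metis
  have nth: "(w ! i, w' ! i) \<in> \<beta>" if "i < n" for i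
    using assms(4) that by (auto simp: list_all2_conv_all_nth assms(5))
  have "w ! i \<in> X \<and> w' ! i \<in> X" if "i < n" for i using nth[OF that] assms(6) by blast
  then have sub: "set w \<subseteq> X" "set w' \<subseteq> X" using assms(5) len by (auto simp: in_set_conv_nth)
  have "k \<le> n \<Longrightarrow> R (f w) (f (take k w' @ drop k w))" for k
  proof (induction k)
    case 0
    then show ?case using assms(2,5) sub by auto
  next
    case (Suc k)
    let ?v = "take k w' @ drop k w"
    have v: "length ?v = n" "set ?v \<subseteq> X"
      using sub Suc.prems assms(5) len set_take_subset[of k w'] set_drop_subset[of k w] by auto
    have 1: "?v[k := w ! k] = ?v"
      using Suc.prems len assms(5) by (intro nth_equalityI) (auto simp: nth_list_update nth_append)
    have 2: "?v[k := w' ! k] = take (Suc k) w' @ drop (Suc k) w"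
      using Suc.prems len assms(5)
      by (intro nth_equalityI) (auto simp: nth_list_update nth_append less_Suc_eq)
    have "R (f (?v[k := w ! k])) (f (?v[k := w' ! k]))"
      using Suc.prems v nth by (intro assms(1)) auto
    then show ?case using Suc assms(3) unfolding 1 2 by (meson Suc_leD)
  qed
  from this[of n] show ?thesis using len assms(5) by simp
qed

text \<open>A basic operation in which one entry varies is a unary polynomial, and entries can be
  changed one after the other.\<close>

lemma congruence_from_upol:
  assumes "algebra ar X F" "equiv X \<theta>" "\<theta> \<subseteq> X \<times> X" "\<And>f x y. upol ar F X f \<Longrightarrow> (x, y) \<in> \<theta> \<Longrightarrow> (f x, f y) \<in> \<theta>"
  shows "congruence ar X F \<theta>"
  unfolding congruence_def
proof (intro conjI allI impI)
  show "equiv X \<theta>" by fact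
  fix i xs ys assume xs: "length xs = ar i" "list_all2 (\<lambda>x y. (x, y) \<in> \<theta>) xs ys"
  have pol: "pol ar F X (ar i) (F i)"
    by (rule pol_cong[OF pol_app[of ar i F X "ar i" "\<lambda>j xs. xs ! j"]]) (auto simp: pol_proj list_map_nth)
  have upd: "upol ar F X (\<lambda>z. F i (w[k := z]))" if "k < ar i" "length w = ar i" "set w \<subseteq> X" for k w
    using upol_upd[OF pol upol_id that] .
  show "(F i xs, F i ys) \<in> \<theta>"
    using _ _ _ xs(2,1) assms(3)
  proof (rule coordinatewise[where R = "\<lambda>x y. (x, y) \<in> \<theta>"])
    show "(F i (w[k := z]), F i (w[k := z'])) \<in> \<theta>"
      if "k < ar i" "length w = ar i" "set w \<subseteq> X" "(z, z') \<in> \<theta>" for k w z z'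
      using assms(4)[OF upd] that by blast
    show "(x, x) \<in> \<theta>" if "x \<in> F i ` {w. length w = ar i \<and> set w \<subseteq> X}" for x
      using that assms(1,2) unfolding algebra_def equiv_def refl_on_def by auto
    show "(x, z) \<in> \<theta>" if "(x, y) \<in> \<theta>" "(y, z) \<in> \<theta>" for x y z
      using that assms(2) unfolding equiv_def trans_def by blast
  qed
qed

text \<open>With m the factorial of |U|, the m-th iterate of t(x, as) in x is the identity on U, and
  that of t(x, bs) is idempotent on U. The quasi-identity \<open>rigid\<close>, applied to the
  iterated term, makes the second iterate the identity too, so t(x, bs) is injective on U.\<close>

lemma rigid_perm:
  assumes "rigid ar X F" "finite X" "subuniv ar F X" "pol ar F X (Suc n) t"
    and "length as = n" "length bs = n" "set as \<subseteq> X" "set bs \<subseteq> X" "U \<subseteq> X"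
    and "bij_betw (\<lambda>x. t (x # as)) U U" "(\<lambda>x. t (x # bs)) ` U \<subseteq> U"
  shows "bij_betw (\<lambda>x. t (x # bs)) U U"
proof -
  have finU: "finite U" using assms finite_subset by blast
  obtain L where L: "set L = X" using assms(2) finite_list by blast
  let ?k = "length L"
  have "\<exists>h. pol ar F {} ?k h \<and> h L = c" if "c \<in> X" for c
    using that L by (metis in_set_conv_nth pol_proj)
  from pol_param[OF assms(4) refl this] obtain g where
    g: "pol ar F {} (?k + Suc n) g" "\<And>xs. length xs = Suc n \<Longrightarrow> t xs = g (L @ xs)"
    by blast
  \<comment> \<open>\<open>rigid\<close> concerns terms with their variable in front, so the
    constants L of t join the parameters and the variable is moved before them.\<close>
  have "pol ar F {} (Suc (?k + n)) (\<lambda>xs. g (map (\<lambda>j. if j < ?k then xs ! Suc j else if j = ?k then xs ! 0 else xs ! j) [0..<?k + Suc n]))"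
  proof (rule pol_comp[OF g(1)])
    fix j assume "j < ?k + Suc n"
    then show "pol ar F {} (Suc (?k + n)) (\<lambda>xs. if j < ?k then xs ! Suc j else if j = ?k then xs ! 0 else xs ! j)"
      by (cases "j < ?k"; cases "j = ?k") (auto intro!: pol_proj)
  qed
  then have s: "pol ar F {} (Suc (?k + n)) (\<lambda>xs. g (take ?k (tl xs) @ hd xs # drop ?k (tl xs)))"
  proof (rule pol_cong)
    fix xs :: "'b list" assume xs: "length xs = Suc (?k + n)"
    have "take ?k (tl xs) @ hd xs # drop ?k (tl xs)
      = map (\<lambda>j. if j < ?k then xs ! Suc j else if j = ?k then xs ! 0 else xs ! j) [0..<?k + Suc n]"
      using xs by (cases xs) (auto intro!: nth_equalityI simp: nth_append nth_Cons' simp del: upt_Suc)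
    then show "g (take ?k (tl xs) @ hd xs # drop ?k (tl xs)) = g (map (\<lambda>j. if j < ?k then xs ! Suc j else if j = ?k then xs ! 0 else xs ! j) [0..<?k + Suc n])"
      by simp
  qed
  let ?s = "\<lambda>xs. g (take ?k (tl xs) @ hd xs # drop ?k (tl xs))"
  let ?m = "fact (card U)"
  obtain r where r: "(Suc (?k + n), r) \<in> polys ar {} F"
    "\<And>xs. length xs = Suc (?k + n) \<Longrightarrow> ((\<lambda>x. ?s (x # tl xs)) ^^ ?m) (hd xs) = r xs"
    using pol_iter[OF s, of ?m] unfolding pol_def by blast
  have req: "r (x # L @ cs) = ((\<lambda>x. t (x # cs)) ^^ ?m) x" if "length cs = n" for x cs
    using r(2)[of "x # L @ cs"] that by (simp add: g(2))
  let ?f = "\<lambda>x. t (x # as)" and ?h = "\<lambda>x. t (x # bs)"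
  have id: "(?f ^^ ?m) x = x" if "x \<in> U" for x
    using funpow_fact_id[OF finU assms(10) that] .
  have hU: "(?h ^^ ?m) x \<in> U" if "x \<in> U" for x
    using funpow_image[OF assms(11), of ?m] that by blast
  have hid: "(?h ^^ ?m) x = x" if "x \<in> U" for x
  proof -
    have "r (x # L @ bs) = x"
      using assms(1)[unfolded rigid_def, rule_format, OF r(1), of "L @ as" "L @ bs" x]
        assms(5-9) that hU[OF that] id funpow_fact_idem[OF finU assms(11) that] L
      by (auto simp: req)
    then show ?thesis by (simp add: req assms)
  qed
  have "inj_on ?h U"
  proof (rule inj_onI)
    fix x y assume xy: "x \<in> U" "y \<in> U" "?h x = ?h y"
    obtain m where m: "?m = Suc m" by (metis fact_nonzero not0_implies_Suc)
    have "(?h ^^ ?m) x = (?h ^^ ?m) y"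
      unfolding m funpow_Suc_right comp_apply using xy by simp
    then show "x = y" using hid xy by simp
  qed
  then show ?thesis
    unfolding bij_betw_def using endo_inj_surj[OF finU assms(11)] by blast
qed

lemma rigid_perm_upd:
  assumes "rigid ar X F" "finite X" "subuniv ar F X" "pol ar F X n f" "upol ar F X p" "i < n"
    and "length w = n" "length w' = n" "set w \<subseteq> X" "set w' \<subseteq> X" "U \<subseteq> X"
    and "bij_betw (\<lambda>z. f (w[i := p z])) U U" "(\<lambda>z. f (w'[i := p z])) ` U \<subseteq> U"
  shows "bij_betw (\<lambda>z. f (w'[i := p z])) U U"
  using rigid_perm[OF assms(1-3) pol_upd[OF assms(4-6)] assms(7-11)] assms(12,13) by simp

lemma subuniv_hull:
  assumes cong: "congruence ar X F \<psi>" and M: "subuniv ar F M"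
  shows "subuniv ar F {x \<in> X. \<exists>m\<in>M. (x, m) \<in> \<psi>}"
  unfolding subuniv_def
proof (intro allI impI)
  fix i xs assume xs: "length xs = ar i" "set xs \<subseteq> {x \<in> X. \<exists>m\<in>M. (x, m) \<in> \<psi>}"
  define ms where "ms = map (\<lambda>x. SOME m. m \<in> M \<and> (x, m) \<in> \<psi>) xs"
  have sm: "(SOME m. m \<in> M \<and> (x, m) \<in> \<psi>) \<in> M \<and> (x, SOME m. m \<in> M \<and> (x, m) \<in> \<psi>) \<in> \<psi>" if "x \<in> set xs" for x
    by (rule someI_ex) (use that xs(2) in auto)
  have ms: "length ms = ar i" "set ms \<subseteq> M" "list_all2 (\<lambda>x y. (x, y) \<in> \<psi>) xs ms"
    using sm xs(1) by (auto simp: ms_def list_all2_conv_all_nth)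
  then have "(F i xs, F i ms) \<in> \<psi>" using cong xs(1) unfolding congruence_def by blast
  moreover have "F i ms \<in> M" using M ms unfolding subuniv_def by blast
  ultimately show "F i xs \<in> {x \<in> X. \<exists>m\<in>M. (x, m) \<in> \<psi>}" using congruence_in[OF cong] by blast
qed

section \<open>Minimal sets of prime quotients and maximal subalgebras\<close>

lemma upol_param:
  assumes "upol ar F D f" "length ls = m"
    and "\<And>c. c \<in> D \<Longrightarrow> \<exists>h. pol ar F C m h \<and> h ls = c"
  shows "\<exists>t. pol ar F C (Suc m) t \<and> (\<forall>x. f x = t (x # ls))"
proof -
  obtain g where g: "pol ar F C (m + Suc 0) g" "\<And>xs. length xs = Suc 0 \<Longrightarrow> f (xs ! 0) = g (ls @ xs)"
    using pol_param[OF assms(1)[unfolded upol_def] assms(2,3)] by blast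
  have "pol ar F C (Suc m) (\<lambda>xs. g (map (\<lambda>j. if j < m then xs ! Suc j else xs ! 0) [0..<m + Suc 0]))"
  proof (rule pol_comp[OF g(1)])
    fix j assume "j < m + Suc 0"
    then show "pol ar F C (Suc m) (\<lambda>xs. if j < m then xs ! Suc j else xs ! 0)"
      by (cases "j < m") (auto intro!: pol_proj)
  qed
  moreover have "map (\<lambda>j. if j < m then (x # ls) ! Suc j else (x # ls) ! 0) [0..<m + Suc 0] = ls @ [x]" for x
    using assms(2) by (intro nth_equalityI) (auto simp: nth_append simp del: upt_Suc)
  ultimately show ?thesis using g(2)[of "[_]"] by (intro exI conjI allI) auto
qed

lemma funpow_fixed: "f x = x \<Longrightarrow> (f ^^ m) x = x"
  by (induction m) auto

lemma upol_enum_param: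
  assumes "upol ar F X f" "finite X"
  obtains t L where "pol ar F {} (Suc (length L)) t" "set L = X" "\<And>x. f x = t (x # L)"
proof -
  obtain L where L: "set L = X" using assms(2) finite_list by blast
  have "\<exists>h. pol ar F {} (length L) h \<and> h L = c" if "c \<in> X" for c
    using that L by (metis in_set_conv_nth pol_proj)
  from upol_param[OF assms(1) refl this] L that show ?thesis by blast
qed

text \<open>The finite set M \<inter> V is mapped injectively into itself, hence onto itself, so no
  point of V outside M can land in M.\<close>

lemma perm_preserves:
  assumes "finite V" "bij_betw f V V" "\<And>x. x \<in> M \<Longrightarrow> x \<in> V \<Longrightarrow> f x \<in> M" "x \<in> V"
  shows "f x \<in> M \<longleftrightarrow> x \<in> M"
proof
  assume "f x \<in> M"
  have inj: "inj_on f V" and img: "f ` V = V" using assms(2) by (auto simp: bij_betw_def)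
  have "f ` (M \<inter> V) = M \<inter> V"
    using assms(1,3) img inj by (intro endo_inj_surj) (auto intro: inj_on_subset)
  moreover have "f x \<in> M \<inter> V" using \<open>f x \<in> M\<close> img assms(4) by blast
  ultimately obtain y where "y \<in> M \<inter> V" "f y = f x" by (metis imageE)
  then show "x \<in> M" using inj assms(4) by (auto simp: inj_on_def)
qed (use assms in blast)

locale rigid_alg =
  fixes ar :: "'i \<Rightarrow> nat" and X :: "'a set" and F :: "'i \<Rightarrow> 'a list \<Rightarrow> 'a"
  assumes alg: "algebra ar X F" and fin: "finite X" and rigid: "rigid ar X F"
begin

lemma sub: "subuniv ar F X"
  using alg by (simp add: algebra_def subuniv_def)

lemma upol_in: "upol ar F X f \<Longrightarrow> x \<in> X \<Longrightarrow> f x \<in> X"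
  by (rule upol_closed[OF _ sub subset_refl])

lemmas perm = rigid_perm[OF rigid fin sub]
lemmas perm_upd = rigid_perm_upd[OF rigid fin sub]

definition quasi :: "'a set \<Rightarrow> ('a list \<Rightarrow> 'a) \<Rightarrow> bool" where
  "quasi V g \<longleftrightarrow> pol ar F X 2 g \<and> (\<forall>x\<in>V. \<forall>y\<in>V. g [x, y] \<in> V) \<and>
     (\<forall>x\<in>V. bij_betw (\<lambda>y. g [x, y]) V V) \<and> (\<forall>y\<in>V. bij_betw (\<lambda>x. g [x, y]) V V)"

end

section \<open>Minimal sets of a prime quotient: separation, retractions, connectedness\<close>

locale prime_quot = rigid_alg ar X F
  for ar :: "'i \<Rightarrow> nat" and X :: "'a set" and F :: "'i \<Rightarrow> 'a list \<Rightarrow> 'a" +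
  fixes \<theta> \<beta> :: "'a rel"
  assumes pq: "prime_quotient ar X F \<theta> \<beta>"
begin

lemma cong: "congruence ar X F \<theta>" "congruence ar X F \<beta>" "\<theta> \<subseteq> \<beta>" "\<theta> \<noteq> \<beta>"
  using pq unfolding prime_quotient_def by auto

lemma no_between: "congruence ar X F \<gamma> \<Longrightarrow> \<theta> \<subseteq> \<gamma> \<Longrightarrow> \<gamma> \<subseteq> \<beta> \<Longrightarrow> \<gamma> = \<theta> \<or> \<gamma> = \<beta>"
  using pq unfolding prime_quotient_def by blast

lemma beta_X: "(x, y) \<in> \<beta> \<Longrightarrow> x \<in> X" "(x, y) \<in> \<beta> \<Longrightarrow> y \<in> X"
  using congruence_in[OF cong(2)] by blast+

text \<open>The pairs of \<beta> that f p sends into \<theta> for all unary polynomials p form a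
  congruence between \<theta> and \<beta>. The pair (a, b) shows that it is not \<beta>, so it is
  \<theta>.\<close>

lemma separate:
  assumes f: "upol ar F X f" "(a, b) \<in> \<beta>" "(f a, f b) \<notin> \<theta>" and xy: "(x, y) \<in> \<beta>" "(x, y) \<notin> \<theta>"
  shows "\<exists>p. upol ar F X p \<and> (f (p x), f (p y)) \<notin> \<theta>"
proof -
  define \<mu> where "\<mu> = {(x, y). (x, y) \<in> \<beta> \<and> (\<forall>p. upol ar F X p \<longrightarrow> (f (p x), f (p y)) \<in> \<theta>)}"
  have "equiv X \<mu>"
  proof (rule equivI)
    show "\<mu> \<subseteq> X \<times> X" using beta_X by (auto simp: \<mu>_def)
    show "refl_on X \<mu>"
      using congruence_refl[OF cong(1)] congruence_refl[OF cong(2)] upol_in f(1)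
      by (auto simp: \<mu>_def refl_on_def)
    show "sym \<mu>" using congruence_sym[OF cong(1)] congruence_sym[OF cong(2)] 
      by (auto simp: \<mu>_def sym_def)
    show "trans \<mu>" unfolding trans_def \<mu>_def
      using congruence_trans[OF cong(1)] congruence_trans[OF cong(2)] by blast
  qed
  moreover have "(g x, g y) \<in> \<mu>" if "upol ar F X g" "(x, y) \<in> \<mu>" for g x y
    using that upol_congruence[OF that(1) cong(2)] upol_comp[OF _ that(1)] by (fastforce simp: \<mu>_def)
  ultimately have "congruence ar X F \<mu>"
    using beta_X by (intro congruence_from_upol[OF alg]) (auto simp: \<mu>_def)
  moreover have "\<theta> \<subseteq> \<mu>"
    using cong(3) upol_congruence[OF _ cong(1)] f(1) by (auto simp: \<mu>_def)
  moreover have "\<mu> \<subseteq> \<beta>" "\<mu> \<noteq> \<beta>" using f upol_id by (fastforce simp: \<mu>_def)+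
  ultimately have "\<mu> = \<theta>" using no_between by blast
  then show ?thesis using xy by (auto simp: \<mu>_def)
qed

abbreviation "minsets \<equiv> min_sets ar X F \<theta> \<beta>"

lemma U_sets_iff:
  "V \<in> U_sets ar X F \<theta> \<beta> \<longleftrightarrow> (\<exists>f. upol ar F X f \<and> V = f ` X \<and> (\<exists>x y. (x, y) \<in> \<beta> \<and> (f x, f y) \<notin> \<theta>))"
proof
  assume "V \<in> U_sets ar X F \<theta> \<beta>"
  then obtain p x y where p: "(Suc 0, p) \<in> polys ar X F" "V = (\<lambda>x. p [x]) ` X" "(x, y) \<in> \<beta>" "(p [x], p [y]) \<notin> \<theta>"
    unfolding U_sets_def by blast
  have "upol ar F X (\<lambda>x. p [x])" unfolding upol_def pol_def
    using p(1) by (intro exI[of _ p]) (auto simp: length_Suc_conv)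
  then show "\<exists>f. upol ar F X f \<and> V = f ` X \<and> (\<exists>x y. (x, y) \<in> \<beta> \<and> (f x, f y) \<notin> \<theta>)"
    using p by blast
next
  assume "\<exists>f. upol ar F X f \<and> V = f ` X \<and> (\<exists>x y. (x, y) \<in> \<beta> \<and> (f x, f y) \<notin> \<theta>)"
  then obtain f p x y where f: "(Suc 0, p) \<in> polys ar X F" "\<And>xs. length xs = Suc 0 \<Longrightarrow> f (xs ! 0) = p xs"
    "V = f ` X" "(x, y) \<in> \<beta>" "(f x, f y) \<notin> \<theta>"
    unfolding upol_def pol_def by blast
  have "f = (\<lambda>x. p [x])" using f(2)[of "[_]"] by auto
  then show "V \<in> U_sets ar X F \<theta> \<beta>" unfolding U_sets_def using f by blast
qed

lemma U_setsI: "upol ar F X f \<Longrightarrow> (x, y) \<in> \<beta> \<Longrightarrow> (f x, f y) \<notin> \<theta> \<Longrightarrow> f ` X \<in> U_sets ar X F \<theta> \<beta>"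
  unfolding U_sets_iff by blast

lemma U_sets_sub: "V \<in> U_sets ar X F \<theta> \<beta> \<Longrightarrow> V \<subseteq> X"
  unfolding U_sets_iff using upol_in by auto

lemma minsets_sub: "V \<in> minsets \<Longrightarrow> V \<subseteq> X"
  unfolding min_sets_def using U_sets_sub by blast

lemma minset_fin: "V \<in> minsets \<Longrightarrow> finite V"
  using minsets_sub fin finite_subset by blast

text \<open>If V = f(X) and the pair (f(a), f(b)) is outside \<theta>, then some f p separates this
  pair again. Minimality makes f p map V onto V, and an iterate of this permutation is a retraction
  onto V.\<close>

lemma min_idem:
  assumes "V \<in> minsets"
  obtains e where "upol ar F X e" "e ` X = V" "\<And>x. x \<in> V \<Longrightarrow> e x = x"
proof -
  have VX: "V \<subseteq> X" and finV: "finite V" using assms minsets_sub minset_fin by auto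
  obtain f a b where f: "upol ar F X f" "V = f ` X" "(a, b) \<in> \<beta>" "(f a, f b) \<notin> \<theta>"
    using assms unfolding min_sets_def U_sets_iff by blast
  have "(f a, f b) \<in> \<beta>" using upol_congruence[OF f(1) cong(2) f(3)] .
  then obtain p where p: "upol ar F X p" "(f (p (f a)), f (p (f b))) \<notin> \<theta>"
    using separate[OF f(1,3,4)] f(4) by blast
  let ?h = "\<lambda>x. f (p x)"
  have h: "upol ar F X ?h" using upol_comp[OF f(1) p(1)] .
  have "upol ar F X (\<lambda>x. ?h (f x))" using upol_comp[OF h f(1)] .
  then have "(\<lambda>x. ?h (f x)) ` X \<in> U_sets ar X F \<theta> \<beta>" using f(3) p(2) by (rule U_setsI)
  moreover have sub: "(\<lambda>x. ?h (f x)) ` X \<subseteq> V" using f(1,2) p(1) upol_in by auto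
  ultimately have "(\<lambda>x. ?h (f x)) ` X = V" using assms unfolding min_sets_def by blast
  then have img: "?h ` V = V" unfolding f(2) by (simp add: image_image)
  then have bij: "bij_betw ?h V V"
    using finV by (simp add: bij_betw_def eq_card_imp_inj_on)
  define e where "e = ?h ^^ fact (card V)"
  have e: "upol ar F X e" unfolding e_def by (rule upol_funpow[OF h])
  have id: "e x = x" if "x \<in> V" for x
    unfolding e_def using funpow_fact_id[OF finV bij that] .
  obtain m where m: "fact (card V) = Suc m" by (metis fact_nonzero not0_implies_Suc)
  have "e x \<in> V" if "x \<in> X" for x
  proof -
    have "(?h ^^ m) x \<in> X" using upol_in[OF upol_funpow[OF h] that] .
    then show ?thesis unfolding e_def m using f(1,2) p(1) upol_in by auto
  qed
  then have "e ` X = V" using id VX by force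
  then show ?thesis using e id that by blast
qed

lemma min_pair:
  assumes "V \<in> minsets"
  obtains x y where "x \<in> V" "y \<in> V" "(x, y) \<in> \<beta>" "(x, y) \<notin> \<theta>"
proof -
  obtain f a b where f: "upol ar F X f" "V = f ` X" "(a, b) \<in> \<beta>" "(f a, f b) \<notin> \<theta>"
    using assms unfolding min_sets_def U_sets_iff by blast
  then have "f a \<in> V" "f b \<in> V" "(f a, f b) \<in> \<beta>"
    using upol_congruence[OF f(1) cong(2) f(3)] beta_X by auto
  then show ?thesis using f that by blast
qed

text \<open>If f does not collapse the pair, then f composed with the retraction onto V has its
  image in the family in which V is minimal, so f maps V onto V.\<close>

lemma min_bij_or:
  assumes "V \<in> minsets" "upol ar F X f" "f ` V \<subseteq> V" "\<not> bij_betw f V V"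
    and "x \<in> V" "y \<in> V" "(x, y) \<in> \<beta>"
  shows "(f x, f y) \<in> \<theta>"
proof (rule ccontr)
  assume neg: "(f x, f y) \<notin> \<theta>"
  obtain e where e: "upol ar F X e" "e ` X = V" "\<And>x. x \<in> V \<Longrightarrow> e x = x"
    using min_idem[OF assms(1)] by blast
  have "(\<lambda>x. f (e x)) ` X \<in> U_sets ar X F \<theta> \<beta>"
    using assms(5-7) neg e by (intro U_setsI[OF upol_comp[OF assms(2) e(1)], of x y]) auto
  moreover have "(\<lambda>x. f (e x)) ` X = f ` V" using e(2) by auto
  ultimately have "f ` V = V" using assms(1,3) unfolding min_sets_def by auto
  then have "bij_betw f V V"
    using minset_fin[OF assms(1)] by (simp add: bij_betw_def eq_card_imp_inj_on)
  then show False using assms(4) by blast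
qed

text \<open>The inverse of f on V is an iterate of f, hence a polynomial.\<close>

lemma bij_reflect:
  assumes "upol ar F X f" "finite V" "bij_betw f V V" "x \<in> V" "y \<in> V" "(f x, f y) \<in> \<theta>"
  shows "(x, y) \<in> \<theta>"
proof -
  obtain m where m: "fact (card V) = Suc m" by (metis fact_nonzero not0_implies_Suc)
  have "((f ^^ m) (f x), (f ^^ m) (f y)) \<in> \<theta>"
    using upol_congruence[OF upol_funpow[OF assms(1)] cong(1) assms(6)] .
  then have "((f ^^ fact (card V)) x, (f ^^ fact (card V)) y) \<in> \<theta>"
    unfolding m funpow_Suc_right by simp
  then show ?thesis using funpow_fact_id[OF assms(2,3)] assms(4,5) by simp
qed

text \<open>\<beta> is the transitive closure of \<theta> together with the polynomial images of
  \<beta> restricted to V, because that closure is a congruence strictly above \<theta>. The lemma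
  states this connectedness as induction along a chain.\<close>

lemma chain:
  assumes V: "V \<in> minsets" and xy: "(x, y) \<in> \<beta>" and Px: "P x"
    and step1: "\<And>a b. (a, b) \<in> \<theta> \<Longrightarrow> P a \<Longrightarrow> P b"
    and step2: "\<And>p u v. upol ar F X p \<Longrightarrow> u \<in> V \<Longrightarrow> v \<in> V \<Longrightarrow> (u, v) \<in> \<beta> \<Longrightarrow> P (p u) \<Longrightarrow> P (p v)"
  shows "P y"
proof -
  define S where "S = \<theta> \<union> {(p u, p v) | p u v. upol ar F X p \<and> u \<in> V \<and> v \<in> V \<and> (u, v) \<in> \<beta>}"
  have SB: "S \<subseteq> \<beta>" unfolding S_def using cong(3) upol_congruence[OF _ cong(2)] by auto
  have RB: "S\<^sup>+ \<subseteq> \<beta>"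
  proof
    fix q assume "q \<in> S\<^sup>+"
    moreover have "(a, b) \<in> S\<^sup>+ \<Longrightarrow> (a, b) \<in> \<beta>" for a b
      by (induction rule: trancl_induct) (use SB congruence_trans[OF cong(2)] in blast)+
    ultimately show "q \<in> \<beta>" by (cases q) auto
  qed
  have "sym S" unfolding S_def sym_def
    using congruence_sym[OF cong(1)] congruence_sym[OF cong(2)] by blast
  have "equiv X (S\<^sup>+)"
  proof (rule equivI)
    show "S\<^sup>+ \<subseteq> X \<times> X" using RB beta_X by auto
    show "refl_on X (S\<^sup>+)"
      using congruence_refl[OF cong(1)] by (auto simp: refl_on_def S_def)
    show "sym (S\<^sup>+)" using \<open>sym S\<close> by (rule sym_trancl)
  qed simp
  moreover have "(g a, g b) \<in> S\<^sup>+" if g: "upol ar F X g" and "(a, b) \<in> S\<^sup>+" for g a b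
  proof -
    have S: "(g a, g b) \<in> S" if ab: "(a, b) \<in> S" for a b
    proof (cases "(a, b) \<in> \<theta>")
      case True
      then show ?thesis using upol_congruence[OF g cong(1)] by (auto simp: S_def)
    next
      case False
      then obtain p u v where "upol ar F X p" "u \<in> V" "v \<in> V" "(u, v) \<in> \<beta>" "a = p u" "b = p v"
        using ab by (auto simp: S_def)
      then show ?thesis using upol_comp[OF g, of p] by (auto simp: S_def)
    qed
    show ?thesis using that(2)
    proof (induction rule: trancl_induct)
      case (base b)
      then show ?case using S by blast
    next
      case (step b c)
      then show ?case using S trancl_into_trancl by metis
    qed
  qed
  ultimately have "congruence ar X F (S\<^sup>+)"
    using RB beta_X by (intro congruence_from_upol[OF alg]) auto
  moreover have "\<theta> \<subseteq> S\<^sup>+" by (auto simp: S_def)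
  moreover have "S\<^sup>+ \<noteq> \<theta>"
  proof -
    obtain a b where ab: "a \<in> V" "b \<in> V" "(a, b) \<in> \<beta>" "(a, b) \<notin> \<theta>" using min_pair[OF V] .
    then have "(a, b) \<in> S" unfolding S_def
      by (intro UnI2 CollectI exI[of _ "\<lambda>x. x"] exI[of _ a] exI[of _ b]) (simp add: upol_id)
    then show ?thesis using ab by blast
  qed
  ultimately have "S\<^sup>+ = \<beta>" using no_between RB by blast
  then have "(x, y) \<in> S\<^sup>+" using xy by simp
  then show "P y"
  proof (induction rule: trancl_induct)
    case (base b)
    then show ?case using Px step1 step2 by (auto simp: S_def)
  next
    case (step b c)
    then show ?case using step1 step2 by (auto simp: S_def)
  qed
qed

end

section \<open>A maximal subalgebra that is a union of classes of the lower congruence\<close>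

locale max_sub = prime_quot ar X F \<theta> \<beta>
  for ar :: "'i \<Rightarrow> nat" and X :: "'a set" and F :: "'i \<Rightarrow> 'a list \<Rightarrow> 'a" and \<theta> \<beta> :: "'a rel" +
  fixes M :: "'a set"
  assumes M_sub: "subuniv ar F M" and M_X: "M \<subseteq> X" and M_ne: "M \<noteq> {}" and M_prop: "M \<noteq> X"
    and M_max: "\<And>S. subuniv ar F S \<Longrightarrow> M \<subseteq> S \<Longrightarrow> S \<subseteq> X \<Longrightarrow> S = M \<or> S = X"
    and M_sat: "\<And>x y. (x, y) \<in> \<theta> \<Longrightarrow> x \<in> M \<Longrightarrow> y \<in> M"
    and M_hit: "\<And>x. x \<in> X \<Longrightarrow> \<exists>m\<in>M. (x, m) \<in> \<beta>"
begin

text \<open>Moves constants and arguments into M inside their \<beta>-class; changes along \<beta>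
  are what the dichotomy on minimal sets controls.\<close>

definition toM :: "'a \<Rightarrow> 'a" where "toM x = (SOME m. m \<in> M \<and> (x, m) \<in> \<beta>)"

lemma toM: "x \<in> X \<Longrightarrow> toM x \<in> M" "x \<in> X \<Longrightarrow> (x, toM x) \<in> \<beta>"
  using someI_ex[of "\<lambda>m. m \<in> M \<and> (x, m) \<in> \<beta>"] M_hit unfolding toM_def by blast+

lemma toM_list: "set w \<subseteq> X \<Longrightarrow> set (map toM w) \<subseteq> M" "set w \<subseteq> X \<Longrightarrow> list_all2 (\<lambda>x y. (x, y) \<in> \<beta>) w (map toM w)"
  using toM by (auto simp: list_all2_conv_all_nth subset_iff)

lemma M_upol_X: "upol ar F M f \<Longrightarrow> upol ar F X f"
  by (rule upol_mono[OF _ M_X])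

text \<open>Take V of least size with retraction \<open>e0\<close>, given by t(x, L), move the
  constants L into M and iterate to an idempotent e. By rigidity \<open>e0\<close> after e permutes
  V, so e does not collapse \<beta>. Likewise e after an iterate of \<open>e0\<close> permutes e(X),
  so e(X) is no larger than V. Least size, unlike minimality under inclusion, thus carries over to
  e(X).\<close>

lemma exists_M_idem:
  obtains V e where "V \<in> minsets" "upol ar F M e" "e ` X = V" "\<And>x. x \<in> V \<Longrightarrow> e x = x"
proof -
  obtain a b where ab: "(a, b) \<in> \<beta>" "(a, b) \<notin> \<theta>" using cong by auto
  have "\<exists>V. V \<in> U_sets ar X F \<theta> \<beta>" using U_setsI[OF upol_id ab] by blast
  then obtain V where V: "V \<in> U_sets ar X F \<theta> \<beta>"
    and least: "\<And>W. W \<in> U_sets ar X F \<theta> \<beta> \<Longrightarrow> card V \<le> card W"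
    using ex_has_least_nat[of "\<lambda>V. V \<in> U_sets ar X F \<theta> \<beta>" _ card] by blast
  have minI: "W \<in> minsets" if "W \<in> U_sets ar X F \<theta> \<beta>" "card W \<le> card V" for W
    unfolding min_sets_def
  proof (intro CollectI conjI ballI impI that(1))
    fix W' assume W': "W' \<in> U_sets ar X F \<theta> \<beta>" "W' \<subseteq> W"
    have "finite W" using U_sets_sub[OF that(1)] fin finite_subset by blast
    moreover have "card W \<le> card W'" using that(2) least[OF W'(1)] by simp
    ultimately show "W' = W" using W'(2) card_seteq by blast
  qed
  have Vmin: "V \<in> minsets" using minI V by blast
  obtain e0 where e0: "upol ar F X e0" "e0 ` X = V" "\<And>x. x \<in> V \<Longrightarrow> e0 x = x"
    using min_idem[OF Vmin] by blast
  obtain L t where t: "pol ar F {} (Suc (length L)) t" "set L = X" "\<And>x. e0 x = t (x # L)"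
    by (rule upol_enum_param[OF e0(1) fin]) (rule that; assumption)
  let ?L = "map toM L"
  have L': "set ?L \<subseteq> M" "length ?L = length L" using toM_list t(2) by auto
  let ?K = "fact (card X) :: nat"
  let ?f = "\<lambda>x. t (x # ?L)"
  have f: "upol ar F M ?f" using pol_Cons_upol[OF pol_mono[OF t(1)] L'(2,1)] by simp
  define e where "e = ?f ^^ ?K"
  have e: "upol ar F M e" unfolding e_def by (rule upol_funpow[OF f])
  note eX = M_upol_X[OF e]
  have fX: "?f ` X \<subseteq> X" using upol_in[OF M_upol_X[OF f]] by blast
  have ee: "e (e x) = e x" if "x \<in> X" for x
    unfolding e_def using funpow_fact_idem[OF fin fX that] .
  \<comment> \<open>Both maps must be instances of one polynomial, so \<open>e0\<close> is iterated
    along with the map that yields e; on V this changes nothing.\<close>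
  have e0K: "(e0 ^^ ?K) x = x" if "x \<in> V" for x
    using e0(3)[OF that] by (rule funpow_fixed)
  have e0V: "(e0 ^^ ?K) x \<in> V" if "x \<in> X" for x
  proof -
    obtain m where m: "?K = Suc m" by (metis fact_nonzero not0_implies_Suc)
    show ?thesis unfolding m using upol_in[OF upol_funpow[OF e0(1)] that] e0(2) by auto
  qed
  have tX: "pol ar F X (Suc (length L)) t" using pol_mono[OF t(1)] by simp
  let ?T = "\<lambda>h xs. h (((\<lambda>x. t (x # tl xs)) ^^ ?K) (hd xs))"
  have polT: "pol ar F X (Suc (length L)) (?T h)" if "upol ar F X h" for h
    using upol_comp_pol[OF that pol_iter[OF tX]] .
  have TL: "?T h (x # L) = h ((e0 ^^ ?K) x)" for h x
  proof -
    have "(\<lambda>x. t (x # L)) = e0" using t(3) by auto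
    then show ?thesis by simp
  qed
  have TL': "?T h (x # ?L) = h (e x)" for h x by (simp add: e_def)
  have LX: "set L \<subseteq> X" "set ?L \<subseteq> X" using t(2) L'(1) M_X by auto
  have VX: "V \<subseteq> X" using V U_sets_sub by blast
  have "bij_betw (\<lambda>x. ?T e0 (x # ?L)) V V"
  proof (rule perm[OF polT[OF e0(1)] refl L'(2) LX VX])
    have "bij_betw (\<lambda>x. x) V V" by (simp add: bij_betw_def)
    then show "bij_betw (\<lambda>x. ?T e0 (x # L)) V V"
      unfolding TL by (rule bij_betw_cong[THEN iffD1, rotated]) (simp add: e0K e0(3))
    show "(\<lambda>x. ?T e0 (x # ?L)) ` V \<subseteq> V"
      unfolding TL' using upol_in[OF eX] VX e0(2) by auto
  qed
  then have bij: "bij_betw (\<lambda>x. e0 (e x)) V V" unfolding TL' .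
  obtain x y where xy: "x \<in> V" "y \<in> V" "(x, y) \<in> \<beta>" "(x, y) \<notin> \<theta>" using min_pair[OF Vmin] .
  have "(e0 (e x), e0 (e y)) \<notin> \<theta>"
    using bij_reflect[OF upol_comp[OF e0(1) eX] _ bij xy(1,2)] xy(4) minset_fin[OF Vmin] by blast
  then have "(e x, e y) \<notin> \<theta>" using upol_congruence[OF e0(1) cong(1)] by blast
  then have W: "e ` X \<in> U_sets ar X F \<theta> \<beta>" using U_setsI[OF eX xy(3)] by blast
  have WX: "e ` X \<subseteq> X" using upol_in[OF eX] by blast
  have "bij_betw (\<lambda>x. ?T e (x # L)) (e ` X) (e ` X)"
  proof (rule perm[OF polT[OF eX] L'(2) refl LX(2,1) WX])
    have "bij_betw (\<lambda>x. x) (e ` X) (e ` X)" by (simp add: bij_betw_def)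
    then show "bij_betw (\<lambda>x. ?T e (x # ?L)) (e ` X) (e ` X)"
      unfolding TL' by (rule bij_betw_cong[THEN iffD1, rotated]) (use ee in auto)
    show "(\<lambda>x. ?T e (x # L)) ` e ` X \<subseteq> e ` X"
      unfolding TL using e0V VX WX by blast
  qed
  then have "inj_on (\<lambda>x. e ((e0 ^^ ?K) x)) (e ` X)" unfolding TL bij_betw_def by blast
  then have "inj_on (e0 ^^ ?K) (e ` X)" by (auto simp: inj_on_def)
  moreover have "(e0 ^^ ?K) ` e ` X \<subseteq> V" using e0V WX by blast
  ultimately have "card (e ` X) \<le> card V" using card_inj_on_le minset_fin[OF Vmin] by blast
  then have "e ` X \<in> minsets" using minI W by blast
  then show ?thesis using that e ee by blast
qed

text \<open>The values at y of the unary polynomials over M form a subalgebra that contains M and y,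
  so maximality of M makes it all of X.\<close>

lemma generated:
  assumes y: "y \<in> X" "y \<notin> M" and c: "c \<in> X"
  shows "\<exists>h. upol ar F M h \<and> h y = c"
proof -
  let ?S = "{h y | h. upol ar F M h}"
  have "subuniv ar F ?S" unfolding subuniv_def
  proof (intro allI impI)
    fix i xs assume xs: "length xs = ar i" "set xs \<subseteq> ?S"
    have ex: "\<exists>h. upol ar F M h \<and> xs ! j = h y" if "j < ar i" for j
    proof -
      have "xs ! j \<in> ?S" by (rule subsetD[OF xs(2) nth_mem]) (use that xs(1) in simp)
      then show ?thesis by (elim CollectE exE conjE) (intro exI conjI)
    qed
    define h where "h j = (SOME h. upol ar F M h \<and> xs ! j = h y)" for j
    have h: "upol ar F M (h j)" "xs ! j = h j y" if "j < ar i" for j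
      using someI_ex[OF ex[OF that]] by (auto simp: h_def)
    let ?H = "\<lambda>z. F i (map (\<lambda>j. h j z) [0..<ar i])"
    have H: "upol ar F M ?H"
      unfolding upol_def by (rule pol_app) (use h(1) in \<open>simp add: upol_def\<close>)
    have "xs = map (\<lambda>j. h j y) [0..<ar i]"
      using h(2) xs(1) by (intro nth_equalityI) auto
    then have "F i xs = ?H y" by simp
    then show "F i xs \<in> ?S" by (intro CollectI exI[of _ ?H] conjI H)
  qed
  moreover have "M \<subseteq> ?S"
  proof
    fix m assume "m \<in> M"
    then show "m \<in> ?S" by (intro CollectI exI[of _ "\<lambda>_. m"]) (simp add: upol_const)
  qed
  moreover have "?S \<subseteq> X" using upol_in[OF M_upol_X y(1)] by blast
  moreover have "y \<in> ?S" by (intro CollectI exI[of _ "\<lambda>x. x"]) (simp add: upol_id)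
  ultimately have "?S = X" using M_max y by blast
  then have "c \<in> ?S" using c by simp
  then show ?thesis by (elim CollectE exE conjE) (intro exI conjI, assumption, simp)
qed

text \<open>Among the idempotents \<open>\<eta>\<close> with constants in \<open>M\<close> and image \<open>E\<close> not inside \<open>M\<close>, one with \<open>E\<close> least admits no
  proper shrinking of \<open>E\<close> that fixes a point outside \<open>M\<close>. Rigidity then yields a permutation of \<open>E\<close> with
  constants in \<open>M\<close> that takes a point outside \<open>M\<close> into \<open>M\<close>.\<close>

lemma minset_not_sub:
  assumes V: "V \<in> minsets" and VM: "V \<subseteq> M"
  shows False
proof -
  let ?idem = "\<lambda>\<eta>. upol ar F M \<eta> \<and> (\<forall>x\<in>X. \<eta> (\<eta> x) = \<eta> x) \<and> \<not> \<eta> ` X \<subseteq> M"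
  have "?idem (\<lambda>x. x)" using upol_id[of ar F M] M_X M_prop by simp
  from ex_has_least_nat[of ?idem, OF this, where m = "\<lambda>\<eta>. card (\<eta> ` X)"]
  obtain \<eta> where \<eta>_least: "?idem \<eta> \<and> (\<forall>\<epsilon>. ?idem \<epsilon> \<longrightarrow> card (\<eta> ` X) \<le> card (\<epsilon> ` X))"
    by (rule exE)
  then have \<eta>: "?idem \<eta>" by (rule conjunct1)
  have least: "card (\<eta> ` X) \<le> card (\<epsilon> ` X)" if "?idem \<epsilon>" for \<epsilon>
    using conjunct2[OF \<eta>_least] that by (elim allE impE)
  define E where "E = \<eta> ` X"
  have \<eta>M: "upol ar F M \<eta>" and \<eta>X: "upol ar F X \<eta>" using \<eta> M_upol_X by auto
  have EX: "E \<subseteq> X" unfolding E_def using upol_in[OF \<eta>X] by blast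
  have finE: "finite E" using EX fin finite_subset by blast
  have \<eta>E: "\<eta> x = x" if "x \<in> E" for x using \<eta> that by (auto simp: E_def)
  obtain y0 where y0: "y0 \<in> E" "y0 \<notin> M" using \<eta> by (auto simp: E_def)
  obtain m0 where m0: "m0 \<in> M" "(m0, y0) \<in> \<beta>"
    using M_hit y0(1) EX congruence_sym[OF cong(2)] by blast
  \<comment> \<open>Along a chain from \<open>m0\<close> in M to \<open>y0\<close> outside M, some
    polynomial image of V must cross the border of M after \<eta> is applied.\<close>
  have "\<exists>p u v. upol ar F X p \<and> u \<in> V \<and> v \<in> V \<and> (u, v) \<in> \<beta> \<and> \<eta> (p u) \<in> M \<and> \<eta> (p v) \<notin> M"
  proof (rule ccontr)
    assume no: "\<not> ?thesis"
    have "\<eta> y0 \<in> M"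
    proof (rule chain[OF V m0(2), where P = "\<lambda>a. \<eta> a \<in> M"])
      show "\<eta> m0 \<in> M" using upol_closed[OF \<eta>M M_sub _ m0(1)] by simp
      show "\<eta> b \<in> M" if "(a, b) \<in> \<theta>" "\<eta> a \<in> M" for a b
        using M_sat[OF upol_congruence[OF \<eta>X cong(1) that(1)] that(2)] .
    qed (use no in blast)
    then show False using \<eta>E y0 by simp
  qed
  then obtain p u v where p: "upol ar F X p" "u \<in> V" "v \<in> V" "\<eta> (p u) \<in> M" "\<eta> (p v) \<notin> M" by blast
  define y where "y = \<eta> (p v)"
  have pX: "p u \<in> X" "p v \<in> X" using upol_in[OF p(1)] VM p(2,3) M_X by auto
  have y: "y \<in> X" "y \<notin> M" "y \<in> E" unfolding y_def using p(5) upol_in[OF \<eta>X pX(2)] pX(2) by (auto simp: E_def)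
  have uv: "u \<in> M" "v \<in> M" using p VM by auto
  \<comment> \<open>The constants of \<eta> p are expressed through y over M, so \<eta>(p(z)) = s(z,
    y) with s over M. Reading z as the parameter and y as the variable gives a map that fixes y when
    z = v.\<close>
  have "\<exists>h. pol ar F M (Suc 0) h \<and> h [y] = c" if c: "c \<in> X" for c
  proof -
    obtain h where "upol ar F M h" "h y = c" using generated[OF y(1,2) c] by blast
    then show ?thesis unfolding upol_def by (intro exI[of _ "\<lambda>xs. h (xs ! 0)"]) simp
  qed
  then obtain s where s: "pol ar F M (Suc (Suc 0)) s" "\<And>z. \<eta> (p z) = s [z, y]"
    using upol_param[OF upol_comp[OF \<eta>X p(1)], of "[y]" "Suc 0" M] by auto
  let ?t = "\<lambda>xs. \<eta> (s [xs ! 1, xs ! 0])"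
  have "pol ar F M (Suc (Suc 0)) (\<lambda>xs. s (map (\<lambda>j. xs ! (1 - j)) [0..<Suc (Suc 0)]))"
    by (rule pol_comp[OF s(1)]) (simp add: pol_proj)
  then have "pol ar F M (Suc (Suc 0)) (\<lambda>xs. s [xs ! 1, xs ! 0])" by simp
  then have t: "pol ar F M (Suc (Suc 0)) ?t" by (rule upol_comp_pol[OF \<eta>M])
  have \<sigma>: "upol ar F M (\<lambda>x. ?t (x # [z]))" if "z \<in> M" for z
    by (rule pol_Cons_upol[OF t]) (use that in auto)
  have sX: "s [z, x] \<in> X" if "z \<in> X" "x \<in> X" for z x
    using pol_closed[OF s(1) sub M_X, of "[z, x]"] that by simp
  have \<sigma>E: "?t (x # [z]) \<in> E" if "z \<in> X" "x \<in> X" for z x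
    using sX[OF that] by (auto simp: E_def)
  let ?\<sigma> = "\<lambda>x. ?t (x # [v])"
  have vX: "v \<in> X" "u \<in> X" using uv M_X by auto
  have "?\<sigma> y = y" using s(2)[of v] \<eta>E[OF y(3)] by (simp add: y_def)
  let ?K = "fact (card X) :: nat"
  define \<epsilon> where "\<epsilon> = ?\<sigma> ^^ ?K"
  have \<epsilon>y: "\<epsilon> y = y" unfolding \<epsilon>_def using \<open>?\<sigma> y = y\<close> by (rule funpow_fixed)
  have \<epsilon>M: "upol ar F M \<epsilon>" unfolding \<epsilon>_def by (rule upol_funpow[OF \<sigma>[OF uv(2)]])
  have \<sigma>X: "?\<sigma> ` X \<subseteq> X" using \<sigma>E[OF vX(1)] EX by blast
  have \<epsilon>\<epsilon>: "\<epsilon> (\<epsilon> x) = \<epsilon> x" if "x \<in> X" for x unfolding \<epsilon>_def using funpow_fact_idem[OF fin \<sigma>X that] .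
  have "?idem \<epsilon>" using \<epsilon>M \<epsilon>\<epsilon> y(1,2) \<epsilon>y by (metis imageI subsetD)
  then have "card E \<le> card (\<epsilon> ` X)" unfolding E_def by (rule least)
  obtain m where m: "?K = Suc m" by (metis fact_nonzero not0_implies_Suc)
  have "\<epsilon> ` X \<subseteq> E"
  proof
    fix z assume "z \<in> \<epsilon> ` X"
    then obtain x where x: "x \<in> X" "z = \<epsilon> x" by blast
    have "(?\<sigma> ^^ m) x \<in> X" using funpow_image[OF \<sigma>X, of m] x(1) by blast
    then show "z \<in> E" unfolding x(2) \<epsilon>_def m using \<sigma>E[OF vX(1)] by simp
  qed
  then have \<epsilon>E: "\<epsilon> ` X = E" using \<open>card E \<le> card (\<epsilon> ` X)\<close> finE card_seteq by blast
  have "inj_on ?\<sigma> E"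
  proof (rule inj_onI)
    fix a b assume ab: "a \<in> E" "b \<in> E" "?\<sigma> a = ?\<sigma> b"
    have "\<epsilon> a = \<epsilon> b" unfolding \<epsilon>_def m funpow_Suc_right comp_apply ab(3) ..
    moreover have "\<epsilon> a = a" "\<epsilon> b = b" using ab \<epsilon>E \<epsilon>\<epsilon> by auto
    ultimately show "a = b" by simp
  qed
  moreover have "?\<sigma> ` E \<subseteq> E" using \<sigma>E[OF vX(1)] EX by blast
  ultimately have "bij_betw ?\<sigma> E E" using endo_inj_surj[OF finE] by (auto simp: bij_betw_def)
  \<comment> \<open>Passing from v to u changes the parameter within M. The new permutation still
    respects M, yet it takes y, outside M, to \<eta>(p(u)) in M.\<close>
  then have bij: "bij_betw (\<lambda>x. ?t (x # [u])) E E"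
    using vX \<sigma>E[OF vX(2)] EX by (intro perm[OF pol_mono[OF t M_X] _ _ _ _ EX, of "[v]" "[u]"]) auto
  have "?t (y # [u]) \<in> M \<longleftrightarrow> y \<in> M"
    by (rule perm_preserves[OF finE bij _ y(3)]) (use upol_closed[OF \<sigma>[OF uv(1)] M_sub] in blast)
  moreover have "?t (y # [u]) = \<eta> (p u)" using s(2)[of u] pX(1) \<eta> by (auto simp flip: s(2))
  ultimately show False using p(4) y(2) by simp
qed

end

section \<open>Strongly abelian quotients\<close>

lemma rep_in: "S \<noteq> {} \<Longrightarrow> rep S \<in> S"
  unfolding rep_def by (metis some_in_eq)

lemma rep_class:
  assumes "equiv X r" "S \<in> X // r"
  shows "rep S \<in> X" "r `` {rep S} = S"
proof -
  have "rep S \<in> S" by (intro rep_in in_quotient_imp_non_empty[OF assms])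
  then show "rep S \<in> X" using in_quotient_imp_subset[OF assms] by blast
  show "r `` {rep S} = S" using \<open>rep S \<in> S\<close> assms
    by (metis Image_singleton_iff equiv_class_eq_iff quotientE)
qed

lemma quot_term:
  assumes cong: "congruence ar X F \<theta>" and X: "subuniv ar F X"
    and "(n, T) \<in> term_ops ar (quot_ops F \<theta>)"
  shows "\<exists>t. pol ar F {} n t \<and> (\<forall>Xs. length Xs = n \<longrightarrow> set Xs \<subseteq> X // \<theta> \<longrightarrow> T Xs = \<theta> `` {t (map rep Xs)})"
  using assms(3)
proof (induction n T rule: term_ops.induct)
  case (proj j n)
  have eq: "equiv X \<theta>" using cong by (simp add: congruence_def)
  have "Xs ! j = \<theta> `` {map rep Xs ! j}" if "length Xs = n" "set Xs \<subseteq> X // \<theta>" for Xs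
    using rep_class(2)[OF eq, of "Xs ! j"] that proj by (auto simp: subset_iff)
  then show ?case by (intro exI[of _ "\<lambda>xs. xs ! j"] conjI pol_proj proj) auto
next
  case (app i n g)
  have eq: "equiv X \<theta>" using cong by (simp add: congruence_def)
  let ?P = "\<lambda>j t. pol ar F {} n t \<and> (\<forall>Xs. length Xs = n \<longrightarrow> set Xs \<subseteq> X // \<theta> \<longrightarrow> g j Xs = \<theta> `` {t (map rep Xs)})"
  define t where "t j = (SOME t. ?P j t)" for j
  have t: "?P j (t j)" if "j < ar i" for j
    unfolding t_def by (rule someI_ex[OF app.IH[OF that]])
  let ?t = "\<lambda>xs. F i (map (\<lambda>j. t j xs) [0..<ar i])"
  have "quot_ops F \<theta> i (map (\<lambda>j. g j Xs) [0..<ar i]) = \<theta> `` {?t (map rep Xs)}"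
    if Xs: "length Xs = n" "set Xs \<subseteq> X // \<theta>" for Xs
  proof -
    have r: "set (map rep Xs) \<subseteq> X" using rep_class(1)[OF eq] Xs(2) by auto
    \<comment> \<open>Each inner node of the term chooses a new representative of its value; it
      differs from the value computed in X only within \<theta>.\<close>
    have *: "(rep (g j Xs), t j (map rep Xs)) \<in> \<theta>" if j: "j < ar i" for j
    proof -
      have "t j (map rep Xs) \<in> X"
        using Xs(1) r by (intro pol_closed[OF conjunct1[OF t[OF j]] X]) auto
      have g: "g j Xs = \<theta> `` {t j (map rep Xs)}" using conjunct2[OF t[OF j]] Xs by blast
      have "g j Xs \<in> X // \<theta>" unfolding g by (rule quotientI) fact
      then have "\<theta> `` {rep (g j Xs)} = \<theta> `` {t j (map rep Xs)}"
        using rep_class(2)[OF eq] g by simp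
      then show ?thesis using \<open>t j (map rep Xs) \<in> X\<close> by (rule eq_equiv_class[OF _ eq])
    qed
    have "list_all2 (\<lambda>x y. (x, y) \<in> \<theta>) (map rep (map (\<lambda>j. g j Xs) [0..<ar i])) (map (\<lambda>j. t j (map rep Xs)) [0..<ar i])"
      using * by (auto simp: list_all2_conv_all_nth)
    then have "(F i (map rep (map (\<lambda>j. g j Xs) [0..<ar i])), ?t (map rep Xs)) \<in> \<theta>"
      using cong unfolding congruence_def by simp
    then show ?thesis unfolding quot_ops_def by (rule equiv_class_eq[OF eq])
  qed
  moreover have "pol ar F {} n ?t" by (rule pol_app[OF conjunct1[OF t]])
  ultimately show ?case by (intro exI[of _ ?t]) blast
qed

section \<open>The case without a quasigroup polynomial\<close>

locale no_quasi = max_sub ar X F \<theta> \<beta> M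
  for ar :: "'i \<Rightarrow> nat" and X :: "'a set" and F :: "'i \<Rightarrow> 'a list \<Rightarrow> 'a" and \<theta> \<beta> :: "'a rel" and M +
  fixes V :: "'a set" and e :: "'a \<Rightarrow> 'a"
  assumes V: "V \<in> minsets" and eM: "upol ar F M e" and eV: "e ` X = V"
    and e_id: "\<And>x. x \<in> V \<Longrightarrow> e x = x"
    and no_quasi: "\<And>g. \<not> quasi V g"
    and theta_max: "\<And>\<psi>. congruence ar X F \<psi> \<Longrightarrow> \<theta> \<subseteq> \<psi> \<Longrightarrow> (\<And>x y. (x, y) \<in> \<psi> \<Longrightarrow> x \<in> M \<Longrightarrow> y \<in> M) \<Longrightarrow> \<psi> = \<theta>"
begin

lemma eX: "upol ar F X e" by (rule M_upol_X[OF eM])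
lemma e_in: "x \<in> X \<Longrightarrow> e x \<in> V" using eV by blast
lemma VX: "V \<subseteq> X" by (rule minsets_sub[OF V])

text \<open>For f with values in V, rigidity carries a permutation for one \<open>w\<close> to all
  others, so activity belongs to the variable and not to the remaining arguments.\<close>

definition active :: "nat \<Rightarrow> ('a list \<Rightarrow> 'a) \<Rightarrow> nat \<Rightarrow> bool" where
  "active n f i \<longleftrightarrow> (\<exists>p w. upol ar F X p \<and> length w = n \<and> set w \<subseteq> X \<and> bij_betw (\<lambda>z. f (w[i := p z])) V V)"

definition Vpol :: "nat \<Rightarrow> ('a list \<Rightarrow> 'a) \<Rightarrow> bool" where
  "Vpol n f \<longleftrightarrow> pol ar F X n f \<and> (\<forall>w. length w = n \<longrightarrow> set w \<subseteq> X \<longrightarrow> f w \<in> V)"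

lemma Vpol_upd:
  assumes "Vpol n f" "upol ar F X p" "i < n" "length w = n" "set w \<subseteq> X"
  shows "upol ar F X (\<lambda>z. f (w[i := p z]))" "z \<in> X \<Longrightarrow> f (w[i := p z]) \<in> V"
    "(\<lambda>z. f (w[i := p z])) ` V \<subseteq> V"
proof -
  show "upol ar F X (\<lambda>z. f (w[i := p z]))"
    by (rule upol_upd[OF _ assms(2-5)]) (use assms(1) in \<open>simp add: Vpol_def\<close>)
  have *: "f (w[i := p z]) \<in> V" if "z \<in> X" for z
    using assms upol_in[OF assms(2) that] set_update_subsetI[OF assms(5)] by (simp add: Vpol_def)
  then show "z \<in> X \<Longrightarrow> f (w[i := p z]) \<in> V" by simp
  show "(\<lambda>z. f (w[i := p z])) ` V \<subseteq> V" using * VX by blast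
qed

lemma Vpol_perm_upd:
  assumes "Vpol n f" "upol ar F X p" "i < n" "length w = n" "set w \<subseteq> X" "length w' = n" "set w' \<subseteq> X"
    and "bij_betw (\<lambda>z. f (w[i := p z])) V V"
  shows "bij_betw (\<lambda>z. f (w'[i := p z])) V V"
  using assms(1) perm_upd[OF _ assms(2,3,4,6,5,7) VX assms(8) Vpol_upd(3)[OF assms(1-3,6,7)]]
  by (simp add: Vpol_def)

text \<open>Varying two active variables together gives a binary polynomial on V. By rigidity each
  of its rows and columns is a permutation, which is the excluded quasigroup.\<close>

lemma active_unique:
  assumes "Vpol n f" "i < n" "j < n" "active n f i" "active n f j"
  shows "i = j"
proof (rule ccontr)
  assume ij: "i \<noteq> j"
  obtain p w where p: "upol ar F X p" "length w = n" "set w \<subseteq> X" "bij_betw (\<lambda>z. f (w[i := p z])) V V"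
    using assms(4) unfolding active_def by (elim exE conjE)
  obtain q w' where q: "upol ar F X q" "length w' = n" "set w' \<subseteq> X" "bij_betw (\<lambda>z. f (w'[j := q z])) V V"
    using assms(5) unfolding active_def by (elim exE conjE)
  let ?g = "\<lambda>xs. f (w[i := p (xs ! 0), j := q (xs ! 1)])"
  have f: "pol ar F X n f" using assms(1) by (simp add: Vpol_def)
  have "pol ar F X 2 (\<lambda>xs. f (map (\<lambda>k. if k = j then q (xs ! 1) else if k = i then p (xs ! 0) else w ! k) [0..<n]))"
  proof (rule pol_comp[OF f])
    fix k assume "k < n"
    then have "w ! k \<in> X" using p(2,3) by auto
    then show "pol ar F X 2 (\<lambda>xs. if k = j then q (xs ! 1) else if k = i then p (xs ! 0) else w ! k)"
      by (cases "k = j"; cases "k = i")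
        (simp_all add: pol_const upol_comp_pol[OF q(1) pol_proj] upol_comp_pol[OF p(1) pol_proj])
  qed
  moreover have "map (\<lambda>k. if k = j then b else if k = i then a else w ! k) [0..<n] = w[i := a, j := b]" for a b
    using p(2) by (intro nth_equalityI) (auto simp: nth_list_update)
  ultimately have g: "pol ar F X 2 ?g" by simp
  have u: "set (w[k := r z]) \<subseteq> X" if "upol ar F X r" "z \<in> V" for k r z
    using upol_in[OF that(1)] that(2) VX p(3) by (intro set_update_subsetI) auto
  have 1: "bij_betw (\<lambda>y. ?g [x, y]) V V" if "x \<in> V" for x
    using Vpol_perm_upd[OF assms(1) q(1) assms(3) q(2,3) _ u[OF p(1) that] q(4)] p(2) by simp
  have 2: "bij_betw (\<lambda>x. ?g [x, y]) V V" if "y \<in> V" for y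
    using Vpol_perm_upd[OF assms(1) p(1) assms(2) p(2,3) _ u[OF q(1) that] p(4), of j] p(2) ij
    by (simp add: list_update_swap[of i j])
  have "?g [x, y] \<in> V" if "x \<in> V" "y \<in> V" for x y using 1[OF that(1)] that(2) by (auto simp: bij_betw_def)
  then have "quasi V ?g" using g 1 2 unfolding quasi_def by blast
  then show False using no_quasi by blast
qed

text \<open>Join z to z' by a chain. No polynomial substituted for this variable permutes V, so the
  dichotomy collapses every link that comes from V.\<close>

lemma inactive:
  assumes "Vpol n f" "i < n" "\<not> active n f i" "(z, z') \<in> \<beta>" "length w = n" "set w \<subseteq> X"
  shows "(f (w[i := z]), f (w[i := z'])) \<in> \<theta>"
proof (rule chain[OF V assms(4), where P = "\<lambda>a. (f (w[i := z]), f (w[i := a])) \<in> \<theta>"])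
  have fX: "upol ar F X (\<lambda>a. f (w[i := a]))" using Vpol_upd(1)[OF assms(1) upol_id assms(2,5,6)] .
  show "(f (w[i := z]), f (w[i := z])) \<in> \<theta>"
    using upol_in[OF fX beta_X(1)[OF assms(4)]] congruence_refl[OF cong(1)] by simp
  show "(f (w[i := z]), f (w[i := b])) \<in> \<theta>" if "(a, b) \<in> \<theta>" "(f (w[i := z]), f (w[i := a])) \<in> \<theta>" for a b
    using congruence_trans[OF cong(1) that(2)] upol_congruence[OF fX cong(1) that(1)] by simp
  show "(f (w[i := z]), f (w[i := p v])) \<in> \<theta>"
    if "upol ar F X p" "u \<in> V" "v \<in> V" "(u, v) \<in> \<beta>" "(f (w[i := z]), f (w[i := p u])) \<in> \<theta>" for p u v
  proof -
    have "\<not> bij_betw (\<lambda>z. f (w[i := p z])) V V"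
      using assms(3,5,6) that(1) unfolding active_def by blast
    from min_bij_or[OF V Vpol_upd(1,3)[OF assms(1) that(1) assms(2,5,6)] this that(2-4)]
    show ?thesis using congruence_trans[OF cong(1) that(5)] by simp
  qed
qed

lemma same_M: "(x, y) \<in> \<theta> \<Longrightarrow> x \<in> M \<longleftrightarrow> y \<in> M"
  using M_sat congruence_sym[OF cong(1)] by blast

text \<open>On V, f is e(t(x, L)) with x as active variable. The parameters L are therefore inactive
  and can be moved into M while the value stays in its \<theta>-class. With parameters in M the
  permutation respects M, and M is a union of \<theta>-classes.\<close>

lemma perm_M:
  assumes f: "upol ar F X f" "bij_betw f V V" "x \<in> V"
  shows "f x \<in> M \<longleftrightarrow> x \<in> M"
proof -
  obtain L t where t: "pol ar F {} (Suc (length L)) t" "set L = X" "\<And>x. f x = t (x # L)"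
    by (rule upol_enum_param[OF f(1) fin]) (rule that; assumption)
  let ?n = "length L" and ?L = "map toM L"
  have L': "set ?L \<subseteq> M" "length ?L = length L" using toM_list t(2) by auto
  let ?h = "\<lambda>xs. e (t xs)"
  have hM: "pol ar F M (Suc ?n) ?h" by (rule upol_comp_pol[OF eM pol_mono[OF t(1)]]) simp
  have h: "Vpol (Suc ?n) ?h"
    unfolding Vpol_def using pol_mono[OF hM M_X] pol_closed[OF t(1) sub] e_in by simp
  have fV: "f z \<in> V" if "z \<in> V" for z using f(2) that by (auto simp: bij_betw_def)
  have bij: "bij_betw (\<lambda>z. ?h (z # L)) V V"
    using f(2) by (rule bij_betw_cong[THEN iffD1, rotated]) (simp add: fV e_id flip: t(3))
  have xX: "x \<in> X" using f(3) VX by blast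
  have act: "active (Suc ?n) ?h 0"
    unfolding active_def
    by (rule exI[of _ "\<lambda>x. x"], rule exI[of _ "x # L"]) (use bij xX t(2) upol_id in simp)
  have bij': "bij_betw (\<lambda>z. ?h (z # ?L)) V V"
    using Vpol_perm_upd[OF h upol_id, of 0 "x # L" "x # ?L"] bij xX t(2) L' M_X by auto
  have hu: "upol ar F M (\<lambda>z. ?h (z # ?L))" by (rule pol_Cons_upol[OF hM L'(2,1)])
  have eq: "?h (x # ?L) \<in> M \<longleftrightarrow> x \<in> M"
    by (rule perm_preserves[OF minset_fin[OF V] bij' upol_closed[OF hu M_sub subset_refl] f(3)])
  have "(?h (x # L), ?h (x # ?L)) \<in> \<theta>"
  proof (rule coordinatewise[where f = "\<lambda>l. ?h (x # l)" and R = "\<lambda>a b. (a, b) \<in> \<theta>" and n = ?n and X = X and \<beta> = \<beta>])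
    show "(?h (x # w[i := z]), ?h (x # w[i := z'])) \<in> \<theta>"
      if "i < ?n" "length w = ?n" "set w \<subseteq> X" "(z, z') \<in> \<beta>" for i w z z'
    proof -
      have "\<not> active (Suc ?n) ?h (Suc i)" using active_unique[OF h, of 0 "Suc i"] that(1) act by auto
      from inactive[OF h _ this that(4), of "x # w"] show ?thesis using that xX by simp
    qed
    show "(a, a) \<in> \<theta>" if "a \<in> (\<lambda>l. ?h (x # l)) ` {w. length w = ?n \<and> set w \<subseteq> X}" for a
      using that h VX xX by (intro congruence_refl[OF cong(1)]) (auto simp: Vpol_def)
    show "(a, c) \<in> \<theta>" if "(a, b) \<in> \<theta>" "(b, c) \<in> \<theta>" for a b c
      using congruence_trans[OF cong(1) that] .
    show "list_all2 (\<lambda>x y. (x, y) \<in> \<beta>) L ?L" using toM_list(2) t(2) by simp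
    show "\<beta> \<subseteq> X \<times> X" using beta_X by auto
  qed simp
  then have "?h (x # L) \<in> M \<longleftrightarrow> ?h (x # ?L) \<in> M" by (rule same_M)
  moreover have "?h (x # L) = f x" using fV[OF f(3)] e_id t(3) by simp
  ultimately show ?thesis using eq by simp
qed

text \<open>Inactive variables can be moved into M modulo \<theta>, which settles the case without
  active variables. Otherwise compare two lists m, m' over M while the active argument travels along
  a chain from M to z. On each image of V either both polynomials permute V, and
  \<open>perm_M\<close> reads membership off the point of V, or neither does, and both values keep
  their \<theta>-classes.\<close>

lemma one_variable:
  assumes f: "Vpol n f" "pol ar F M n f"
  shows "\<exists>i. \<forall>w w'. length w = n \<longrightarrow> length w' = n \<longrightarrow> set w \<subseteq> X \<longrightarrow> set w' \<subseteq> X \<longrightarrow>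
     (i < n \<longrightarrow> w ! i = w' ! i) \<longrightarrow> (f w \<in> M \<longleftrightarrow> f w' \<in> M)"
proof -
  have fin_X: "f w \<in> X" if "length w = n" "set w \<subseteq> X" for w
    using f(1) that VX by (auto simp: Vpol_def)
  have bX: "\<beta> \<subseteq> X \<times> X" using beta_X by auto
  show ?thesis
  proof (cases "\<exists>i<n. active n f i")
    case False
    have "f w \<in> M" if w: "length w = n" "set w \<subseteq> X" for w
    proof -
      have "(f w, f (map toM w)) \<in> \<theta>"
      proof (rule coordinatewise[where f = f and R = "\<lambda>a b. (a, b) \<in> \<theta>" and n = n and X = X and \<beta> = \<beta>])
        show "(f (w[i := z]), f (w[i := z'])) \<in> \<theta>"
          if "i < n" "length w = n" "set w \<subseteq> X" "(z, z') \<in> \<beta>" for i w z z'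
          using inactive[OF f(1) that(1) _ that(4,2,3)] False that(1) by blast
      qed (use fin_X congruence_refl[OF cong(1)] congruence_trans[OF cong(1)] toM_list w bX in auto)
      moreover have "f (map toM w) \<in> M"
        using pol_closed[OF f(2) M_sub subset_refl] toM_list(1)[OF w(2)] w(1) by simp
      ultimately show ?thesis using same_M by blast
    qed
    then show ?thesis by blast
  next
    case True
    then obtain i where i: "i < n" "active n f i" by blast
    have key: "f w \<in> M \<longleftrightarrow> f w' \<in> M"
      if w: "length w = n" "length w' = n" "set w \<subseteq> X" "set w' \<subseteq> X" "w ! i = w' ! i" for w w'
    proof -
      define z where "z = w ! i"
      have zX: "z \<in> X" using w i by (auto simp: z_def)
      have toz: "(f v, f ((map toM v)[i := z])) \<in> \<theta>" if v: "length v = n" "set v \<subseteq> X" "v ! i = z" for v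
      proof -
        have "(f (v[i := z]), f ((map toM v)[i := z])) \<in> \<theta>"
        proof (rule coordinatewise[where f = "\<lambda>v. f (v[i := z])" and R = "\<lambda>a b. (a, b) \<in> \<theta>" and n = n and X = X and \<beta> = \<beta>])
          show "(f (w[j := a, i := z]), f (w[j := b, i := z])) \<in> \<theta>"
            if "j < n" "length w = n" "set w \<subseteq> X" "(a, b) \<in> \<beta>" for j w a b
          proof -
            have wi: "set (w[i := z]) \<subseteq> X" using zX that(3) by (intro set_update_subsetI)
            show ?thesis
            proof (cases "j = i")
              case True
              then show ?thesis using fin_X[OF _ wi] that(2) congruence_refl[OF cong(1)] by simp
            next
              case False
              then have "\<not> active n f j" using active_unique[OF f(1) that(1) i(1)] i(2) by blast
              then show ?thesis
                using inactive[OF f(1) that(1) _ that(4) _ wi] that(2) False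
                by (simp add: list_update_swap)
            qed
          qed
          show "(a, a) \<in> \<theta>" if a: "a \<in> (\<lambda>v. f (v[i := z])) ` {w. length w = n \<and> set w \<subseteq> X}" for a
          proof -
            obtain v where v: "length v = n" "set v \<subseteq> X" "a = f (v[i := z])" using a by blast
            have "set (v[i := z]) \<subseteq> X" using zX v(2) by (intro set_update_subsetI)
            then show ?thesis using fin_X v congruence_refl[OF cong(1)] by simp
          qed
          show "(a, c) \<in> \<theta>" if "(a, b) \<in> \<theta>" "(b, c) \<in> \<theta>" for a b c
            using congruence_trans[OF cong(1) that] .
        qed (use toM_list v bX in auto)
        then show ?thesis using v(3) list_update_id by metis
      qed
      define m where "m = map toM w"
      define m' where "m' = map toM w'"
      have m: "length m = n" "set m \<subseteq> M" "length m' = n" "set m' \<subseteq> M"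
        using w toM_list(1)[OF w(3)] toM_list(1)[OF w(4)] by (auto simp: m_def m'_def)
      have mX: "set m \<subseteq> X" "set m' \<subseteq> X" using m M_X by auto
      have zm: "(toM z, z) \<in> \<beta>" "toM z \<in> M" using toM[OF zX] congruence_sym[OF cong(2)] by auto
      have "f (m[i := z]) \<in> M \<longleftrightarrow> f (m'[i := z]) \<in> M"
      proof (rule chain[OF V zm(1), where P = "\<lambda>a. f (m[i := a]) \<in> M \<longleftrightarrow> f (m'[i := a]) \<in> M"])
        have "f (m[i := toM z]) \<in> M" "f (m'[i := toM z]) \<in> M"
          using m set_update_subsetI[OF m(2) zm(2)] set_update_subsetI[OF m(4) zm(2)]
          by (simp_all add: pol_closed[OF f(2) M_sub subset_refl])
        then show "f (m[i := toM z]) \<in> M \<longleftrightarrow> f (m'[i := toM z]) \<in> M" by simp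
        show "f (m[i := b]) \<in> M \<longleftrightarrow> f (m'[i := b]) \<in> M"
          if "(a, b) \<in> \<theta>" "f (m[i := a]) \<in> M \<longleftrightarrow> f (m'[i := a]) \<in> M" for a b
          using same_M[OF upol_congruence[OF Vpol_upd(1)[OF f(1) upol_id i(1) m(1) mX(1)] cong(1) that(1)]]
            same_M[OF upol_congruence[OF Vpol_upd(1)[OF f(1) upol_id i(1) m(3) mX(2)] cong(1) that(1)]] that(2)
          by simp
        show "f (m[i := p v]) \<in> M \<longleftrightarrow> f (m'[i := p v]) \<in> M"
          if p: "upol ar F X p" and uv: "u \<in> V" "v \<in> V" "(u, v) \<in> \<beta>"
            and eq: "f (m[i := p u]) \<in> M \<longleftrightarrow> f (m'[i := p u]) \<in> M" for p u v
        proof (cases "bij_betw (\<lambda>z. f (m[i := p z])) V V")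
          case True
          then have T': "bij_betw (\<lambda>z. f (m'[i := p z])) V V"
            using Vpol_perm_upd[OF f(1) p i(1) m(1) mX(1) m(3) mX(2)] by blast
          show ?thesis
            using perm_M[OF Vpol_upd(1)[OF f(1) p i(1) m(1) mX(1)] True uv(2)]
              perm_M[OF Vpol_upd(1)[OF f(1) p i(1) m(3) mX(2)] T' uv(2)] by simp
        next
          case False
          then have F': "\<not> bij_betw (\<lambda>z. f (m'[i := p z])) V V"
            using Vpol_perm_upd[OF f(1) p i(1) m(3) mX(2) m(1) mX(1)] by blast
          show ?thesis
            using same_M[OF min_bij_or[OF V Vpol_upd(1,3)[OF f(1) p i(1) m(1) mX(1)] False uv]]
              same_M[OF min_bij_or[OF V Vpol_upd(1,3)[OF f(1) p i(1) m(3) mX(2)] F' uv]] eq by simp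
        qed
      qed
      moreover have "w' ! i = z" using w(5) by (simp add: z_def)
      ultimately show ?thesis
        using same_M[OF toz[OF w(1,3)]] same_M[OF toz[OF w(2,4)]] by (simp add: m_def m'_def z_def)
    qed
    show ?thesis by (rule exI[of _ i]) (use key i(1) in blast)
  qed
qed

text \<open>The pairs satisfying the condition form a congruence \<psi> above \<theta>. The
  \<psi>-hull of M omits a point c of V outside M, because e fixes c and maps M into M. So the hull
  is M by maximality of M, and \<psi> = \<theta> by maximality of \<theta>.\<close>

lemma theta_char:
  assumes "x \<in> X" "y \<in> X" "\<And>p. upol ar F X p \<Longrightarrow> e (p x) \<in> M \<longleftrightarrow> e (p y) \<in> M"
  shows "(x, y) \<in> \<theta>"
proof -
  define \<psi> where "\<psi> = {(x, y). x \<in> X \<and> y \<in> X \<and> (\<forall>p. upol ar F X p \<longrightarrow> (e (p x) \<in> M \<longleftrightarrow> e (p y) \<in> M))}"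
  have \<psi>X: "\<psi> \<subseteq> X \<times> X" by (auto simp: \<psi>_def)
  have "equiv X \<psi>"
    by (rule equivI) (auto simp: \<psi>_def refl_on_def sym_def trans_def)
  moreover have "(g a, g b) \<in> \<psi>" if g: "upol ar F X g" and "(a, b) \<in> \<psi>" for g a b
  proof -
    have ab: "a \<in> X" "b \<in> X" and *: "\<And>p. upol ar F X p \<Longrightarrow> e (p a) \<in> M \<longleftrightarrow> e (p b) \<in> M"
      using that(2) by (auto simp: \<psi>_def)
    have "e (p (g a)) \<in> M \<longleftrightarrow> e (p (g b)) \<in> M" if "upol ar F X p" for p
      using *[OF upol_comp[OF that g]] .
    then show ?thesis unfolding \<psi>_def using upol_in[OF g] ab by simp
  qed
  ultimately have cpsi: "congruence ar X F \<psi>" using \<psi>X by (intro congruence_from_upol[OF alg])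
  have sub: "\<theta> \<subseteq> \<psi>"
  proof
    fix q assume "q \<in> \<theta>"
    then obtain a b where q: "q = (a, b)" "(a, b) \<in> \<theta>" by (cases q) auto
    have "e (p a) \<in> M \<longleftrightarrow> e (p b) \<in> M" if "upol ar F X p" for p
      using same_M[OF upol_congruence[OF upol_comp[OF eX that] cong(1) q(2)]] .
    then show "q \<in> \<psi>" unfolding q \<psi>_def using congruence_in[OF cong(1) q(2)] by simp
  qed
  obtain c where c: "c \<in> V" "c \<notin> M" using minset_not_sub[OF V] by blast
  define S where "S = {x \<in> X. \<exists>m\<in>M. (x, m) \<in> \<psi>}"
  have "subuniv ar F S" unfolding S_def by (rule subuniv_hull[OF cpsi M_sub])
  moreover have "M \<subseteq> S" using M_X congruence_refl[OF cpsi] by (auto simp: S_def)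
  moreover have "S \<subseteq> X" by (auto simp: S_def)
  moreover have "c \<notin> S"
  proof
    assume "c \<in> S"
    then obtain m where m: "m \<in> M" "(c, m) \<in> \<psi>" by (auto simp: S_def)
    then have "e c \<in> M \<longleftrightarrow> e m \<in> M" using upol_id[of ar F X] by (auto simp: \<psi>_def)
    moreover have "e m \<in> M" using upol_closed[OF eM M_sub subset_refl m(1)] .
    ultimately show False using c e_id by simp
  qed
  ultimately have "S = M" using M_max c(1) VX by blast
  then have SM: "y \<in> M" if "y \<in> X" "m \<in> M" "(y, m) \<in> \<psi>" for y m
    using that by (auto simp: S_def)
  have "\<psi> = \<theta>"
    using \<psi>X SM[OF _ _ congruence_sym[OF cpsi]] by (intro theta_max[OF cpsi sub]) blast
  then show ?thesis using assms by (auto simp: \<psi>_def)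
qed

text \<open>By \<open>theta_char\<close> only the membership of e(p(t(...))) in M has to be
  compared. Once the constants of p are made variables, \<open>one_variable\<close> leaves one
  variable that matters. If it is the first, both sides have the same d there; otherwise the first
  argument can be exchanged, d for a on one side and b for d on the other, and \<open>eq\<close>
  joins the two.\<close>

lemma strong_term_condition:
  assumes t: "pol ar F {} (Suc k) t" and X: "a \<in> X" "b \<in> X" "d \<in> X" "set cs \<subseteq> X" "set ds \<subseteq> X"
    and len: "length cs = k" "length ds = k" and eq: "(t (a # cs), t (b # ds)) \<in> \<theta>"
  shows "(t (d # cs), t (d # ds)) \<in> \<theta>"
proof (rule theta_char)
  show "t (d # cs) \<in> X" "t (d # ds) \<in> X"
    using X len by (auto intro!: pol_closed[OF t sub])
  fix p assume p: "upol ar F X p"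
  obtain L r where r: "pol ar F {} (Suc (length L)) r" "set L = X" "\<And>x. p x = r (x # L)"
    by (rule upol_enum_param[OF p fin]) (rule that; assumption)
  let ?n = "Suc k + length L"
  let ?f = "\<lambda>w. e (r (t (take (Suc k) w) # drop (Suc k) w))"
  have take: "pol ar F {} ?n (\<lambda>w. t (map (\<lambda>j. w ! j) [0..<Suc k]))"
    by (rule pol_comp[OF t]) (simp add: pol_proj)
  have "pol ar F {} ?n (\<lambda>w. r (map (\<lambda>j. if j = 0 then t (map (\<lambda>j. w ! j) [0..<Suc k]) else w ! (k + j)) [0..<Suc (length L)]))"
  proof (rule pol_comp[OF r(1)])
    fix j assume "j < Suc (length L)"
    then show "pol ar F {} ?n (\<lambda>w. if j = 0 then t (map (\<lambda>j. w ! j) [0..<Suc k]) else w ! (k + j))"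
      using take by (cases "j = 0") (simp_all add: pol_proj del: upt_Suc)
  qed
  then have "pol ar F {} ?n (\<lambda>w. r (t (take (Suc k) w) # drop (Suc k) w))"
  proof (rule pol_cong)
    fix w :: "'a list" assume w: "length w = ?n"
    have 1: "map (\<lambda>j. w ! j) [0..<Suc k] = take (Suc k) w"
      using w by (intro nth_equalityI) (auto simp del: upt_Suc)
    have "map (\<lambda>j. if j = 0 then t (map (\<lambda>j. w ! j) [0..<Suc k]) else w ! (k + j)) [0..<Suc (length L)]
       = t (take (Suc k) w) # drop (Suc k) w"
      unfolding 1 using w by (intro nth_equalityI) (auto simp: nth_Cons' simp del: upt_Suc)
    then show "r (t (take (Suc k) w) # drop (Suc k) w) = 
       r (map (\<lambda>j. if j = 0 then t (map (\<lambda>j. w ! j) [0..<Suc k]) else w ! (k + j)) [0..<Suc (length L)])"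
      by simp
  qed
  then have rt: "pol ar F {} ?n (\<lambda>w. r (t (take (Suc k) w) # drop (Suc k) w))" .
  have fM: "pol ar F M ?n ?f" by (rule upol_comp_pol[OF eM pol_mono[OF rt]]) simp
  have fV: "Vpol ?n ?f"
    unfolding Vpol_def using pol_mono[OF fM M_X] pol_closed[OF rt sub] e_in by simp
  obtain i where i: "\<And>w w'. length w = ?n \<Longrightarrow> length w' = ?n \<Longrightarrow> set w \<subseteq> X \<Longrightarrow> set w' \<subseteq> X \<Longrightarrow>
     (i < ?n \<Longrightarrow> w ! i = w' ! i) \<Longrightarrow> ?f w \<in> M \<longleftrightarrow> ?f w' \<in> M"
    using one_variable[OF fV fM] by blast
  define h where "h x ys = ?f (x # ys @ L)" for x ys
  have h: "h x ys = e (p (t (x # ys)))" if "length ys = k" for x ys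
    using that r(3) by (simp add: h_def)
  have hi: "h x ys \<in> M \<longleftrightarrow> h x' ys' \<in> M"
    if "length ys = k" "length ys' = k" "set ys \<subseteq> X" "set ys' \<subseteq> X" "x \<in> X" "x' \<in> X"
      "i < ?n \<Longrightarrow> (x # ys @ L) ! i = (x' # ys' @ L) ! i" for x x' ys ys'
    unfolding h_def by (rule i) (use that r(2) in auto)
  have e: "h a cs \<in> M \<longleftrightarrow> h b ds \<in> M"
    unfolding h[OF len(1)] h[OF len(2)]
    using same_M[OF upol_congruence[OF upol_comp[OF eX p] cong(1) eq]] .
  have "h d cs \<in> M \<longleftrightarrow> h d ds \<in> M"
  proof (cases "i = 0")
    case True
    then show ?thesis using X len by (intro hi) auto
  next
    case False
    have "h d cs \<in> M \<longleftrightarrow> h a cs \<in> M" "h b ds \<in> M \<longleftrightarrow> h d ds \<in> M"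
      by (rule hi; use X len False in \<open>simp add: nth_Cons'\<close>)+
    then show ?thesis using e by simp
  qed
  then show "e (p (t (d # cs))) \<in> M \<longleftrightarrow> e (p (t (d # ds))) \<in> M"
    unfolding h[OF len(1)] h[OF len(2)] .
qed

theorem sa_quotient: "has_nontrivial_sa_quotient ar X F"
proof -
  have eq: "equiv X \<theta>" using cong(1) by (simp add: congruence_def)
  obtain m where m: "m \<in> M" using M_ne by blast
  obtain c where c: "c \<in> X" "c \<notin> M" using M_prop M_X by blast
  have "\<theta> `` {m} \<noteq> \<theta> `` {c}"
    using eq_equiv_class[OF _ eq c(1)] M_sat[OF _ m] c(2) by blast
  then have nt: "\<exists>S\<in>X // \<theta>. \<exists>S'\<in>X // \<theta>. S \<noteq> S'"
    using m c(1) M_X by (blast intro: quotientI)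
  have "strongly_abelian ar (X // \<theta>) (quot_ops F \<theta>)"
    unfolding strongly_abelian_def
  proof (intro allI impI)
    fix k T A B D Cs Ds
    assume T: "(Suc k, T) \<in> term_ops ar (quot_ops F \<theta>)" and Q: "A \<in> X // \<theta>" "B \<in> X // \<theta>" "D \<in> X // \<theta>"
      and len: "length Cs = k" "length Ds = k" and sets: "set Cs \<subseteq> X // \<theta>" "set Ds \<subseteq> X // \<theta>"
      and TT: "T (A # Cs) = T (B # Ds)"
    obtain t where t: "pol ar F {} (Suc k) t"
      "\<And>Xs. length Xs = Suc k \<Longrightarrow> set Xs \<subseteq> X // \<theta> \<Longrightarrow> T Xs = \<theta> `` {t (map rep Xs)}"
      using quot_term[OF cong(1) sub T] by blast
    have r: "rep S \<in> X" if "S \<in> X // \<theta>" for S using rep_class(1)[OF eq that] .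
    have rs: "set (map rep Cs) \<subseteq> X" "set (map rep Ds) \<subseteq> X" using r sets by auto
    have "\<theta> `` {t (rep A # map rep Cs)} = \<theta> `` {t (rep B # map rep Ds)}"
      using TT t(2)[of "A # Cs"] t(2)[of "B # Ds"] Q sets len by simp
    moreover have "t (rep B # map rep Ds) \<in> X"
      using r[OF Q(2)] rs len by (intro pol_closed[OF t(1) sub]) auto
    ultimately have "(t (rep A # map rep Cs), t (rep B # map rep Ds)) \<in> \<theta>"
      using eq_equiv_class[OF _ eq] by blast
    then have "(t (rep D # map rep Cs), t (rep D # map rep Ds)) \<in> \<theta>"
      using r Q rs len by (intro strong_term_condition[OF t(1)]) auto
    then show "T (D # Cs) = T (D # Ds)"
      using t(2)[of "D # Cs"] t(2)[of "D # Ds"] Q sets len equiv_class_eq[OF eq] by simp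
  qed
  then show ?thesis unfolding has_nontrivial_sa_quotient_def using cong(1) nt by blast
qed

end

section \<open>Quasigroup polynomials and type 2\<close>

context rigid_alg
begin

text \<open>The usual Malcev term of a quasigroup: d(x, y, w) is the product of x / q(y, y) and q(y,
  w), with / right division and q(y, w) the solution z of y z = w. Divisions are polynomials because
  a translation of the finite set V has an iterate as inverse.\<close>

lemma quasi_malcev:
  assumes q: "quasi V g" and VX: "V \<subseteq> X"
  obtains d where "pol ar F X 3 d" "\<And>x y w. x \<in> V \<Longrightarrow> y \<in> V \<Longrightarrow> w \<in> V \<Longrightarrow> d [x, y, w] \<in> V"
    "\<And>x y. x \<in> V \<Longrightarrow> y \<in> V \<Longrightarrow> d [x, x, y] = y" "\<And>x y. x \<in> V \<Longrightarrow> y \<in> V \<Longrightarrow> d [x, y, y] = x"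
proof -
  have finV: "finite V" using VX fin finite_subset by blast
  have g: "pol ar F X 2 g" and b1: "\<And>x. x \<in> V \<Longrightarrow> bij_betw (\<lambda>y. g [x, y]) V V"
    and b2: "\<And>y. y \<in> V \<Longrightarrow> bij_betw (\<lambda>x. g [x, y]) V V" using q by (auto simp: quasi_def)
  have gV: "g [x, y] \<in> V" if "x \<in> V" "y \<in> V" for x y using q that by (auto simp: quasi_def)
  obtain m where m: "fact (card V) = Suc m" by (metis fact_nonzero not0_implies_Suc)
  have gs: "pol ar F X 2 (\<lambda>xs. g [xs ! 1, xs ! 0])"
    by (rule pol_comp2[OF g]) (simp_all add: pol_proj)
  define rd where "rd = (\<lambda>xs. ((\<lambda>x. g (x # tl xs)) ^^ m) (hd xs))"
  define ld where "ld = (\<lambda>xs. ((\<lambda>x. g [(x # tl xs) ! 1, (x # tl xs) ! 0]) ^^ m) (hd xs))"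
  have rd: "pol ar F X 2 rd" and ld: "pol ar F X 2 ld"
    unfolding rd_def ld_def using pol_iter[of ar F X 1 g m] pol_iter[of ar F X 1 "\<lambda>xs. g [xs ! 1, xs ! 0]" m] g gs
    by (simp_all add: numeral_2_eq_2)
  have rdV: "rd [x, y] \<in> V" "g [rd [x, y], y] = x" "rd [g [x, y], y] = x" if xy: "x \<in> V" "y \<in> V" for x y
  proof -
    let ?f = "\<lambda>x. g [x, y]"
    have "?f ` V \<subseteq> V" using gV xy by blast
    then show "rd [x, y] \<in> V" using funpow_image[of ?f V m] xy by (auto simp: rd_def)
    have "(?f ^^ Suc m) x = x" using funpow_fact_id[OF finV b2[OF xy(2)] xy(1)] m by simp
    then show "g [rd [x, y], y] = x" by (simp add: rd_def)
    show "rd [g [x, y], y] = x"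
      using \<open>(?f ^^ Suc m) x = x\<close> unfolding funpow_Suc_right by (simp add: rd_def)
  qed
  have ldV: "ld [y, x] \<in> V" "g [x, ld [y, x]] = y" if xy: "x \<in> V" "y \<in> V" for x y
  proof -
    let ?f = "\<lambda>y. g [x, y]"
    have "?f ` V \<subseteq> V" using gV xy by blast
    then show "ld [y, x] \<in> V" using funpow_image[of ?f V m] xy by (auto simp: ld_def)
    have "(?f ^^ Suc m) y = y" using funpow_fact_id[OF finV b1[OF xy(1)] xy(2)] m by simp
    then show "g [x, ld [y, x]] = y" by (auto simp: ld_def)
  qed
  let ?d = "\<lambda>xs. g [rd [xs ! 0, ld [xs ! 1, xs ! 1]], ld [xs ! 2, xs ! 1]]"
  show ?thesis
  proof (rule that[of ?d])
    show "pol ar F X 3 ?d"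
      by (intro pol_comp2[OF g] pol_comp2[OF rd] pol_comp2[OF ld] pol_proj) simp_all
    show "?d [x, y, w] \<in> V" if "x \<in> V" "y \<in> V" "w \<in> V" for x y w
      using that rdV ldV gV by simp
    show "?d [x, x, y] = y" if "x \<in> V" "y \<in> V" for x y
      using that rdV(3)[of x "ld [x, x]"] ldV by simp
    show "?d [x, y, y] = x" if "x \<in> V" "y \<in> V" for x y
      using that rdV(2) ldV by simp
  qed
qed

end

section \<open>Affine structure on a trace, from a Malcev polynomial and rigidity\<close>

locale vs_setup = prime_quot ar X F \<theta> \<beta>
  for ar :: "'i \<Rightarrow> nat" and X :: "'a set" and F :: "'i \<Rightarrow> 'a list \<Rightarrow> 'a" and \<theta> \<beta> :: "'a rel" +
  fixes U :: "'a set" and E :: "'a \<Rightarrow> 'a" and d :: "'a list \<Rightarrow> 'a" and u0 u1 :: 'a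
  assumes U: "U \<in> minsets" and E: "upol ar F X E" and EU: "E ` X = U" and E_id: "\<And>x. x \<in> U \<Longrightarrow> E x = x"
    and d: "pol ar F X 3 d" and dU: "\<And>x y w. x \<in> U \<Longrightarrow> y \<in> U \<Longrightarrow> w \<in> U \<Longrightarrow> d [x, y, w] \<in> U"
    and d1: "\<And>x y. x \<in> U \<Longrightarrow> y \<in> U \<Longrightarrow> d [x, x, y] = y"
    and d2: "\<And>x y. x \<in> U \<Longrightarrow> y \<in> U \<Longrightarrow> d [x, y, y] = x"
    and u: "u0 \<in> U" "u1 \<in> U" "(u0, u1) \<in> \<beta>" "(u0, u1) \<notin> \<theta>"
begin

lemma UX: "U \<subseteq> X" by (rule minsets_sub[OF U])
lemma E_in: "x \<in> X \<Longrightarrow> E x \<in> U" using EU by blast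

definition eqv :: "'a \<Rightarrow> 'a \<Rightarrow> bool" (infix "\<approx>" 50) where "x \<approx> y \<longleftrightarrow> (x, y) \<in> \<theta>"

lemma eqv_refl: "x \<in> U \<Longrightarrow> x \<approx> x" using congruence_refl[OF cong(1)] UX by (auto simp: eqv_def)
lemma eqv_sym: "x \<approx> y \<Longrightarrow> y \<approx> x" using congruence_sym[OF cong(1)] by (auto simp: eqv_def)
lemma eqv_trans [trans]: "x \<approx> y \<Longrightarrow> y \<approx> z \<Longrightarrow> x \<approx> z"
  using congruence_trans[OF cong(1)] by (auto simp: eqv_def)
lemma eqv_upol: "upol ar F X f \<Longrightarrow> x \<approx> y \<Longrightarrow> f x \<approx> f y"
  using upol_congruence[OF _ cong(1)] by (simp add: eqv_def)
lemma eqv_d: "x \<approx> x' \<Longrightarrow> y \<approx> y' \<Longrightarrow> z \<approx> z' \<Longrightarrow> d [x, y, z] \<approx> d [x', y', z']"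
  using pol_congruence[OF d cong(1), of "[x, y, z]" "[x', y', z']"] by (simp add: eqv_def)
lemma eqv_pol: "pol ar F X n f \<Longrightarrow> length xs = n \<Longrightarrow> list_all2 (\<approx>) xs ys \<Longrightarrow> f xs \<approx> f ys"
  unfolding eqv_def by (rule pol_congruence[OF _ cong(1)])

definition N :: "'a set" where "N = U \<inter> \<beta> `` {u0}"

lemma N_iff: "x \<in> N \<longleftrightarrow> x \<in> U \<and> (u0, x) \<in> \<beta>" by (auto simp: N_def)
lemma NU: "N \<subseteq> U" by (auto simp: N_def)
lemma u0N: "u0 \<in> N" using u congruence_refl[OF cong(2)] UX by (auto simp: N_iff)
lemma u1N: "u1 \<in> N" using u by (auto simp: N_iff)

text \<open>If h(x, a) and h(x', a) agree modulo \<theta> while x and x' do not, then h with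
  parameters a does not permute U. By rigidity neither does h with parameters b, so it collapses
  \<beta> on U into \<theta>.\<close>

lemma term_condition:
  assumes h: "pol ar F X (Suc n) h"
    and hU: "\<And>x w. x \<in> U \<Longrightarrow> length w = n \<Longrightarrow> set w \<subseteq> U \<Longrightarrow> h (x # w) \<in> U"
    and x: "x \<in> U" "x' \<in> U" "(x, x') \<in> \<beta>"
    and ab: "length a = n" "length b = n" "set a \<subseteq> U" "set b \<subseteq> U"
    and eq: "h (x # a) \<approx> h (x' # a)"
  shows "h (x # b) \<approx> h (x' # b)"
proof (cases "(x, x') \<in> \<theta>")
  case True
  have "list_all2 (\<approx>) b b" using eqv_refl ab(4) by (intro list.rel_refl_strong) blast
  then show ?thesis using eqv_pol[OF h, of "x # b" "x' # b"] True ab(2) by (simp add: eqv_def)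
next
  case False
  have abX: "set a \<subseteq> X" "set b \<subseteq> X" using ab UX by auto
  have uh: "upol ar F X (\<lambda>x. h (x # a))" "upol ar F X (\<lambda>x. h (x # b))"
    using pol_Cons_upol[OF h] ab abX by auto
  have "\<not> bij_betw (\<lambda>x. h (x # a)) U U"
    using bij_reflect[OF uh(1) minset_fin[OF U] _ x(1,2)] eq False by (auto simp: eqv_def)
  moreover have "(\<lambda>x. h (x # a)) ` U \<subseteq> U" using hU ab by auto
  ultimately have "\<not> bij_betw (\<lambda>x. h (x # b)) U U"
    using perm[OF h ab(2,1) abX(2,1) UX] by blast
  moreover have "(\<lambda>x. h (x # b)) ` U \<subseteq> U" using hU ab by auto
  ultimately show ?thesis using min_bij_or[OF U uh(2) _ _ x] by (simp add: eqv_def)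
qed

text \<open>A twin of the identity map x \<mapsto> d(x, w, w).\<close>

lemma d_bij:
  assumes "v \<in> U" "w \<in> U"
  shows "bij_betw (\<lambda>x. d (x # [v, w])) U U"
proof (rule perm[of 2 d "[w, w]" "[v, w]" U])
  show "pol ar F X (Suc 2) d" using d by (simp add: numeral_3_eq_3 numeral_2_eq_2)
  have "bij_betw (\<lambda>x. x) U U" by (simp add: bij_betw_def)
  then show "bij_betw (\<lambda>x. d (x # [w, w])) U U"
    by (rule bij_betw_cong[THEN iffD1, rotated]) (simp add: d2 assms)
qed (use assms UX dU in auto)

text \<open>d(x, y, u0) acts as x - y, so an agreement modulo \<theta> becomes the vanishing of one
  polynomial.\<close>

lemma diff_zero_iff: "x \<in> U \<Longrightarrow> y \<in> U \<Longrightarrow> d [x, y, u0] \<approx> u0 \<longleftrightarrow> x \<approx> y"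
proof
  assume xy: "x \<in> U" "y \<in> U"
  have ud: "upol ar F X (\<lambda>x. d (x # [y, u0]))"
    by (rule pol_Cons_upol[of _ _ _ 2]) (use d xy u(1) UX in \<open>auto simp: numeral_3_eq_3 numeral_2_eq_2\<close>)
  show "x \<approx> y" if "d [x, y, u0] \<approx> u0"
    using bij_reflect[OF ud minset_fin[OF U] d_bij[OF xy(2) u(1)] xy] that d1[OF xy(2) u(1)] by (simp add: eqv_def)
  show "d [x, y, u0] \<approx> u0" if "x \<approx> y"
    using eqv_d[OF that eqv_refl[OF xy(2)] eqv_refl[OF u(1)]] d1[OF xy(2) u(1)] by simp
qed

text \<open>Identities of affine modules modulo \<open>\<theta>\<close> reduce by this lemma to the case where variables are \<open>u0\<close>.\<close>

lemma four_points:
  assumes h1: "pol ar F X (Suc n) h1" "\<And>x w. x \<in> U \<Longrightarrow> length w = n \<Longrightarrow> set w \<subseteq> U \<Longrightarrow> h1 (x # w) \<in> U"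
    and h2: "pol ar F X (Suc n) h2" "\<And>x w. x \<in> U \<Longrightarrow> length w = n \<Longrightarrow> set w \<subseteq> U \<Longrightarrow> h2 (x # w) \<in> U"
    and x: "x \<in> N" and ab: "length a = n" "length b = n" "set a \<subseteq> U" "set b \<subseteq> U"
    and eq: "h1 (x # a) \<approx> h2 (x # a)" "h1 (u0 # a) \<approx> h2 (u0 # a)" "h1 (u0 # b) \<approx> h2 (u0 # b)"
  shows "h1 (x # b) \<approx> h2 (x # b)"
proof -
  have xU: "x \<in> U" "(x, u0) \<in> \<beta>" using x congruence_sym[OF cong(2)] by (auto simp: N_iff)
  \<comment> \<open>The term condition concerns a single operation, so the two sides are combined
    into their difference.\<close>
  let ?D = "\<lambda>xs. d [h1 xs, h2 xs, u0]"
  have D: "pol ar F X (Suc n) ?D"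
    using u(1) UX by (intro pol_comp3[OF d h1(1) h2(1)] pol_const) auto
  have iff: "?D (z # w) \<approx> u0 \<longleftrightarrow> h1 (z # w) \<approx> h2 (z # w)" if "z \<in> U" "length w = n" "set w \<subseteq> U" for z w
    using diff_zero_iff h1(2) h2(2) that by blast
  have "?D (x # b) \<approx> ?D (u0 # b)"
  proof (rule term_condition[OF D _ xU(1) u(1) xU(2) ab])
    show "?D (z # w) \<in> U" if "z \<in> U" "length w = n" "set w \<subseteq> U" for z w
      using dU h1(2) h2(2) u(1) that by blast
    show "?D (x # a) \<approx> ?D (u0 # a)"
      using iff[OF xU(1) ab(1,3)] iff[OF u(1) ab(1,3)] eq(1,2) eqv_trans eqv_sym by blast
  qed
  then show ?thesis
    using iff[OF xU(1) ab(2,4)] iff[OF u(1) ab(2,4)] eq(3) eqv_trans by blast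
qed

text \<open>The addition x - 0 + y that a Malcev operation induces, with \<open>u0\<close> as
  zero.\<close>

definition plus :: "'a \<Rightarrow> 'a \<Rightarrow> 'a" where "plus x y = d [x, u0, y]"

lemma dN: "x \<in> N \<Longrightarrow> y \<in> N \<Longrightarrow> z \<in> N \<Longrightarrow> d [x, y, z] \<in> N"
  using dU pol_congruence[OF d cong(2), of "[u0, u0, u0]" "[x, y, z]"] d1[OF u(1) u(1)]
  by (auto simp: N_iff)

lemma plusU: "x \<in> U \<Longrightarrow> y \<in> U \<Longrightarrow> plus x y \<in> U" using dU u(1) by (simp add: plus_def)
lemma plusN: "x \<in> N \<Longrightarrow> y \<in> N \<Longrightarrow> plus x y \<in> N" using dN u0N by (simp add: plus_def)
lemma plus_0: "x \<in> U \<Longrightarrow> plus x u0 = x" "x \<in> U \<Longrightarrow> plus u0 x = x"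
  using d1 d2 u(1) by (simp_all add: plus_def)
lemma plus_eqv: "x \<approx> x' \<Longrightarrow> y \<approx> y' \<Longrightarrow> plus x y \<approx> plus x' y'"
  unfolding plus_def by (rule eqv_d) (auto intro: eqv_refl u(1))

lemma pol_plus: "pol ar F X n a \<Longrightarrow> pol ar F X n b \<Longrightarrow> pol ar F X n (\<lambda>xs. plus (a xs) (b xs))"
  unfolding plus_def using u(1) UX by (intro pol_comp3[OF d] pol_const) auto

lemma pol_d: "pol ar F X n a \<Longrightarrow> pol ar F X n b \<Longrightarrow> pol ar F X n c \<Longrightarrow> pol ar F X n (\<lambda>xs. d [a xs, b xs, c xs])"
  by (rule pol_comp3[OF d])

lemma pol_u0: "pol ar F X n (\<lambda>xs. u0)" using u(1) UX by (intro pol_const) auto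

lemma len1: "length w = Suc 0 \<Longrightarrow> \<exists>y. w = [y]" by (simp add: length_Suc_conv)
lemma len2: "length w = Suc (Suc 0) \<Longrightarrow> \<exists>y z. w = [y, z]" by (auto simp: length_Suc_conv)

lemma plus_comm:
  assumes "x \<in> N" "y \<in> U"
  shows "plus x y \<approx> plus y x"
proof -
  let ?h1 = "\<lambda>xs. plus (xs ! 0) (xs ! 1)" and ?h2 = "\<lambda>xs. plus (xs ! 1) (xs ! 0)"
  have "?h1 (x # [y]) \<approx> ?h2 (x # [y])"
    by (rule four_points[where n = "Suc 0" and a = "[u0]"])
      (use assms u(1) NU in \<open>auto intro!: pol_plus pol_proj plusU eqv_refl simp: plus_0 plusU subset_iff dest!: len1\<close>)
  then show ?thesis by simp
qed

lemma plus_assoc: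
  assumes "x \<in> N" "y \<in> U" "w \<in> U"
  shows "plus (plus x y) w \<approx> plus x (plus y w)"
proof -
  let ?h1 = "\<lambda>xs. plus (plus (xs ! 0) (xs ! 1)) (xs ! 2)" and ?h2 = "\<lambda>xs. plus (xs ! 0) (plus (xs ! 1) (xs ! 2))"
  have "?h1 (x # [y, w]) \<approx> ?h2 (x # [y, w])"
    by (rule four_points[where n = "Suc (Suc 0)" and a = "[u0, w]"])
      (use assms u(1) NU in \<open>auto intro!: pol_plus pol_proj plusU eqv_refl simp: plus_0 plusU subset_iff dest!: len2\<close>)
  then show ?thesis by simp
qed

lemma diff_plus:
  assumes "x \<in> N" "y \<in> U"
  shows "plus (d [y, x, u0]) x \<approx> y"
proof -
  let ?h1 = "\<lambda>xs. plus (d [xs ! 1, xs ! 0, u0]) (xs ! 0)" and ?h2 = "\<lambda>xs. xs ! 1"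
  have "?h1 (x # [y]) \<approx> ?h2 (x # [y])"
    \<comment> \<open>Unlike for the other identities, y is compared with x instead of
      \<open>u0\<close>: there the difference is zero.\<close>
    by (rule four_points[where n = "Suc 0" and a = "[x]"])
      (use assms u(1) NU in \<open>auto intro!: pol_plus pol_d pol_proj pol_u0 plusU dU eqv_refl simp: plus_0 d1 d2 plusU dU subset_iff dest!: len1\<close>)
  then show ?thesis by simp
qed

lemma additive:
  assumes p: "upol ar F X p" "\<And>x. x \<in> X \<Longrightarrow> p x \<in> U" "p u0 \<approx> u0" and xy: "x \<in> N" "y \<in> U"
  shows "p (plus x y) \<approx> plus (p x) (p y)"
proof -
  let ?h1 = "\<lambda>xs. p (plus (xs ! 0) (xs ! 1))" and ?h2 = "\<lambda>xs. plus (p (xs ! 0)) (p (xs ! 1))"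
  have pU: "p z \<in> U" if "z \<in> U" for z using p(2) that UX by blast
  have px: "p x \<approx> plus (p x) (p u0)" if "x \<in> U" for x
    using plus_eqv[OF eqv_refl eqv_sym[OF p(3)], of "p x"] pU[OF that] plus_0 by simp
  have py: "p y \<approx> plus (p u0) (p y)" if "y \<in> U" for y
    using plus_eqv[OF eqv_sym[OF p(3)] eqv_refl, of "p y"] pU[OF that] plus_0 by simp
  have "?h1 (x # [y]) \<approx> ?h2 (x # [y])"
  proof (rule four_points[where n = "Suc 0" and a = "[u0]"])
    show "pol ar F X (Suc (Suc 0)) ?h1"
      by (rule upol_comp_pol[OF p(1)]) (intro pol_plus pol_proj; simp)
    show "pol ar F X (Suc (Suc 0)) ?h2"
      by (intro pol_plus upol_comp_pol[OF p(1)] pol_proj) simp_all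
  qed (use xy u(1) NU px py pU in \<open>auto intro!: plusU simp: plus_0 plusU subset_iff dest!: len1\<close>)
  then show ?thesis by simp
qed

section \<open>The trace modulo the lower congruence as a vector space\<close>

abbreviation "R \<equiv> \<theta> \<inter> N \<times> N"
abbreviation "Q \<equiv> N // R"
definition cls :: "'a \<Rightarrow> 'a set" where "cls x = R `` {x}"

lemma equivR: "equiv N R"
proof (rule equivI)
  show "refl_on N R" using eqv_refl NU by (auto simp: refl_on_def eqv_def)
  show "sym R" using eqv_sym by (auto simp: sym_def eqv_def)
  show "trans R" using eqv_trans unfolding trans_def eqv_def by blast
qed auto

lemma clsQ: "x \<in> N \<Longrightarrow> cls x \<in> Q" unfolding cls_def by (rule quotientI)

lemma cls_eq: "x \<in> N \<Longrightarrow> y \<in> N \<Longrightarrow> cls x = cls y \<longleftrightarrow> x \<approx> y"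
  using eq_equiv_class_iff[OF equivR, of x y] by (auto simp: cls_def eqv_def)

lemma rep_cls: "S \<in> Q \<Longrightarrow> rep S \<in> N" "S \<in> Q \<Longrightarrow> cls (rep S) = S"
  using rep_class[OF equivR] by (auto simp: cls_def)

lemma rep_eqv: "x \<in> N \<Longrightarrow> rep (cls x) \<approx> x"
  using rep_cls[OF clsQ] cls_eq by blast

lemma Q_cases: assumes "S \<in> Q" obtains x where "x \<in> N" "S = cls x"
  using rep_cls[OF assms] by metis

definition pl :: "'a set \<Rightarrow> 'a set \<Rightarrow> 'a set" where "pl S T = cls (plus (rep S) (rep T))"
definition ng :: "'a set \<Rightarrow> 'a set" where "ng S = cls (d [u0, rep S, u0])"

lemma pl_cls: "x \<in> N \<Longrightarrow> y \<in> N \<Longrightarrow> pl (cls x) (cls y) = cls (plus x y)"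
  unfolding pl_def using plus_eqv[OF rep_eqv rep_eqv] cls_eq plusN rep_cls(1)[OF clsQ] by simp

lemma ng_cls: "x \<in> N \<Longrightarrow> ng (cls x) = cls (d [u0, x, u0])"
  unfolding ng_def using eqv_d[OF _ rep_eqv, of u0 u0 x u0 u0] cls_eq dN u0N rep_cls(1)[OF clsQ] eqv_refl[OF u(1)] by simp

text \<open>The polynomials that represent scalars. Values in U on all of X, not merely on the
  trace, are what \<open>additive\<close> and the dichotomy on U work with.\<close>

definition lin :: "('a \<Rightarrow> 'a) \<Rightarrow> bool" where
  "lin p \<longleftrightarrow> upol ar F X p \<and> (\<forall>x\<in>X. p x \<in> U) \<and> (\<forall>x\<in>N. p x \<in> N) \<and> p u0 \<approx> u0"

text \<open>Membership prescribes k only on classes of elements of N. Elsewhere k is free, so that K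
  contains \<open>id\<close> and is closed under the literal pointwise operations in
  \<open>poly_equiv_vector_space\<close>.\<close>

definition K :: "('a set \<Rightarrow> 'a set) set" where
  "K = {k. \<exists>p. lin p \<and> (\<forall>x\<in>N. k (cls x) = cls (p x))}"

lemma KE: assumes "k \<in> K" obtains p where "lin p" "\<And>x. x \<in> N \<Longrightarrow> k (cls x) = cls (p x)"
  using assms unfolding K_def by blast

lemma KI: "lin p \<Longrightarrow> (\<And>x. x \<in> N \<Longrightarrow> k (cls x) = cls (p x)) \<Longrightarrow> k \<in> K"
  unfolding K_def by blast

lemma linD:
  assumes "lin p"
  shows "upol ar F X p" "\<And>x. x \<in> X \<Longrightarrow> p x \<in> U" "\<And>x. x \<in> N \<Longrightarrow> p x \<in> N" "p u0 \<approx> u0"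
  using assms by (auto simp: lin_def)

lemma lin_E: "lin E"
  unfolding lin_def using E E_in E_id NU u(1) eqv_refl[OF u(1)] by (auto simp: subset_iff)

lemma lin_0: "lin (\<lambda>_. u0)"
  unfolding lin_def using u(1) UX u0N eqv_refl by (auto intro: upol_const)

lemma upol_plus: "upol ar F X p \<Longrightarrow> upol ar F X q \<Longrightarrow> upol ar F X (\<lambda>x. plus (p x) (q x))"
  unfolding upol_def by (rule pol_plus)

lemma lin_plus:
  assumes "lin p" "lin q" shows "lin (\<lambda>x. plus (p x) (q x))"
proof -
  have "plus (p u0) (q u0) \<approx> u0"
    using plus_eqv[OF linD(4)[OF assms(1)] linD(4)[OF assms(2)]] plus_0 u(1) by simp
  then show ?thesis
    unfolding lin_def using linD[OF assms(1)] linD[OF assms(2)] plusN plusU upol_plus by simp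
qed

lemma lin_comp:
  assumes "lin p" "lin q" shows "lin (\<lambda>x. p (q x))"
proof -
  have "p (q u0) \<approx> u0"
    using eqv_trans[OF eqv_upol[OF linD(1)[OF assms(1)] linD(4)[OF assms(2)]] linD(4)[OF assms(1)]] .
  moreover have "p (q x) \<in> U" if "x \<in> X" for x
    using linD(2)[OF assms(1)] upol_in[OF linD(1)[OF assms(2)] that] by blast
  ultimately show ?thesis
    unfolding lin_def using linD(3)[OF assms(1)] linD(3)[OF assms(2)]
      upol_comp[OF linD(1)[OF assms(1)] linD(1)[OF assms(2)]] by simp
qed

lemma lin_neg:
  assumes "lin p" shows "lin (\<lambda>x. d [u0, p x, u0])"
proof -
  have "d [u0, p u0, u0] \<approx> u0"
    using eqv_d[OF eqv_refl linD(4)[OF assms] eqv_refl, of u0 u0] d1 u(1) by simp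
  moreover have "upol ar F X (\<lambda>x. d [u0, p x, u0])"
    unfolding upol_def by (intro pol_d pol_u0 linD(1)[OF assms, unfolded upol_def])
  ultimately show ?thesis
    unfolding lin_def using linD[OF assms] dN dU u0N u(1) by simp
qed

lemma K_app: assumes "k \<in> K" "S \<in> Q" shows "k S \<in> Q"
  using assms by (metis KE Q_cases clsQ linD(3))

lemma K_hom:
  assumes "k \<in> K" "S \<in> Q" "T \<in> Q" shows "k (pl S T) = pl (k S) (k T)"
proof -
  obtain p where p: "lin p" "\<And>x. x \<in> N \<Longrightarrow> k (cls x) = cls (p x)" using KE[OF assms(1)] by blast
  obtain x y where xy: "x \<in> N" "S = cls x" "y \<in> N" "T = cls y" using assms by (metis Q_cases)
  have "p (plus x y) \<approx> plus (p x) (p y)"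
    using additive[OF linD(1,2,4)[OF p(1)] xy(1)] xy(3) NU by blast
  then show ?thesis
    using xy p(2) linD(3)[OF p(1)] plusN by (simp add: pl_cls cls_eq)
qed

text \<open>A polynomial representing a nonzero scalar does not collapse \<beta> on U, so it
  permutes U, and an iterate of it represents the inverse scalar.\<close>

lemma K_inverse:
  assumes k: "k \<in> K" and S: "S \<in> Q" "k S \<noteq> cls u0"
  shows "\<exists>l\<in>K. \<forall>T\<in>Q. l (k T) = T"
proof -
  obtain p where p: "lin p" "\<And>x. x \<in> N \<Longrightarrow> k (cls x) = cls (p x)" using KE[OF k] by blast
  obtain x where x: "x \<in> N" "S = cls x" using Q_cases[OF S(1)] by blast
  have "\<not> p x \<approx> u0" using S(2) x p(2) linD(3)[OF p(1)] u0N by (simp add: cls_eq)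
  then have npx: "\<not> p u0 \<approx> p x" using linD(4)[OF p(1)] eqv_trans eqv_sym by blast
  have pUU: "p ` U \<subseteq> U" using linD(2)[OF p(1)] UX by blast
  have bij: "bij_betw p U U"
  proof (rule ccontr)
    assume "\<not> bij_betw p U U"
    from min_bij_or[OF U linD(1)[OF p(1)] pUU this u(1)] x(1) npx show False
      by (auto simp: N_iff eqv_def)
  qed
  obtain m where m: "fact (card U) = Suc m" by (metis fact_nonzero not0_implies_Suc)
  have inv: "(p ^^ m) (p y) = y" if "y \<in> U" for y
    using funpow_fact_id[OF minset_fin[OF U] bij that] unfolding m funpow_Suc_right by simp
  let ?l = "\<lambda>x. (p ^^ m) (E x)"
  have "p ` N \<subseteq> N" using linD(3)[OF p(1)] by blast
  then have mN: "(p ^^ m) ` N \<subseteq> N" and mU: "(p ^^ m) ` U \<subseteq> U"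
    using funpow_image pUU by blast+
  have um: "upol ar F X (p ^^ m)" by (rule upol_funpow[OF linD(1)[OF p(1)]])
  have "(p ^^ m) (p u0) \<approx> (p ^^ m) u0" by (rule eqv_upol[OF um linD(4)[OF p(1)]])
  then have "?l u0 \<approx> u0" using inv[OF u(1)] E_id u(1) eqv_sym by simp
  then have "lin ?l"
    unfolding lin_def using upol_comp[OF um E] mN mU E_in linD(3)[OF lin_E] by blast
  define l where "l S = cls (?l (rep S))" for S
  have l: "l (cls y) = cls (?l y)" if "y \<in> N" for y
    unfolding l_def using eqv_upol[OF linD(1)[OF \<open>lin ?l\<close>] rep_eqv[OF that]]
      linD(3)[OF \<open>lin ?l\<close>] rep_cls(1)[OF clsQ[OF that]] that by (simp add: cls_eq)
  have "l \<in> K" using \<open>lin ?l\<close> l by (rule KI)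
  moreover have "l (k T) = T" if T: "T \<in> Q" for T
  proof -
    obtain y where y: "y \<in> N" "T = cls y" using Q_cases[OF T] by blast
    have py: "p y \<in> N" using linD(3)[OF p(1) y(1)] .
    then have "E (p y) = p y" using E_id NU by blast
    then show ?thesis using y p(2) l[OF py] inv NU by auto
  qed
  ultimately show ?thesis by blast
qed

lemma Q_assoc: assumes "S \<in> Q" "T \<in> Q" "W \<in> Q" shows "pl (pl S T) W = pl S (pl T W)"
proof -
  obtain x y w where xyw: "x \<in> N" "S = cls x" "y \<in> N" "T = cls y" "w \<in> N" "W = cls w"
    using assms by (metis Q_cases)
  then show ?thesis using plus_assoc[of x y w] NU plusN by (auto simp: pl_cls cls_eq)
qed

lemma Q_comm: assumes "S \<in> Q" "T \<in> Q" shows "pl S T = pl T S"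
proof -
  obtain x y where xyw: "x \<in> N" "S = cls x" "y \<in> N" "T = cls y" using assms by (metis Q_cases)
  then show ?thesis using plus_comm[of x y] NU plusN by (auto simp: pl_cls cls_eq)
qed

lemma Q_zero: assumes "S \<in> Q" shows "pl (cls u0) S = S"
proof -
  obtain x where x: "x \<in> N" "S = cls x" using Q_cases[OF assms] by blast
  then show ?thesis using plus_0(2)[of x] NU u0N by (auto simp: pl_cls)
qed

lemma Q_neg: assumes "S \<in> Q" shows "pl (ng S) S = cls u0"
proof -
  obtain x where x: "x \<in> N" "S = cls x" using Q_cases[OF assms] by blast
  have "pl (ng S) S = cls (plus (d [u0, x, u0]) x)"
    unfolding x(2) ng_cls[OF x(1)] by (rule pl_cls[OF dN[OF u0N x(1) u0N] x(1)])
  also have "\<dots> = cls u0"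
    using diff_plus[OF x(1) u(1)] cls_eq[OF plusN[OF dN[OF u0N x(1) u0N] x(1)] u0N] by simp
  finally show ?thesis .
qed

lemma Q_closed: "S \<in> Q \<Longrightarrow> T \<in> Q \<Longrightarrow> pl S T \<in> Q" "S \<in> Q \<Longrightarrow> ng S \<in> Q"
  using rep_cls(1) plusN dN u0N clsQ by (auto simp: pl_def ng_def)

lemma K_id: "id \<in> K"
  by (rule KI[OF lin_E]) (use E_id NU in auto)

lemma K_zero: "(\<lambda>x. cls u0) \<in> K"
  by (rule KI[OF lin_0]) simp

lemma K_add: assumes "k \<in> K" "l \<in> K" shows "(\<lambda>x. pl (k x) (l x)) \<in> K"
proof -
  obtain p where p: "lin p" "\<And>x. x \<in> N \<Longrightarrow> k (cls x) = cls (p x)" using KE[OF assms(1)] by blast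
  obtain q where q: "lin q" "\<And>x. x \<in> N \<Longrightarrow> l (cls x) = cls (q x)" using KE[OF assms(2)] by blast
  show ?thesis
    by (rule KI[OF lin_plus[OF p(1) q(1)]]) (use p q linD(3) in \<open>simp add: pl_cls\<close>)
qed

lemma K_comp: assumes "k \<in> K" "l \<in> K" shows "k \<circ> l \<in> K"
proof -
  obtain p where p: "lin p" "\<And>x. x \<in> N \<Longrightarrow> k (cls x) = cls (p x)" using KE[OF assms(1)] by blast
  obtain q where q: "lin q" "\<And>x. x \<in> N \<Longrightarrow> l (cls x) = cls (q x)" using KE[OF assms(2)] by blast
  show ?thesis
    by (rule KI[OF lin_comp[OF p(1) q(1)]]) (use p q linD(3) in simp)
qed

lemma K_neg: assumes "k \<in> K" shows "(\<lambda>x. ng (k x)) \<in> K"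
proof -
  obtain p where p: "lin p" "\<And>x. x \<in> N \<Longrightarrow> k (cls x) = cls (p x)" using KE[OF assms(1)] by blast
  show ?thesis
    by (rule KI[OF lin_neg[OF p(1)]]) (use p linD(3) in \<open>simp add: ng_cls\<close>)
qed

lemma K_commute:
  assumes "k \<in> K" "l \<in> K" "S \<in> Q" shows "k (l S) = l (k S)"
proof (rule finite_skew_field_commutes[where Q = Q and z = "cls u0" and pl = pl and ng = ng and K = K])
  have "finite N" using NU minset_fin[OF U] finite_subset by blast
  then show "finite Q" by (rule finite_quotient) auto
qed (use assms clsQ u0N Q_closed Q_assoc Q_comm Q_zero Q_neg K_app K_hom K_id K_zero K_add K_comp K_neg K_inverse in auto)

text \<open>Writing 0 for \<open>u0\<close>, the first variable splits off as p(x, xs) = (p(x, 0) -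
  p(0, 0)) + p(0, xs) modulo \<theta>. The two sides agree when xs = 0 and when x = 0, and
  \<open>four_points\<close> extends this to all arguments; the bracket is linear in x.\<close>

lemma affine_expansion:
  assumes "pol ar F X n p" "\<And>xs. length xs = n \<Longrightarrow> set xs \<subseteq> N \<Longrightarrow> p xs \<in> N"
  shows "\<exists>ps c. length ps = n \<and> (\<forall>q\<in>set ps. lin q) \<and> c \<in> N \<and>
    (\<forall>xs. length xs = n \<longrightarrow> set xs \<subseteq> N \<longrightarrow> p xs \<approx> foldr (\<lambda>(q, x) acc. plus (q x) acc) (zip ps xs) c)"
  using assms
proof (induction n arbitrary: p)
  case 0
  have "p [] \<in> N" using 0 by simp
  then show ?case using eqv_refl NU by (intro exI[of _ "[]"] exI[of _ "p []"]) auto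
next
  case (Suc n)
  define os where "os = replicate n u0"
  have os: "length os = n" "set os \<subseteq> N" using u0N by (auto simp: os_def)
  have osU: "set os \<subseteq> U" "set os \<subseteq> X" using os NU UX by auto
  let ?pz = "\<lambda>xs. p (u0 # xs)"
  have "pol ar F X n (\<lambda>xs. p (u0 # map (\<lambda>j. xs ! j) [0..<n]))"
    by (rule pol_Cons[OF Suc.prems(1)]) (simp_all add: pol_u0 pol_proj)
  then have p0: "pol ar F X n ?pz" by (rule pol_cong) (simp add: list_map_nth)
  have p0N: "?pz xs \<in> N" if "length xs = n" "set xs \<subseteq> N" for xs
    using Suc.prems(2) that u0N by simp
  obtain ps c where ps: "length ps = n" "\<forall>q\<in>set ps. lin q" "c \<in> N"
    "\<And>xs. length xs = n \<Longrightarrow> set xs \<subseteq> N \<Longrightarrow> ?pz xs \<approx> foldr (\<lambda>(q, x) acc. plus (q x) acc) (zip ps xs) c"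
    using Suc.IH[OF p0 p0N] by blast
  \<comment> \<open>Off the trace p may leave U; the retraction E brings it back and changes nothing
    on the trace.\<close>
  let ?p = "\<lambda>xs. E (p xs)"
  have p: "pol ar F X (Suc n) ?p" by (rule upol_comp_pol[OF E Suc.prems(1)])
  have pU: "?p xs \<in> U" if "length xs = Suc n" "set xs \<subseteq> X" for xs
    using pol_closed[OF Suc.prems(1) sub subset_refl that] E_in by blast
  have peq: "?p xs = p xs" if "length xs = Suc n" "set xs \<subseteq> N" for xs
    using E_id Suc.prems(2)[OF that] NU by blast
  define c0 where "c0 = p (u0 # os)"
  have c0: "c0 \<in> N" "c0 \<in> U" "c0 = ?p (u0 # os)"
    using Suc.prems(2)[of "u0 # os"] peq[of "u0 # os"] os u0N NU by (auto simp: c0_def)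
  let ?q = "\<lambda>x. d [?p (x # os), c0, u0]"
  have u0X: "u0 \<in> X" "c0 \<in> X" using u(1) c0 UX by auto
  have uq: "upol ar F X ?q"
    unfolding upol_def
    by (intro pol_d pol_u0 pol_const u0X pol_Cons_upol[OF p os(1) osU(2), unfolded upol_def])
  have "lin ?q"
    unfolding lin_def
  proof (intro conjI ballI uq)
    show "?q x \<in> U" if "x \<in> X" for x using dU pU c0(2) u(1) os(1) osU(2) that by simp
    show "?q x \<in> N" if "x \<in> N" for x
      using dN c0(1) u0N Suc.prems(2)[of "x # os"] peq[of "x # os"] os that by simp
    show "?q u0 \<approx> u0" using c0 d1 u(1) eqv_refl by simp
  qed
  have step: "p (x # xs) \<approx> plus (?q x) (?pz xs)" if x: "x \<in> N" and xs: "length xs = n" "set xs \<subseteq> N" for x xs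
  proof -
    let ?h2 = "\<lambda>ys. plus (?q (ys ! 0)) (?p (u0 # tl ys))"
    have xsU: "set xs \<subseteq> U" using xs NU by auto
    have "?p (x # xs) \<approx> ?h2 (x # xs)"
    proof (rule four_points[OF p _ _ _ x os(1) xs(1) osU(1) xsU])
      show "?p (z # w) \<in> U" if "z \<in> U" "length w = n" "set w \<subseteq> U" for z w
        using pU[of "z # w"] that UX by auto
      have "pol ar F X (Suc n) (\<lambda>ys. ?q (ys ! 0))" by (rule upol_comp_pol[OF uq pol_proj]) simp
      moreover have "pol ar F X (Suc n) (\<lambda>ys. ?p (u0 # tl ys))"
        by (rule upol_comp_pol[OF E pol_tl[OF p0]])
      ultimately show "pol ar F X (Suc n) ?h2" by (rule pol_plus)
      show "?h2 (z # w) \<in> U" if "z \<in> U" "length w = n" "set w \<subseteq> U" for z w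
      proof -
        have "z \<in> X" "set w \<subseteq> X" using that UX by auto
        then show ?thesis using plusU[OF linD(2)[OF \<open>lin ?q\<close>] pU[of "u0 # w"]] that(2) u0X by simp
      qed
      have pq0: "?p (y # os) \<approx> ?h2 (y # os)" if "y \<in> N" for y
        using eqv_sym[OF diff_plus[OF c0(1), of "?p (y # os)"]] pU[of "y # os"] os(1) osU(2) that NU UX
        by (auto simp flip: c0(3))
      then show "?p (x # os) \<approx> ?h2 (x # os)" "?p (u0 # os) \<approx> ?h2 (u0 # os)" using x u0N by auto
      have "?p (u0 # xs) \<in> U" using pU[of "u0 # xs"] xs xsU UX u(1) by auto
      moreover have "?q u0 = u0" using c0 d1 u(1) by simp
      ultimately show "?p (u0 # xs) \<approx> ?h2 (u0 # xs)" using plus_0(2) eqv_refl by simp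
    qed
    moreover have "?p (x # xs) = p (x # xs)" "?p (u0 # xs) = p (u0 # xs)"
      using peq xs x u0N by auto
    ultimately show ?thesis by simp
  qed
  have "p xs \<approx> foldr (\<lambda>(q, x) acc. plus (q x) acc) (zip (?q # ps) xs) c"
    if xs: "length xs = Suc n" "set xs \<subseteq> N" for xs
  proof -
    obtain y ys where y: "xs = y # ys" using xs by (cases xs) auto
    have yN: "y \<in> N" "length ys = n" "set ys \<subseteq> N" using xs y by auto
    have "plus (?q y) (?pz ys) \<approx> plus (?q y) (foldr (\<lambda>(q, x) acc. plus (q x) acc) (zip ps ys) c)"
      using plus_eqv[OF eqv_refl ps(4)[OF yN(2,3)], of "?q y"] linD(2)[OF \<open>lin ?q\<close>] yN NU UX by auto
    then show ?thesis using eqv_trans[OF step[OF yN]] y by simp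
  qed
  then show ?case
    using ps \<open>lin ?q\<close> by (intro exI[of _ "?q # ps"] exI[of _ c]) simp
qed

lemma K_rep:
  assumes "lin q" shows "(\<lambda>S. cls (q (rep S))) \<in> K"
proof (rule KI[OF assms])
  fix x assume x: "x \<in> N"
  show "cls (q (rep (cls x))) = cls (q x)"
    using eqv_upol[OF linD(1)[OF assms] rep_eqv[OF x]] linD(3)[OF assms] rep_cls(1)[OF clsQ[OF x]] x
    by (simp add: cls_eq)
qed

lemma fold_N:
  "length ps = length xs \<Longrightarrow> \<forall>q\<in>set ps. lin q \<Longrightarrow> c \<in> N \<Longrightarrow> set xs \<subseteq> N \<Longrightarrow>
    foldr (\<lambda>(q, x) acc. plus (q x) acc) (zip ps xs) c \<in> N"
  by (induction ps xs rule: list_induct2) (simp_all add: plusN linD(3))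

lemma affine_cls:
  "length ps = length Xs \<Longrightarrow> \<forall>q\<in>set ps. lin q \<Longrightarrow> c \<in> N \<Longrightarrow> set Xs \<subseteq> Q \<Longrightarrow>
    affine_op pl (map (\<lambda>q S. cls (q (rep S))) ps) (cls c) Xs =
    cls (foldr (\<lambda>(q, x) acc. plus (q x) acc) (zip ps (map rep Xs)) c)"
proof (induction ps Xs rule: list_induct2)
  case Nil
  then show ?case by (simp add: affine_op_def)
next
  case (Cons q ps S Xs)
  have "foldr (\<lambda>(q, x) acc. plus (q x) acc) (zip ps (map rep Xs)) c \<in> N"
    using Cons.prems Cons.hyps rep_cls(1) by (intro fold_N) auto
  moreover have "q (rep S) \<in> N" using Cons.prems rep_cls(1) linD(3) by simp
  ultimately show ?case using Cons.IH Cons.prems by (simp add: affine_op_def pl_cls)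
qed

lemma clone_affine:
  assumes "(n, f) \<in> induced_clone ar X F \<theta> N"
  shows "\<exists>ks c. length ks = n \<and> set ks \<subseteq> K \<and> c \<in> Q \<and>
     (\<forall>xs. length xs = n \<longrightarrow> set xs \<subseteq> Q \<longrightarrow> f xs = affine_op pl ks c xs)"
proof -
  obtain p where p: "(n, p) \<in> polys ar X F" "\<And>xs. length xs = n \<Longrightarrow> set xs \<subseteq> N \<Longrightarrow> p xs \<in> N"
    "f = (\<lambda>Xs. R `` {p (map rep Xs)})"
    using assms unfolding induced_clone_def by auto
  have "pol ar F X n p" using p(1) by (auto simp: pol_def)
  from affine_expansion[OF this p(2)] obtain ps c where ps: "length ps = n" "\<forall>q\<in>set ps. lin q" "c \<in> N"
    "\<And>xs. length xs = n \<Longrightarrow> set xs \<subseteq> N \<Longrightarrow> p xs \<approx> foldr (\<lambda>(q, x) acc. plus (q x) acc) (zip ps xs) c"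
    by blast
  have "f Xs = affine_op pl (map (\<lambda>q S. cls (q (rep S))) ps) (cls c) Xs" if Xs: "length Xs = n" "set Xs \<subseteq> Q" for Xs
  proof -
    have r: "length (map rep Xs) = n" "set (map rep Xs) \<subseteq> N" using Xs rep_cls(1) by auto
    have "cls (p (map rep Xs)) = cls (foldr (\<lambda>(q, x) acc. plus (q x) acc) (zip ps (map rep Xs)) c)"
      using cls_eq[OF p(2)[OF r] fold_N[of ps "map rep Xs" c]] ps(1-3) ps(4)[OF r] r Xs by simp
    then show ?thesis using affine_cls[of ps Xs c] ps Xs p(3) by (simp add: cls_def)
  qed
  then show ?thesis
    using ps K_rep clsQ by (intro exI[of _ "map (\<lambda>q S. cls (q (rep S))) ps"] exI[of _ "cls c"]) auto
qed

lemma affine_pol: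
  "set ks \<subseteq> K \<Longrightarrow> c \<in> Q \<Longrightarrow> \<exists>p. pol ar F X (length ks) p \<and>
    (\<forall>xs. length xs = length ks \<longrightarrow> set xs \<subseteq> N \<longrightarrow> p xs \<in> N) \<and>
    (\<forall>Xs. length Xs = length ks \<longrightarrow> set Xs \<subseteq> Q \<longrightarrow> affine_op pl ks c Xs = cls (p (map rep Xs)))"
proof (induction ks)
  case Nil
  then show ?case
    using rep_cls[of c] NU UX by (intro exI[of _ "\<lambda>_. rep c"]) (auto simp: affine_op_def intro!: pol_const)
next
  case (Cons k ks)
  then obtain p where p: "pol ar F X (length ks) p"
    "\<And>xs. length xs = length ks \<Longrightarrow> set xs \<subseteq> N \<Longrightarrow> p xs \<in> N"
    "\<And>Xs. length Xs = length ks \<Longrightarrow> set Xs \<subseteq> Q \<Longrightarrow> affine_op pl ks c Xs = cls (p (map rep Xs))" by auto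
  have "k \<in> K" using Cons by simp
  then obtain q where q: "lin q" "\<And>x. x \<in> N \<Longrightarrow> k (cls x) = cls (q x)" using KE by blast
  let ?p = "\<lambda>xs. plus (q (xs ! 0)) (p (tl xs))"
  have "pol ar F X (length (k # ks)) ?p"
    using pol_plus[OF upol_comp_pol[OF linD(1)[OF q(1)] pol_proj[of 0 "Suc (length ks)"]] pol_tl[OF p(1)]] by simp
  moreover have "?p xs \<in> N" if "length xs = length (k # ks)" "set xs \<subseteq> N" for xs
    using that p(2)[of "tl xs"] linD(3)[OF q(1)] by (cases xs) (auto intro: plusN)
  moreover have "affine_op pl (k # ks) c Xs = cls (?p (map rep Xs))"
    if Xs: "length Xs = length (k # ks)" "set Xs \<subseteq> Q" for Xs
  proof -
    obtain Y Ys where Y: "Xs = Y # Ys" using Xs by (cases Xs) auto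
    have Ys: "length Ys = length ks" "set Ys \<subseteq> Q" "Y \<in> Q" using Xs Y by auto
    have r: "rep Y \<in> N" "cls (rep Y) = Y" "set (map rep Ys) \<subseteq> N" using rep_cls Ys by auto
    have "affine_op pl (k # ks) c Xs = pl (k Y) (affine_op pl ks c Ys)" by (simp add: Y affine_op_def)
    also have "\<dots> = pl (cls (q (rep Y))) (cls (p (map rep Ys)))" using q(2)[OF r(1)] r(2) p(3) Ys by simp
    also have "\<dots> = cls (?p (map rep Xs))"
      using pl_cls[OF linD(3)[OF q(1) r(1)] p(2)[of "map rep Ys"]] r Ys Y by simp
    finally show ?thesis .
  qed
  ultimately show ?case by blast
qed

lemma affine_clone:
  assumes "length ks = n" "set ks \<subseteq> K" "c \<in> Q"
  shows "\<exists>f. (n, f) \<in> induced_clone ar X F \<theta> N \<and>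
     (\<forall>xs. length xs = n \<longrightarrow> set xs \<subseteq> Q \<longrightarrow> f xs = affine_op pl ks c xs)"
proof -
  obtain p where p: "pol ar F X n p"
    "\<And>xs. length xs = n \<Longrightarrow> set xs \<subseteq> N \<Longrightarrow> p xs \<in> N"
    "\<And>Xs. length Xs = n \<Longrightarrow> set Xs \<subseteq> Q \<Longrightarrow> affine_op pl ks c Xs = cls (p (map rep Xs))"
    using affine_pol[OF assms(2,3)] assms(1) by blast
  obtain p' where p': "(n, p') \<in> polys ar X F" "\<And>xs. length xs = n \<Longrightarrow> p xs = p' xs"
    using p(1) by (auto simp: pol_def)
  let ?f = "\<lambda>Xs. R `` {p' (map rep Xs)}"
  have "(n, ?f) \<in> induced_clone ar X F \<theta> N"
    unfolding induced_clone_def using p'(1) p(2) p'(2) by auto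
  moreover have "?f Xs = affine_op pl ks c Xs" if "length Xs = n" "set Xs \<subseteq> Q" for Xs
    using p(3)[OF that] p'(2)[of "map rep Xs"] that by (simp add: cls_def)
  ultimately show ?thesis by blast
qed

lemma vector_space: "poly_equiv_vector_space Q (induced_clone ar X F \<theta> N)"
  unfolding poly_equiv_vector_space_def
  apply (rule exI[of _ pl], rule exI[of _ "cls u0"], rule exI[of _ ng], rule exI[of _ K])
  apply (intro conjI ballI impI allI)
  subgoal by (rule clsQ[OF u0N])
  subgoal by (rule Q_closed(1))
  subgoal by (rule Q_closed(2))
  subgoal by (rule Q_assoc)
  subgoal by (rule Q_comm)
  subgoal by (rule Q_zero)
  subgoal by (rule Q_neg)
  subgoal by (rule K_app)
  subgoal by (rule K_hom)
  subgoal by (rule K_id)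
  subgoal by (rule K_zero)
  subgoal by (rule K_add)
  subgoal by (rule K_comp)
  subgoal by (rule K_commute)
  subgoal by (rule K_neg)
  subgoal for k by (elim bexE) (rule K_inverse)
  subgoal for nf using clone_affine by (cases nf) auto
  subgoal by (rule affine_clone)
  done

lemma type2: "type2 ar X F \<theta> \<beta>"
  unfolding type2_def
proof (intro conjI bexI exI)
  show "prime_quotient ar X F \<theta> \<beta>" by (rule pq)
  show "U \<in> minsets" by (rule U)
  show "is_trace \<theta> \<beta> U N"
    unfolding is_trace_def using u(1,4) u0N u1N by (auto simp: N_def)
  show "poly_equiv_vector_space Q (induced_clone ar X F \<theta> N)" by (rule vector_space)
qed

end

context prime_quot
begin

lemma quasi_type2:
  assumes U: "U \<in> minsets" and g: "quasi U g"
  shows "type2 ar X F \<theta> \<beta>"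
proof -
  obtain E where E: "upol ar F X E" "E ` X = U" "\<And>x. x \<in> U \<Longrightarrow> E x = x" using min_idem[OF U] by blast
  obtain d where d: "pol ar F X 3 d" "\<And>x y w. x \<in> U \<Longrightarrow> y \<in> U \<Longrightarrow> w \<in> U \<Longrightarrow> d [x, y, w] \<in> U"
    "\<And>x y. x \<in> U \<Longrightarrow> y \<in> U \<Longrightarrow> d [x, x, y] = y" "\<And>x y. x \<in> U \<Longrightarrow> y \<in> U \<Longrightarrow> d [x, y, y] = x"
    using quasi_malcev[OF g minsets_sub[OF U]] by blast
  obtain u0 u1 where u: "u0 \<in> U" "u1 \<in> U" "(u0, u1) \<in> \<beta>" "(u0, u1) \<notin> \<theta>" using min_pair[OF U] .
  interpret vs_setup ar X F \<theta> \<beta> U E d u0 u1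
    by unfold_locales (use U E d u in auto)
  show ?thesis by (rule type2)
qed

end

section \<open>Powers of an algebra\<close>

lemma polys_term_ops: "(n, t) \<in> polys ar {} F \<Longrightarrow> (n, t) \<in> term_ops ar F"
  by (induction n t rule: polys.induct) (auto intro: term_ops.intros)

lemma rigid_pol:
  assumes "rigid ar X F" "pol ar F {} (Suc k) t" "length as = k" "length bs = k" "set as \<subseteq> X" "set bs \<subseteq> X"
    and "x \<in> X" "t (x # as) = x" "t (t (x # bs) # as) = t (x # bs)" "t (t (x # bs) # bs) = t (x # bs)"
  shows "t (x # bs) = x"
proof -
  obtain p where p: "(Suc k, p) \<in> polys ar {} F" "\<And>xs. length xs = Suc k \<Longrightarrow> t xs = p xs"
    using assms(2) by (auto simp: pol_def)
  show ?thesis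
    using assms(1)[unfolded rigid_def, rule_format, OF p(1) assms(3-7)] assms(3,4,8-10) p(2) by simp
qed

text \<open>Let y = t(x, bs). Then t(x, bs) = t(y, bs), whereas t(x, as) = x and t(y, as) = y. So
  the term condition puts (x, y) into [1, \<alpha>] whenever it lies in \<alpha>. The pair therefore
  lies in every member of the left series, which reaches the identity relation.\<close>

lemma left_nilpotent_rigid:
  assumes alg: "algebra ar A F" and nil: "left_nilpotent ar A F"
  shows "rigid ar A F"
  unfolding rigid_def
proof (intro allI impI)
  fix k t as bs x
  assume t: "(Suc k, t) \<in> polys ar {} F" and len: "length as = k" "length bs = k"
    and sets: "set as \<subseteq> A" "set bs \<subseteq> A" and x: "x \<in> A" and a: "t (x # as) = x"
    and ba: "t (t (x # bs) # as) = t (x # bs)" and bb: "t (t (x # bs) # bs) = t (x # bs)"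
  have sub: "subuniv ar F A" using alg by (simp add: algebra_def subuniv_def)
  have pt: "pol ar F {} (Suc k) t" using t by (auto simp: pol_def)
  define y where "y = t (x # bs)"
  have yA: "y \<in> A" unfolding y_def using x sets len by (intro pol_closed[OF pt sub]) auto
  \<comment> \<open>\<open>centralizes\<close> has the arguments related by its second relation
    last, so x is moved behind the parameters.\<close>
  have "pol ar F {} (Suc k) (\<lambda>xs. t (xs ! k # map (\<lambda>j. xs ! j) [0..<k]))"
    by (rule pol_Cons[OF pt]) (simp_all add: pol_proj)
  then obtain s where s: "(Suc k, s) \<in> polys ar {} F"
    "\<And>xs. length xs = Suc k \<Longrightarrow> t (xs ! k # map (\<lambda>j. xs ! j) [0..<k]) = s xs"
    by (auto simp: pol_def)
  have st: "s (cs @ [z]) = t (z # cs)" if "length cs = k" for cs z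
  proof -
    have "map (\<lambda>j. (cs @ [z]) ! j) [0..<k] = cs" using that by (intro nth_equalityI) (auto simp: nth_append)
    then show ?thesis using s(2)[of "cs @ [z]"] that by (simp add: nth_append)
  qed
  have s': "(Suc k, s) \<in> term_ops ar F" by (rule polys_term_ops[OF s(1)])
  have la: "list_all2 (\<lambda>x y. (x, y) \<in> A \<times> A) bs as"
    using len sets by (auto simp: list_all2_conv_all_nth subset_iff)
  have "(x, y) \<in> left_comm_series ar A F i" for i
  proof (induction i)
    case 0
    then show ?case using x yA by simp
  next
    case (Suc i)
    have "(x, y) \<in> \<delta>" if \<delta>: "congruence ar A F \<delta>" "centralizes ar F (A \<times> A) (left_comm_series ar A F i) \<delta>" for \<delta>
    proof -
      have "(s (bs @ [x]), s (bs @ [y])) \<in> \<delta>"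
        using congruence_refl[OF \<delta>(1) yA] bb by (simp add: st len flip: y_def)
      then have "(s (as @ [x]), s (as @ [y])) \<in> \<delta>"
        using \<delta>(2)[unfolded centralizes_def, rule_format, OF s', of bs "[x]" as "[y]"] la Suc len by simp
      then show ?thesis using a ba by (simp add: st len flip: y_def)
    qed
    then show ?case by (simp add: commutator_def)
  qed
  then show "t (x # bs) = x" using nil by (auto simp: left_nilpotent_def y_def Id_on_iff)
qed

lemma power_term:
  assumes "pol ar (pow_ops F I) {} n t"
  shows "\<exists>s. pol ar F {} n s \<and> (\<forall>bs i. length bs = n \<longrightarrow> i \<in> I \<longrightarrow> t bs i = s (map (\<lambda>b. b i) bs))"
  using assms
proof (induction rule: pol_induct)
  case (proj j)
  show ?case by (rule exI[of _ "\<lambda>xs. xs ! j"]) (use proj in \<open>auto intro: pol_proj\<close>)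
next
  case (app op g)
  let ?P = "\<lambda>j s. pol ar F {} n s \<and> (\<forall>bs i. length bs = n \<longrightarrow> i \<in> I \<longrightarrow> g j bs i = s (map (\<lambda>b. b i) bs))"
  define s where "s j = (SOME s. ?P j s)" for j
  have s: "?P j (s j)" if "j < ar op" for j
    unfolding s_def by (rule someI_ex[OF app(2)[OF that]])
  have "pow_ops F I op (map (\<lambda>j. g j bs) [0..<ar op]) i = F op (map (\<lambda>j. s j (map (\<lambda>b. b i) bs)) [0..<ar op])"
    if "length bs = n" "i \<in> I" for bs i
    unfolding pow_ops_def using conjunct2[OF s] that
    by (auto simp: comp_def intro!: arg_cong[where f = "F op"])
  then show ?case
    by (intro exI[of _ "\<lambda>xs. F op (map (\<lambda>j. s j xs) [0..<ar op])"] conjI pol_app[OF conjunct1[OF s]]) auto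
next
  case (cong f g)
  then show ?case by metis
qed simp

lemma power_lift:
  assumes "pol ar F {} n s"
  shows "\<exists>t. pol ar (pow_ops F I) {} n t \<and> (\<forall>bs i. length bs = n \<longrightarrow> i \<in> I \<longrightarrow> t bs i = s (map (\<lambda>b. b i) bs))"
  using assms
proof (induction rule: pol_induct)
  case (proj j)
  show ?case by (rule exI[of _ "\<lambda>xs. xs ! j"]) (use proj in \<open>auto intro: pol_proj\<close>)
next
  case (app op g)
  let ?P = "\<lambda>j s. pol ar (pow_ops F I) {} n s \<and> (\<forall>bs i. length bs = n \<longrightarrow> i \<in> I \<longrightarrow> s bs i = g j (map (\<lambda>b. b i) bs))"
  define s where "s j = (SOME s. ?P j s)" for j
  have s: "?P j (s j)" if "j < ar op" for j
    unfolding s_def by (rule someI_ex[OF app(2)[OF that]])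
  have "pow_ops F I op (map (\<lambda>j. s j bs) [0..<ar op]) i = F op (map (\<lambda>j. g j (map (\<lambda>b. b i) bs)) [0..<ar op])"
    if "length bs = n" "i \<in> I" for bs i
    unfolding pow_ops_def using conjunct2[OF s] that
    by (auto simp: comp_def intro!: arg_cong[where f = "F op"])
  then show ?case
    by (intro exI[of _ "\<lambda>xs. pow_ops F I op (map (\<lambda>j. s j xs) [0..<ar op])"] conjI pol_app[OF conjunct1[OF s]]) auto
next
  case (cong f g)
  show ?case
  proof -
    obtain t where t: "pol ar (pow_ops F I) {} n t"
      "\<And>bs i. length bs = n \<Longrightarrow> i \<in> I \<Longrightarrow> t bs i = f (map (\<lambda>b. b i) bs)" using cong(1) by blast
    have "t bs i = g (map (\<lambda>b. b i) bs)" if "length bs = n" "i \<in> I" for bs i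
      using t(2)[OF that] cong(2)[of "map (\<lambda>b. b i) bs"] that(1) by simp
    then show ?thesis using t(1) by blast
  qed
qed simp

lemma pow_ext: "f \<in> pow_carrier I A \<Longrightarrow> g \<in> pow_carrier I A \<Longrightarrow> (\<And>i. i \<in> I \<Longrightarrow> f i = g i) \<Longrightarrow> f = g"
  unfolding pow_carrier_def by (rule PiE_ext)

lemma pow_coord: "f \<in> pow_carrier I A \<Longrightarrow> i \<in> I \<Longrightarrow> f i \<in> A"
  unfolding pow_carrier_def by (rule PiE_mem)

lemma pow_const: "x \<in> A \<Longrightarrow> (\<lambda>i\<in>I. x) \<in> pow_carrier I A"
  unfolding pow_carrier_def by auto

lemma pow_algebra:
  assumes "algebra ar A F"
  shows "algebra ar (pow_carrier I A) (pow_ops F I)"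
  unfolding algebra_def
proof (intro conjI allI impI)
  show "pow_carrier I A \<noteq> {}" using assms by (auto simp: pow_carrier_def algebra_def PiE_eq_empty_iff)
  fix op xs assume xs: "length xs = ar op" "set xs \<subseteq> pow_carrier I A"
  have "F op (map (\<lambda>f. f i) xs) \<in> A" if "i \<in> I" for i
  proof -
    have "set (map (\<lambda>f. f i) xs) \<subseteq> A" using xs(2) pow_coord[OF _ that] by auto
    then show ?thesis using assms xs(1) unfolding algebra_def by simp
  qed
  then show "pow_ops F I op xs \<in> pow_carrier I A" by (auto simp: pow_ops_def pow_carrier_def)
qed

lemma pow_rigid:
  assumes alg: "algebra ar A F" and r: "rigid ar A F"
  shows "rigid ar (pow_carrier I A) (pow_ops F I)"
  unfolding rigid_def
proof (intro allI impI)
  fix k t as bs x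
  let ?B = "pow_carrier I A"
  assume t: "(Suc k, t) \<in> polys ar {} (pow_ops F I)" and len: "length as = k" "length bs = k"
    and sets: "set as \<subseteq> ?B" "set bs \<subseteq> ?B" and x: "x \<in> ?B" and a: "t (x # as) = x"
    and ba: "t (t (x # bs) # as) = t (x # bs)" and bb: "t (t (x # bs) # bs) = t (x # bs)"
  have pt: "pol ar (pow_ops F I) {} (Suc k) t" using t by (auto simp: pol_def)
  obtain s where s: "pol ar F {} (Suc k) s"
    "\<And>bs i. length bs = Suc k \<Longrightarrow> i \<in> I \<Longrightarrow> t bs i = s (map (\<lambda>b. b i) bs)"
    using power_term[OF pt] by blast
  have "subuniv ar (pow_ops F I) ?B" using pow_algebra[OF alg, of I] by (simp add: algebra_def subuniv_def)
  then have "t (x # bs) \<in> ?B" using x sets len by (intro pol_closed[OF pt]) auto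
  then show "t (x # bs) = x"
  proof (rule pow_ext[OF _ x])
    fix i assume i: "i \<in> I"
    have st: "t (z # cs) i = s (z i # map (\<lambda>b. b i) cs)" if "length cs = k" for z cs
      using s(2)[of "z # cs"] that i by simp
    have "s (x i # map (\<lambda>b. b i) bs) = x i"
    proof (rule rigid_pol[OF r s(1), of "map (\<lambda>b. b i) as"])
      show "set (map (\<lambda>b. b i) as) \<subseteq> A" "set (map (\<lambda>b. b i) bs) \<subseteq> A" "x i \<in> A"
        using sets x pow_coord[OF _ i] by auto
      show "s (x i # map (\<lambda>b. b i) as) = x i" using a st[OF len(1), of x] by simp
      show "s (s (x i # map (\<lambda>b. b i) bs) # map (\<lambda>b. b i) as) = s (x i # map (\<lambda>b. b i) bs)"
        using ba st[OF len(1), of "t (x # bs)"] st[OF len(2), of x] by simp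
      show "s (s (x i # map (\<lambda>b. b i) bs) # map (\<lambda>b. b i) bs) = s (x i # map (\<lambda>b. b i) bs)"
        using bb st[OF len(2), of "t (x # bs)"] st[OF len(2), of x] by simp
    qed (use len in auto)
    then show "t (x # bs) i = x i" using st[OF len(2)] by simp
  qed
qed

context prime_quot
begin

text \<open>Writing \<open>x = (x - \<phi> x) + \<phi> x\<close> with the help of a Malcev polynomial, neither summand is a permutation
  in \<open>x\<close>; hence both, and then the identity, would collapse \<open>\<beta>\<close> on \<open>V\<close> into \<open>\<theta>\<close>.\<close>

lemma quasi_no_split:
  assumes V: "V \<in> minsets" and g: "quasi V g" and \<phi>: "upol ar F X \<phi>" "\<phi> ` V \<subseteq> V"
    and idem: "\<And>x. x \<in> V \<Longrightarrow> \<phi> (\<phi> x) = \<phi> x" and nbij: "\<not> bij_betw \<phi> V V"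
    and z: "z1 \<in> V" "z2 \<in> V" "\<phi> z1 \<noteq> \<phi> z2"
  shows False
proof -
  have VX: "V \<subseteq> X" by (rule minsets_sub[OF V])
  obtain d where d: "pol ar F X 3 d" "\<And>x y w. x \<in> V \<Longrightarrow> y \<in> V \<Longrightarrow> w \<in> V \<Longrightarrow> d [x, y, w] \<in> V"
    "\<And>x y. x \<in> V \<Longrightarrow> y \<in> V \<Longrightarrow> d [x, x, y] = y" "\<And>x y. x \<in> V \<Longrightarrow> y \<in> V \<Longrightarrow> d [x, y, y] = x"
    using quasi_malcev[OF g VX] by blast
  have \<phi>V: "\<phi> x \<in> V" if "x \<in> V" for x using \<phi>(2) that by blast
  let ?h = "\<lambda>xs. d [xs ! 0, \<phi> (xs ! 0), xs ! 1]"
  have h: "pol ar F X (Suc 1) ?h"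
    by (intro pol_comp3[OF d(1)] upol_comp_pol[OF \<phi>(1)] pol_proj) simp_all
  have hV: "(\<lambda>x. ?h (x # [w])) ` V \<subseteq> V" if "w \<in> V" for w using d(2) \<phi>V that by auto
  have hu: "upol ar F X (\<lambda>x. ?h (x # [w]))" if "w \<in> V" for w
    by (rule pol_Cons_upol[OF h]) (use that VX in auto)
  \<comment> \<open>On the image of \<phi> the map x - \<phi>(x) + \<phi>(z1) is constant with value
    \<phi>(z1), and this image has at least two points. Rigidity then excludes every other w as
    well.\<close>
  have n0: "\<not> bij_betw (\<lambda>x. ?h (x # [\<phi> z1])) V V"
  proof
    assume "bij_betw (\<lambda>x. ?h (x # [\<phi> z1])) V V"
    then have inj: "inj_on (\<lambda>x. ?h (x # [\<phi> z1])) V" by (simp add: bij_betw_def)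
    have "?h (\<phi> y # [\<phi> z1]) = \<phi> z1" if "y \<in> V" for y
      using idem d(3) \<phi>V that z(1) by simp
    then have "\<phi> z1 = \<phi> z2" using inj_onD[OF inj, of "\<phi> z1" "\<phi> z2"] z \<phi>V by metis
    then show False using z(3) by blast
  qed
  have n: "\<not> bij_betw (\<lambda>x. ?h (x # [w])) V V" if w: "w \<in> V" for w
    using perm[OF h, of "[w]" "[\<phi> z1]" V] n0 hV[OF \<phi>V[OF z(1)]] w \<phi>V[OF z(1)] VX by auto
  obtain x y where xy: "x \<in> V" "y \<in> V" "(x, y) \<in> \<beta>" "(x, y) \<notin> \<theta>" using min_pair[OF V] .
  have "(\<phi> x, \<phi> y) \<in> \<theta>" by (rule min_bij_or[OF V \<phi> nbij xy(1-3)])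
  \<comment> \<open>From x = d(x, \<phi> x, \<phi> x) to y = d(y, \<phi> y, \<phi> y) in two moves
    within \<theta>: first the last argument alone, then the other two together.\<close>
  then have "(d [x, \<phi> x, \<phi> x], d [x, \<phi> x, \<phi> y]) \<in> \<theta>"
    using congruence_refl[OF cong(1)] xy(1) \<phi>V[OF xy(1)] VX
    by (intro pol_congruence[OF d(1) cong(1)]) auto
  then have "(x, d [x, \<phi> x, \<phi> y]) \<in> \<theta>" using d(4) xy \<phi>V by simp
  moreover have "(d [x, \<phi> x, \<phi> y], d [y, \<phi> y, \<phi> y]) \<in> \<theta>"
    using min_bij_or[OF V hu[OF \<phi>V[OF xy(2)]] hV[OF \<phi>V[OF xy(2)]] n[OF \<phi>V[OF xy(2)]] xy(1-3)] by simp
  moreover have "d [y, \<phi> y, \<phi> y] = y" using d(4) xy \<phi>V by simp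
  ultimately show False using congruence_trans[OF cong(1)] xy(4) by metis
qed

lemma exists_minset_below:
  assumes "W \<in> U_sets ar X F \<theta> \<beta>"
  obtains W' where "W' \<in> minsets" "W' \<subseteq> W"
proof -
  let ?S = "{W' \<in> U_sets ar X F \<theta> \<beta>. W' \<subseteq> W}"
  have "finite W" using U_sets_sub[OF assms] fin finite_subset by blast
  then have "finite ?S" by (rule_tac finite_subset[of _ "Pow W"]) auto
  moreover have "?S \<noteq> {}" using assms by auto
  ultimately obtain W' where W': "W' \<in> ?S" "\<forall>V\<in>?S. V \<subseteq> W' \<longrightarrow> W' = V"
    using finite_has_minimal[of ?S] by auto
  then have "W' \<in> minsets" unfolding min_sets_def by auto
  then show ?thesis using that W' by blast
qed

end

section \<open>Extremal congruences and prime quotients of a finite algebra\<close>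

lemma Id_on_congruence:
  assumes "algebra ar X F" shows "congruence ar X F (Id_on X)"
proof (rule congruence_from_upol[OF assms])
  have sub: "subuniv ar F X" using assms by (simp add: algebra_def subuniv_def)
  show "equiv X (Id_on X)" by (rule equivI) (auto simp: refl_on_def sym_def trans_def)
  show "(f x, f y) \<in> Id_on X" if "upol ar F X f" "(x, y) \<in> Id_on X" for f x y
    using upol_closed[OF that(1) sub subset_refl] that(2) by auto
qed auto

lemma full_congruence:
  assumes "algebra ar X F" shows "congruence ar X F (X \<times> X)"
proof (rule congruence_from_upol[OF assms])
  have sub: "subuniv ar F X" using assms by (simp add: algebra_def subuniv_def)
  show "equiv X (X \<times> X)" by (rule equivI) (auto simp: refl_on_def sym_def trans_def)
  show "(f x, f y) \<in> X \<times> X" if "upol ar F X f" "(x, y) \<in> X \<times> X" for f x y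
    using upol_closed[OF that(1) sub subset_refl] that(2) by auto
qed auto

lemma congruence_sub: "congruence ar X F \<psi> \<Longrightarrow> \<psi> \<subseteq> X \<times> X"
  using congruence_in[of ar X F \<psi>] by auto

lemma finite_congruences:
  "finite X \<Longrightarrow> finite {\<psi>. congruence ar X F \<psi> \<and> P \<psi>}"
  by (rule finite_subset[of _ "Pow (X \<times> X)"]) (auto dest: congruence_in)

lemma minimal_congruence:
  assumes "finite X" "congruence ar X F \<psi>" "P \<psi>"
  obtains \<delta> where "congruence ar X F \<delta>" "P \<delta>"
    "\<And>\<psi>. congruence ar X F \<psi> \<Longrightarrow> P \<psi> \<Longrightarrow> \<psi> \<subseteq> \<delta> \<Longrightarrow> \<psi> = \<delta>"
proof -
  let ?S = "{\<psi>. congruence ar X F \<psi> \<and> P \<psi>}"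
  have "?S \<noteq> {}" using assms(2,3) by auto
  then obtain \<delta> where "\<delta> \<in> ?S" "\<forall>\<psi>\<in>?S. \<psi> \<subseteq> \<delta> \<longrightarrow> \<delta> = \<psi>"
    using finite_has_minimal[OF finite_congruences[OF assms(1)], of ar F P] by auto
  then show ?thesis by (intro that[of \<delta>]) auto
qed

lemma maximal_congruence:
  assumes "finite X" "congruence ar X F \<psi>" "P \<psi>"
  obtains \<delta> where "congruence ar X F \<delta>" "P \<delta>"
    "\<And>\<psi>. congruence ar X F \<psi> \<Longrightarrow> P \<psi> \<Longrightarrow> \<delta> \<subseteq> \<psi> \<Longrightarrow> \<psi> = \<delta>"
proof -
  let ?S = "{\<psi>. congruence ar X F \<psi> \<and> P \<psi>}"
  have "?S \<noteq> {}" using assms(2,3) by auto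
  then obtain \<delta> where "\<delta> \<in> ?S" "\<forall>\<psi>\<in>?S. \<delta> \<subseteq> \<psi> \<longrightarrow> \<delta> = \<psi>"
    using finite_has_maximal[OF finite_congruences[OF assms(1)], of ar F P] by auto
  then show ?thesis by (intro that[of \<delta>]) auto
qed

context rigid_alg
begin

text \<open>\<delta> is minimal among the congruences containing a pair separated by f, and \<gamma>
  is a lower cover of \<delta>. If \<gamma> contained (f(x), f(y)) for a separated pair, idempotence
  of f would make this a separated pair of \<gamma>, against the minimality of \<delta>.\<close>

lemma exists_prime_quotient:
  assumes f: "\<And>x. x \<in> X \<Longrightarrow> f (f x) = f x" and x0: "x0 \<in> X" "y0 \<in> X" "f x0 \<noteq> f y0" and fX: "upol ar F X f"
  obtains \<gamma> \<delta> where "prime_quotient ar X F \<gamma> \<delta>" "\<exists>x y. (x, y) \<in> \<delta> \<and> (f x, f y) \<notin> \<gamma>"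
proof -
  let ?P = "\<lambda>\<psi>. \<exists>x y. (x, y) \<in> \<psi> \<and> f x \<noteq> f y"
  have "?P (X \<times> X)" using x0 by blast
  from minimal_congruence[OF fin full_congruence[OF alg], of ?P, OF this]
  obtain \<delta> where \<delta>: "congruence ar X F \<delta>" "?P \<delta>"
    and min: "\<And>\<psi>. congruence ar X F \<psi> \<Longrightarrow> ?P \<psi> \<Longrightarrow> \<psi> \<subseteq> \<delta> \<Longrightarrow> \<psi> = \<delta>" by metis
  have "Id_on X \<subseteq> \<delta>" using congruence_refl[OF \<delta>(1)] by auto
  moreover have "Id_on X \<noteq> \<delta>" using \<delta>(2) by auto
  ultimately have "Id_on X \<subset> \<delta>" by blast
  from maximal_congruence[OF fin Id_on_congruence[OF alg], of "\<lambda>\<psi>. \<psi> \<subset> \<delta>", OF this]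
  obtain \<gamma> where \<gamma>: "congruence ar X F \<gamma>" "\<gamma> \<subset> \<delta>"
    and max: "\<And>\<psi>. congruence ar X F \<psi> \<Longrightarrow> \<psi> \<subset> \<delta> \<Longrightarrow> \<gamma> \<subseteq> \<psi> \<Longrightarrow> \<psi> = \<gamma>" by metis
  have "prime_quotient ar X F \<gamma> \<delta>"
    unfolding prime_quotient_def using \<gamma> \<delta>(1) max by blast
  moreover obtain x y where xy: "(x, y) \<in> \<delta>" "f x \<noteq> f y" using \<delta>(2) by blast
  have "(f x, f y) \<notin> \<gamma>"
  proof
    assume g: "(f x, f y) \<in> \<gamma>"
    have "f (f x) \<noteq> f (f y)" using xy f congruence_in[OF \<delta>(1) xy(1)] by simp
    then have "\<gamma> = \<delta>" using min[OF \<gamma>(1)] \<gamma>(2) g by blast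
    then show False using \<gamma>(2) by blast
  qed
  ultimately show ?thesis using that xy(1) by blast
qed

end

section \<open>Minimal sets of a power and their projections\<close>

locale power_alg = A: rigid_alg ar A F
  for ar :: "'i \<Rightarrow> nat" and A :: "'a set" and F :: "'i \<Rightarrow> 'a list \<Rightarrow> 'a" +
  fixes I :: "'j set"
  assumes finI: "finite I" and I_ne: "I \<noteq> {}"
begin

abbreviation "B \<equiv> pow_carrier I A"
abbreviation "G \<equiv> pow_ops F I"

lemma finB: "finite B"
  unfolding pow_carrier_def using finI A.fin by (intro finite_PiE) auto

sublocale B: rigid_alg ar B G
  by unfold_locales (rule pow_algebra[OF A.alg] finB pow_rigid[OF A.alg A.rigid])+

end

locale power_minset = power_alg ar A F I + B: prime_quot ar "pow_carrier I A" "pow_ops F I" \<theta> \<beta>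
  for ar :: "'i \<Rightarrow> nat" and A :: "'a set" and F :: "'i \<Rightarrow> 'a list \<Rightarrow> 'a" and I :: "'j set"
    and \<theta> \<beta> :: "('j \<Rightarrow> 'a) rel" +
  fixes V :: "('j \<Rightarrow> 'a) set" and e :: "('j \<Rightarrow> 'a) \<Rightarrow> 'j \<Rightarrow> 'a" and g :: "('j \<Rightarrow> 'a) list \<Rightarrow> 'j \<Rightarrow> 'a"
    and t :: "'a list \<Rightarrow> 'a" and L :: "('j \<Rightarrow> 'a) list"
  assumes V: "V \<in> B.minsets" and e: "upol ar G B e" and eV: "e ` B = V" and e_id: "\<And>x. x \<in> V \<Longrightarrow> e x = x"
    and g: "B.quasi V g" and t: "pol ar F {} (Suc (length L)) t" and L: "set L \<subseteq> B"
    and et: "\<And>b i. i \<in> I \<Longrightarrow> e b i = t (b i # map (\<lambda>f. f i) L)"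
begin

text \<open>The i-th coordinate of e. All these maps are twins: the same term t, with the i-th
  coordinates of L as parameters.\<close>

definition ei :: "'j \<Rightarrow> 'a \<Rightarrow> 'a" where "ei i x = t (x # map (\<lambda>f. f i) L)"
definition Vi :: "'j \<Rightarrow> 'a set" where "Vi i = ei i ` A"

lemma VB: "V \<subseteq> B" by (rule B.minsets_sub[OF V])
lemma e_coord: "i \<in> I \<Longrightarrow> e b i = ei i (b i)" by (simp add: et ei_def)
lemma Li: "i \<in> I \<Longrightarrow> set (map (\<lambda>f. f i) L) \<subseteq> A" using L pow_coord[of _ I A i] by auto

lemma ei_upol: "i \<in> I \<Longrightarrow> upol ar F A (ei i)"
  unfolding ei_def by (rule pol_Cons_upol[OF pol_mono[OF t]]) (use Li in auto)

lemma ei_A: "i \<in> I \<Longrightarrow> x \<in> A \<Longrightarrow> ei i x \<in> A" using A.upol_in[OF ei_upol] .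
lemma Vi_A: "i \<in> I \<Longrightarrow> Vi i \<subseteq> A" unfolding Vi_def using ei_A by blast
lemma Vi_fin: "i \<in> I \<Longrightarrow> finite (Vi i)" using Vi_A A.fin finite_subset by blast

definition lift :: "'a \<Rightarrow> 'j \<Rightarrow> 'a" where "lift x = e (\<lambda>i\<in>I. x)"

lemma lift_V: "x \<in> A \<Longrightarrow> lift x \<in> V" unfolding lift_def using imageI[OF pow_const[of x A I], of e] eV by simp
lemma lift_coord: "i \<in> I \<Longrightarrow> lift x i = ei i x" unfolding lift_def using e_coord by simp

lemma ei_idem:
  assumes "i \<in> I" "x \<in> A" shows "ei i (ei i x) = ei i x"
  using e_coord[OF assms(1), of "lift x"] e_id[OF lift_V[OF assms(2)]] lift_coord[OF assms(1)] by simp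

lemma ei_id: "i \<in> I \<Longrightarrow> x \<in> Vi i \<Longrightarrow> ei i x = x" using ei_idem by (auto simp: Vi_def)

lemma V_coord: "v \<in> V \<Longrightarrow> i \<in> I \<Longrightarrow> v i \<in> Vi i"
  using e_id[of v] e_coord[of i v] VB pow_coord[of v I A i] by (auto simp: Vi_def intro: image_eqI)

lemma V_surj: "i \<in> I \<Longrightarrow> x \<in> Vi i \<Longrightarrow> \<exists>v\<in>V. v i = x"
  using lift_V lift_coord[of i x] ei_id Vi_A by (metis subsetD)

text \<open>On \<open>Vi i\<close> the map \<open>ei i\<close> after \<open>ei i\<close> is the
  identity. Changing the parameters of the inner map gives its twin, \<open>ei i\<close> after
  \<open>ei j\<close>, which is therefore a permutation.\<close>

lemma ei_inj:
  assumes ij: "i \<in> I" "j \<in> I" shows "inj_on (ei j) (Vi i)"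
proof -
  have "pol ar F A (Suc (length L)) t" using pol_mono[OF t] by simp
  then have p: "pol ar F A (Suc (length L)) (\<lambda>xs. ei i (t xs))" by (rule upol_comp_pol[OF ei_upol[OF ij(1)]])
  have "bij_betw (\<lambda>x. ei i (t (x # map (\<lambda>f. f j) L))) (Vi i) (Vi i)"
  proof (rule A.perm[OF p _ _ Li[OF ij(1)] Li[OF ij(2)] Vi_A[OF ij(1)]])
    have "bij_betw (\<lambda>x. x) (Vi i) (Vi i)" by (simp add: bij_betw_def)
    then show "bij_betw (\<lambda>x. ei i (t (x # map (\<lambda>f. f i) L))) (Vi i) (Vi i)"
      by (rule bij_betw_cong[THEN iffD1, rotated]) (simp add: ei_id[OF ij(1)] flip: ei_def)
    show "(\<lambda>x. ei i (t (x # map (\<lambda>f. f j) L))) ` Vi i \<subseteq> Vi i"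
      unfolding ei_def[symmetric] using ei_A[OF ij(2)] Vi_A[OF ij(1)] by (auto simp: Vi_def)
  qed simp_all
  then have "inj_on (\<lambda>x. ei i (ei j x)) (Vi i)" by (simp add: ei_def bij_betw_def)
  then show ?thesis by (auto simp: inj_on_def)
qed

lemma ei_image:
  assumes ij: "i \<in> I" "j \<in> I" shows "ei j ` Vi i = Vi j"
proof (rule card_subset_eq[OF Vi_fin[OF ij(2)]])
  have sub: "ei j ` Vi i \<subseteq> Vi j" if "i \<in> I" "j \<in> I" for i j using Vi_A[OF that(1)] by (auto simp: Vi_def)
  then show "ei j ` Vi i \<subseteq> Vi j" using ij by blast
  have le: "card (Vi i) \<le> card (Vi j)" if "i \<in> I" "j \<in> I" for i j
    using card_inj_on_le[OF ei_inj[OF that] sub[OF that] Vi_fin[OF that(2)]] .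
  have "card (Vi i) = card (Vi j)" using le ij by (simp add: le_antisym)
  then show "card (ei j ` Vi i) = card (Vi j)" using card_image[OF ei_inj[OF ij]] by simp
qed

lemma Vi_nontrivial:
  assumes i: "i \<in> I" obtains x y where "x \<in> Vi i" "y \<in> Vi i" "x \<noteq> y"
proof -
  obtain v w where vw: "v \<in> V" "w \<in> V" "(v, w) \<notin> \<theta>" using B.min_pair[OF V] by metis
  have "v \<noteq> w" using vw congruence_refl[OF B.cong(1)] VB by blast
  then obtain j where j: "j \<in> I" "v j \<noteq> w j" using pow_ext[of v I A w] vw VB by blast
  have "v j \<in> Vi j" "w j \<in> Vi j" using V_coord vw j by auto
  then have "ei i (v j) \<in> Vi i" "ei i (w j) \<in> Vi i" "ei i (v j) \<noteq> ei i (w j)"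
    using ei_image[OF j(1) i] inj_onD[OF ei_inj[OF j(1) i]] j(2) by auto
  then show ?thesis using that by blast
qed

text \<open>Lifted to the power with constant functions as parameters, f followed by e acts as f in
  coordinate i. A suitable iterate is idempotent on V but neither a permutation nor constant, and
  \<open>quasi_no_split\<close> forbids this.\<close>

lemma no_smaller:
  assumes i: "i \<in> I" and f: "upol ar F A f" "f ` A \<subset> Vi i" "\<And>x. x \<in> A \<Longrightarrow> f (f x) = f x"
    and w: "w1 \<in> f ` A" "w2 \<in> f ` A" "w1 \<noteq> w2"
  shows False
proof -
  obtain LA s where s: "pol ar F {} (Suc (length LA)) s" "set LA = A" "\<And>x. f x = s (x # LA)"
    by (rule upol_enum_param[OF f(1) A.fin]) (rule that; assumption)
  obtain sB where sB: "pol ar G {} (Suc (length LA)) sB"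
    "\<And>bs i. length bs = Suc (length LA) \<Longrightarrow> i \<in> I \<Longrightarrow> sB bs i = s (map (\<lambda>b. b i) bs)"
    using power_lift[OF s(1)] by blast
  let ?diag = "map (\<lambda>c. \<lambda>i\<in>I. c) LA"
  define f0 where "f0 b = e (sB (b # ?diag))" for b
  have dB: "set ?diag \<subseteq> B" using s(2) pow_const by auto
  have us: "upol ar G B (\<lambda>b. sB (b # ?diag))"
    by (rule pol_Cons_upol[OF pol_mono[OF sB(1)]]) (use dB in auto)
  have u0: "upol ar G B f0" unfolding f0_def by (rule upol_comp[OF e us])
  have \<phi>0V: "f0 b \<in> V" if "b \<in> B" for b using imageI[OF B.upol_in[OF us that], of e] eV by (simp add: f0_def)
  have fA: "f x \<in> A" if "x \<in> A" for x using A.upol_in[OF f(1) that] .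
  have \<phi>0i: "f0 b i = f (b i)" if b: "b \<in> B" for b
  proof -
    have "sB (b # ?diag) i = f (b i)" using sB(2)[of "b # ?diag" i] i s(3) by (simp add: comp_def)
    moreover have "f (b i) \<in> Vi i" using f(2) pow_coord[OF b i] by blast
    ultimately show ?thesis unfolding f0_def using e_coord[OF i] ei_id[OF i] by simp
  qed
  define \<phi> where "\<phi> = f0 ^^ fact (card V)"
  have \<phi>: "upol ar G B \<phi>" unfolding \<phi>_def by (rule upol_funpow[OF u0])
  have sub: "f0 ` V \<subseteq> V" using \<phi>0V VB by blast
  have \<phi>V: "\<phi> ` V \<subseteq> V" unfolding \<phi>_def by (rule funpow_image[OF sub])
  have \<phi>\<phi>: "\<phi> (\<phi> x) = \<phi> x" if "x \<in> V" for x
    unfolding \<phi>_def by (rule funpow_fact_idem[OF B.minset_fin[OF V] sub that])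
  \<comment> \<open>f is idempotent, so iterating further leaves the i-th coordinate as it is after
    one application.\<close>
  have it: "(f0 ^^ Suc m) b \<in> B \<and> (f0 ^^ Suc m) b i = f (b i)" if b: "b \<in> B" for b m
  proof (induction m)
    case 0
    then show ?case using \<phi>0i[OF b] \<phi>0V[OF b] VB by auto
  next
    case (Suc m)
    let ?c = "(f0 ^^ Suc m) b"
    have "f0 ?c i = f (?c i)" "f0 ?c \<in> B" using \<phi>0i \<phi>0V VB Suc by blast+
    then show ?case using Suc f(3)[OF pow_coord[OF b i]] by simp
  qed
  have \<phi>i: "\<phi> b i = f (b i)" if "b \<in> B" for b
  proof -
    obtain m where m: "fact (card V) = Suc m" by (metis fact_nonzero not0_implies_Suc)
    show ?thesis unfolding \<phi>_def m using it[OF that] by blast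
  qed
  have "\<not> bij_betw \<phi> V V"
  proof
    assume "bij_betw \<phi> V V"
    then have img: "\<phi> ` V = V" by (simp add: bij_betw_def)
    obtain y where y: "y \<in> Vi i" "y \<notin> f ` A" using f(2) by blast
    then obtain v where v: "v \<in> V" "v i = y" using V_surj[OF i] by blast
    then obtain v' where v': "v' \<in> V" "v = \<phi> v'" using img by blast
    then have "y = f (v' i)" using \<phi>i VB v(2) by auto
    moreover have "v' i \<in> A" using v'(1) VB pow_coord[OF _ i] by blast
    ultimately show False using y(2) by blast
  qed
  moreover obtain z1 z2 where z: "z1 \<in> V" "z1 i = w1" "z2 \<in> V" "z2 i = w2"
    using V_surj[OF i] w f(2) by (metis psubsetD)
  have "f w1 = w1" "f w2 = w2" using w f(3) by auto
  then have "\<phi> z1 i \<noteq> \<phi> z2 i" using \<phi>i[of z1] \<phi>i[of z2] subsetD[OF VB z(1)] subsetD[OF VB z(3)] z(2,4) w(3) by simp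
  then have "\<phi> z1 \<noteq> \<phi> z2" by metis
  ultimately show False using B.quasi_no_split[OF V g \<phi> \<phi>V \<phi>\<phi> _ z(1,3)] by blast
qed

text \<open>The operation is the i-th coordinate of g. Its translations inherit surjectivity because
  V projects onto \<open>Vi i\<close>, and finiteness turns this into bijectivity.\<close>

lemma quasi_Vi:
  assumes i: "i \<in> I" shows "\<exists>h. A.quasi (Vi i) h"
proof -
  obtain Lg where Lg: "set Lg = B" using finite_list[OF finB] by blast
  have ex: "\<exists>h. pol ar G {} (length Lg) h \<and> h Lg = c" if "c \<in> B" for c
    using that Lg by (metis in_set_conv_nth pol_proj)
  have gp: "pol ar G B 2 g" using g by (simp add: B.quasi_def)
  obtain s where s: "pol ar G {} (length Lg + 2) s" "\<And>xs. length xs = 2 \<Longrightarrow> g xs = s (Lg @ xs)"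
    using pol_param[OF gp refl ex] by blast
  obtain sA where sA: "pol ar F {} (length Lg + 2) sA"
    "\<And>bs i. length bs = length Lg + 2 \<Longrightarrow> i \<in> I \<Longrightarrow> s bs i = sA (map (\<lambda>b. b i) bs)"
    using power_term[OF s(1)] by blast
  let ?h = "\<lambda>xs. sA (map (\<lambda>b. b i) Lg @ xs)"
  have h: "pol ar F A 2 ?h"
    by (rule pol_fix[OF pol_mono[OF sA(1)]]) (use Lg pow_coord[OF _ i] in auto)
  have gh: "g [x, y] i = ?h [x i, y i]" for x y
    using s(2)[of "[x, y]"] sA(2)[of "Lg @ [x, y]" i] i by simp
  have hV: "?h [a, b] \<in> Vi i" if ab: "a \<in> Vi i" "b \<in> Vi i" for a b
  proof -
    obtain x y where xy: "x \<in> V" "x i = a" "y \<in> V" "y i = b" using V_surj[OF i] ab by metis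
    have "g [x, y] \<in> V" using g xy by (simp add: B.quasi_def)
    then have "g [x, y] i \<in> Vi i" using i by (rule V_coord)
    then show ?thesis unfolding gh xy .
  qed
  have surj_bij: "bij_betw k (Vi i) (Vi i)"
    if k: "\<And>c. c \<in> Vi i \<Longrightarrow> k c \<in> Vi i" "\<And>c. c \<in> Vi i \<Longrightarrow> \<exists>b\<in>Vi i. k b = c" for k
  proof -
    have "k ` Vi i = Vi i" using k by blast
    then show ?thesis using Vi_fin[OF i] by (simp add: bij_betw_def eq_card_imp_inj_on)
  qed
  have b1: "bij_betw (\<lambda>y. ?h [a, y]) (Vi i) (Vi i)" if a: "a \<in> Vi i" for a
  proof (rule surj_bij[OF hV[OF a]])
    fix c assume c: "c \<in> Vi i"
    obtain x z where xz: "x \<in> V" "x i = a" "z \<in> V" "z i = c" using V_surj[OF i] a c by metis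
    have "bij_betw (\<lambda>y. g [x, y]) V V" using g xz by (simp add: B.quasi_def)
    then have "z \<in> (\<lambda>y. g [x, y]) ` V" using xz(3) by (simp add: bij_betw_def)
    then obtain y where y: "y \<in> V" "z = g [x, y]" by blast
    then show "\<exists>b\<in>Vi i. ?h [a, b] = c" using gh[of x y] xz V_coord[OF y(1) i] by auto
  qed
  have b2: "bij_betw (\<lambda>x. ?h [x, a]) (Vi i) (Vi i)" if a: "a \<in> Vi i" for a
  proof (rule surj_bij[OF hV[OF _ a]])
    fix c assume c: "c \<in> Vi i"
    obtain x z where xz: "x \<in> V" "x i = a" "z \<in> V" "z i = c" using V_surj[OF i] a c by metis
    have "bij_betw (\<lambda>y. g [y, x]) V V" using g xz by (simp add: B.quasi_def)
    then have "z \<in> (\<lambda>y. g [y, x]) ` V" using xz(3) by (simp add: bij_betw_def)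
    then obtain y where y: "y \<in> V" "z = g [y, x]" by blast
    then show "\<exists>b\<in>Vi i. ?h [b, a] = c" using gh[of y x] xz V_coord[OF y(1) i] by auto
  qed auto
  have "A.quasi (Vi i) ?h" unfolding A.quasi_def using h hV b1 b2 by blast
  then show ?thesis by (intro exI[of _ ?h])
qed

text \<open>Any prime quotient of A that \<open>ei i\<close> does not collapse will do. If a member
  of its family were properly contained in \<open>Vi i\<close>, it would contain the image of an
  idempotent polynomial with two distinct values, which \<open>no_smaller\<close> excludes.\<close>

lemma Vi_type2:
  assumes i: "i \<in> I" shows "Vi i \<in> type2_min_sets ar A F"
proof -
  obtain x y where xy: "x \<in> Vi i" "y \<in> Vi i" "x \<noteq> y" using Vi_nontrivial[OF i] .
  have "x \<in> A" "y \<in> A" "ei i x \<noteq> ei i y" using xy Vi_A[OF i] ei_id[OF i] by auto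
  from A.exists_prime_quotient[OF ei_idem[OF i] this ei_upol[OF i]]
  obtain \<gamma> \<delta> where pq: "prime_quotient ar A F \<gamma> \<delta>" "\<exists>x y. (x, y) \<in> \<delta> \<and> (ei i x, ei i y) \<notin> \<gamma>" by blast
  interpret P: prime_quot ar A F \<gamma> \<delta> by unfold_locales (rule pq(1))
  have U: "Vi i \<in> U_sets ar A F \<gamma> \<delta>" unfolding Vi_def using P.U_setsI[OF ei_upol[OF i]] pq(2) by blast
  have "W = Vi i" if W: "W \<in> U_sets ar A F \<gamma> \<delta>" "W \<subseteq> Vi i" for W
  proof (rule ccontr)
    assume neq: "W \<noteq> Vi i"
    obtain W' where W': "W' \<in> P.minsets" "W' \<subseteq> W" using P.exists_minset_below[OF W(1)] .
    obtain f where f: "upol ar F A f" "f ` A = W'" "\<And>x. x \<in> W' \<Longrightarrow> f x = x" using P.min_idem[OF W'(1)] by blast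
    obtain w1 w2 where w: "w1 \<in> W'" "w2 \<in> W'" "(w1, w2) \<notin> \<gamma>" using P.min_pair[OF W'(1)] by metis
    then have "w1 \<noteq> w2" using congruence_refl[OF P.cong(1)] P.minsets_sub[OF W'(1)] by blast
    show False
      by (rule no_smaller[OF i f(1), of w1 w2]) (use f W' W neq w \<open>w1 \<noteq> w2\<close> in auto)
  qed
  then have "Vi i \<in> P.minsets" using U unfolding min_sets_def by blast
  moreover have "type2 ar A F \<gamma> \<delta>" using quasi_Vi[OF i] P.quasi_type2[OF \<open>Vi i \<in> P.minsets\<close>] by blast
  ultimately show ?thesis unfolding type2_min_sets_def using pq(1) by blast
qed

text \<open>Every \<open>ei j\<close> maps the one set \<open>Vi i\<close> onto \<open>Vi j\<close>,
  so v has a preimage under e with all coordinates in this single type 2 minimal set.\<close>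

lemma V_generated:
  assumes "v \<in> V"
  shows "\<exists>U\<in>type2_min_sets ar A F. \<exists>w\<in>PiE I (\<lambda>_. U). v = e w"
proof -
  obtain i where i: "i \<in> I" using I_ne by blast
  have "\<exists>x\<in>Vi i. ei j x = v j" if "j \<in> I" for j
    using V_coord[OF assms that] ei_image[OF i that] by (metis imageE)
  then obtain w where w: "\<And>j. j \<in> I \<Longrightarrow> w j \<in> Vi i" "\<And>j. j \<in> I \<Longrightarrow> ei j (w j) = v j" by metis
  let ?w = "\<lambda>j\<in>I. w j"
  have wP: "?w \<in> PiE I (\<lambda>_. Vi i)" using w(1) by auto
  then have wB: "?w \<in> B" using Vi_A[OF i] unfolding pow_carrier_def by auto
  have "v = e ?w"
  proof (rule pow_ext)
    show "v \<in> B" "e ?w \<in> B" using assms VB B.upol_in[OF e wB] by auto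
    show "v j = e ?w j" if "j \<in> I" for j using e_coord[OF that] w(2)[OF that] that by simp
  qed
  then show ?thesis using Vi_type2[OF i] wP by blast
qed

end

section \<open>The two cases combined, and the spread\<close>

context power_alg
begin

lemma sa_quotient_or_generated:
  assumes D: "subuniv ar G D" "D \<subseteq> B" "D \<noteq> {}"
    and gen: "\<And>U. U \<in> type2_min_sets ar A F \<Longrightarrow> PiE I (\<lambda>_. U) \<subseteq> D"
    and no_sa: "\<not> has_nontrivial_sa_quotient ar B G"
  shows "D = B"
proof (rule ccontr)
  assume "D \<noteq> B"
  let ?S = "{S. subuniv ar G S \<and> D \<subseteq> S \<and> S \<subseteq> B \<and> S \<noteq> B}"
  have "finite ?S" using finB by (rule_tac finite_subset[of _ "Pow B"]) auto
  moreover have "?S \<noteq> {}" using D(1,2) \<open>D \<noteq> B\<close> by blast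
  ultimately have "\<exists>M\<in>?S. \<forall>S\<in>?S. M \<subseteq> S \<longrightarrow> M = S" by (rule finite_has_maximal)
  then obtain M where M: "M \<in> ?S" and "\<forall>S\<in>?S. M \<subseteq> S \<longrightarrow> M = S"
    by (rule bexE)
  then have Mmax: "\<And>S. S \<in> ?S \<Longrightarrow> M \<subseteq> S \<Longrightarrow> M = S" by blast
  let ?sat = "\<lambda>\<psi>. \<forall>x y. (x, y) \<in> \<psi> \<longrightarrow> x \<in> M \<longrightarrow> y \<in> M"
  have "?sat (Id_on B)" by auto
  from maximal_congruence[OF finB Id_on_congruence[OF B.alg], of ?sat, OF this]
  obtain \<theta> where \<theta>: "congruence ar B G \<theta>" "?sat \<theta>"
    and \<theta>max: "\<And>\<psi>. congruence ar B G \<psi> \<Longrightarrow> ?sat \<psi> \<Longrightarrow> \<theta> \<subseteq> \<psi> \<Longrightarrow> \<psi> = \<theta>" by metis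
  obtain m where m: "m \<in> M" "m \<in> B" using M D(3) by blast
  obtain c where c: "c \<in> B" "c \<notin> M" using M by blast
  have "\<theta> \<subseteq> B \<times> B" by (rule congruence_sub[OF \<theta>(1)])
  moreover have "(m, c) \<notin> \<theta>" using \<theta>(2) m(1) c(2) by blast
  ultimately have "\<theta> \<subset> B \<times> B" using m(2) c(1) by blast
  from minimal_congruence[OF finB full_congruence[OF B.alg], of "\<lambda>\<psi>. \<theta> \<subset> \<psi>", OF this]
  obtain \<beta> where cb: "congruence ar B G \<beta>" and \<beta>: "\<theta> \<subset> \<beta>"
    and \<beta>min: "\<And>\<psi>. congruence ar B G \<psi> \<Longrightarrow> \<theta> \<subset> \<psi> \<Longrightarrow> \<psi> \<subseteq> \<beta> \<Longrightarrow> \<psi> = \<beta>" by metis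
  have pq: "prime_quotient ar B G \<theta> \<beta>"
    unfolding prime_quotient_def using \<theta>(1) cb \<beta> \<beta>min by blast
  \<comment> \<open>\<beta> exceeds the maximal \<theta>, so M is not a union of \<beta>-classes.
    Its \<beta>-hull is a larger subalgebra, hence everything; this is the assumption
    \<open>M_hit\<close>.\<close>
  have "\<not> ?sat \<beta>" using \<theta>max[OF cb] \<beta> by blast
  then obtain x y where xy: "(x, y) \<in> \<beta>" "x \<in> M" "y \<notin> M" by blast
  let ?H = "{x \<in> B. \<exists>m\<in>M. (x, m) \<in> \<beta>}"
  have "M \<subseteq> ?H" using congruence_refl[OF cb] M by blast
  moreover have "y \<in> ?H" using congruence_sym[OF cb xy(1)] congruence_in[OF cb xy(1)] xy(2) by blast
  moreover have "subuniv ar G ?H" using subuniv_hull[OF cb] M by blast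
  ultimately have H: "?H = B" using Mmax[of ?H] M xy(3) by blast
  interpret max_sub ar B G \<theta> \<beta> M
  proof unfold_locales
    show "prime_quotient ar B G \<theta> \<beta>" by (rule pq)
    show "subuniv ar G M" "M \<subseteq> B" "M \<noteq> {}" "M \<noteq> B" using M m by auto
    show "S = M \<or> S = B" if "subuniv ar G S" "M \<subseteq> S" "S \<subseteq> B" for S
      using Mmax[of S] M that by blast
    show "y \<in> M" if "(x, y) \<in> \<theta>" "x \<in> M" for x y using \<theta>(2) that by blast
    show "\<exists>m\<in>M. (x, m) \<in> \<beta>" if "x \<in> B" for x using that H by blast
  qed
  obtain V e where Ve: "V \<in> minsets" "upol ar G M e" "e ` B = V" "\<And>x. x \<in> V \<Longrightarrow> e x = x"
    using exists_M_idem by blast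
  show False
  proof (cases "\<exists>g. B.quasi V g")
    case False
    interpret no_quasi ar B G \<theta> \<beta> M V e
      by unfold_locales (use Ve False \<theta>max in auto)
    show False using sa_quotient no_sa by blast
  next
    case True
    then obtain g where g: "B.quasi V g" by blast
    have eB: "upol ar G B e" by (rule M_upol_X[OF Ve(2)])
    obtain L tB where tB: "pol ar G {} (Suc (length L)) tB" "set L = B" "\<And>x. e x = tB (x # L)"
      by (rule upol_enum_param[OF eB finB]) (rule that; assumption)
    obtain t where t: "pol ar F {} (Suc (length L)) t"
      "\<And>bs i. length bs = Suc (length L) \<Longrightarrow> i \<in> I \<Longrightarrow> tB bs i = t (map (\<lambda>b. b i) bs)"
      using power_term[OF tB(1)] by blast
    interpret power_minset ar A F I \<theta> \<beta> V e g t L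
      by unfold_locales (use Ve eB g t tB in auto)
    \<comment> \<open>The functions w belong to D and hence to M, and e has its constants in
      M.\<close>
    have "V \<subseteq> M"
    proof
      fix v assume "v \<in> V"
      then obtain U w where Uw: "U \<in> type2_min_sets ar A F" "w \<in> PiE I (\<lambda>_. U)" "v = e w"
        using V_generated by blast
      then have "w \<in> M" using gen M by blast
      then show "v \<in> M" using upol_closed[OF Ve(2) M_sub subset_refl] Uw(3) by simp
    qed
    then show False using minset_not_sub[OF Ve(1)] by blast
  qed
qed

end

lemma type2_min_sets_sub:
  assumes "rigid_alg ar A F" "U \<in> type2_min_sets ar A F" shows "U \<subseteq> A"
proof -
  obtain \<alpha> \<beta> where ab: "prime_quotient ar A F \<alpha> \<beta>" "U \<in> min_sets ar A F \<alpha> \<beta>"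
    using assms(2) by (auto simp: type2_min_sets_def)
  interpret rigid_alg ar A F by (rule assms(1))
  interpret prime_quot ar A F \<alpha> \<beta> by unfold_locales (rule ab(1))
  show ?thesis by (rule minsets_sub[OF ab(2)])
qed

theorem theorem6p3:
  fixes ar :: "'i \<Rightarrow> nat" and A :: "'a set" and F :: "'i \<Rightarrow> 'a list \<Rightarrow> 'a"
  assumes "algebra ar A F"
    and "finite A"
    and "left_nilpotent ar A F"
    and "\<not> has_nontrivial_sa_quotient ar (pow_carrier {..<card A} A) (pow_ops F {..<card A})"
  shows "is_spread ar A F (type2_min_sets ar A F)"
proof -
  let ?I = "{..<card A}"
  let ?\<U> = "type2_min_sets ar A F"
  have A_ne: "A \<noteq> {}" using assms(1) by (simp add: algebra_def)
  have r: "rigid_alg ar A F"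
    by unfold_locales (rule assms left_nilpotent_rigid)+
  interpret power_alg ar A F ?I
    by (intro power_alg.intro r power_alg_axioms.intro) (use A_ne assms(2) in \<open>auto simp: card_gt_0_iff lessThan_empty_iff\<close>)
  have UA: "U \<subseteq> A" if "U \<in> ?\<U>" for U by (rule type2_min_sets_sub[OF r that])
  let ?W = "\<Union>U\<in>?\<U>. PiE ?I (\<lambda>_. U)"
  have WB: "?W \<subseteq> B"
  proof
    fix w assume "w \<in> ?W"
    then obtain U where "U \<in> ?\<U>" "w \<in> PiE ?I (\<lambda>_. U)" by blast
    then show "w \<in> B" using PiE_mono[of ?I "\<lambda>_. U" "\<lambda>_. A"] UA unfolding pow_carrier_def by blast
  qed
  obtain ws where ws: "set ws = ?W" using finite_list[OF finite_subset[OF WB finB]] by (rule exE)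
  have wsB: "set ws \<subseteq> B" using ws WB by (rule ord_eq_le_trans)
  \<comment> \<open>Polynomials of A are evaluated at \<open>ws\<close> coordinate by coordinate.
    Their constants act as constant functions, so D below is the subalgebra generated by these and
    by \<open>ws\<close>.\<close>
  let ?ev = "\<lambda>p. \<lambda>i\<in>?I. p (map (\<lambda>w. w i) ws)"
  define D where "D = {?ev p | p. pol ar F A (length ws) p}"
  have DI: "?ev p \<in> D" if "pol ar F A (length ws) p" for p
    unfolding D_def using that by (intro CollectI exI[of _ p] conjI refl)
  have "D = B"
  proof (rule sa_quotient_or_generated)
    show "D \<subseteq> B"
    proof
      fix f assume "f \<in> D"
      then obtain p where p: "pol ar F A (length ws) p" "f = ?ev p" unfolding D_def by blast
      have "p (map (\<lambda>w. w i) ws) \<in> A" if i: "i \<in> ?I" for i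
        by (rule pol_closed[OF p(1) A.sub]) (use subsetD[OF wsB, THEN pow_coord[OF _ i]] in auto)
      then show "f \<in> B" unfolding p(2) pow_carrier_def by auto
    qed
    obtain a where "a \<in> A" using A_ne by blast
    then have "?ev (\<lambda>_. a) \<in> D" by (intro DI pol_const)
    then show "D \<noteq> {}" by blast
    show "subuniv ar G D"
      unfolding subuniv_def
    proof (intro allI impI)
      fix op xs assume xs: "length xs = ar op" "set xs \<subseteq> D"
      have ex: "\<exists>p. pol ar F A (length ws) p \<and> xs ! j = ?ev p" if "j < ar op" for j
      proof -
        have "xs ! j \<in> D" by (rule subsetD[OF xs(2) nth_mem]) (use that xs(1) in simp)
        then show ?thesis unfolding D_def by blast
      qed
      define p where "p j = (SOME p. pol ar F A (length ws) p \<and> xs ! j = ?ev p)" for j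
      have p: "pol ar F A (length ws) (p j) \<and> xs ! j = ?ev (p j)" if "j < ar op" for j
        unfolding p_def by (rule someI_ex[OF ex[OF that]])
      let ?q = "\<lambda>ys. F op (map (\<lambda>j. p j ys) [0..<ar op])"
      have q: "pol ar F A (length ws) ?q" by (rule pol_app[OF conjunct1[OF p]])
      have "map (\<lambda>f. f i) xs = map (\<lambda>j. p j (map (\<lambda>w. w i) ws)) [0..<ar op]" if "i \<in> ?I" for i
        using xs(1) conjunct2[OF p] that by (intro nth_equalityI) auto
      then have "G op xs = ?ev ?q" unfolding pow_ops_def by (intro restrict_ext) simp
      then show "G op xs \<in> D" using DI[OF q] by simp
    qed
    show "PiE ?I (\<lambda>_. U) \<subseteq> D" if "U \<in> ?\<U>" for U
    proof
      fix w assume w: "w \<in> PiE ?I (\<lambda>_. U)"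
      then have "w \<in> set ws" using ws that by blast
      then obtain j where j: "j < length ws" "ws ! j = w" by (auto simp: in_set_conv_nth)
      have "w = restrict w ?I" using w by (simp add: PiE_def extensional_restrict)
      also have "\<dots> = ?ev (\<lambda>xs. xs ! j)" using j by (intro restrict_ext) simp
      finally show "w \<in> D" using DI[OF pol_proj[OF j(1)]] by simp
    qed
    show "\<not> has_nontrivial_sa_quotient ar B G" by (rule assms(4))
  qed
  \<comment> \<open>An enumeration of A is a point of this power. That it equals
    \<open>?ev p0\<close> says that \<open>p0\<close> attains each element of A, with its arguments
    read off at one coordinate of \<open>ws\<close>.\<close>
  obtain a where a: "bij_betw a ?I A" using ex_bij_betw_nat_finite[OF assms(2)] by (auto simp: atLeast0LessThan)
  then have "restrict a ?I \<in> B" unfolding pow_carrier_def by (auto simp: bij_betw_def)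
  then obtain p0 where p0: "pol ar F A (length ws) p0" "restrict a ?I = ?ev p0"
    using \<open>D = B\<close> unfolding D_def by blast
  obtain p where p: "(length ws, p) \<in> polys ar A F" "\<And>xs. length xs = length ws \<Longrightarrow> p0 xs = p xs"
    using p0(1) by (auto simp: pol_def)
  \<comment> \<open>All coordinates of a generator w lie in one minimal set U, which becomes the
    range of the variable belonging to w.\<close>
  define u where "u w = (SOME U. U \<in> ?\<U> \<and> w \<in> PiE ?I (\<lambda>_. U))" for w
  have u: "u w \<in> ?\<U> \<and> w \<in> PiE ?I (\<lambda>_. u w)" if "w \<in> set ws" for w
    unfolding u_def by (rule someI_ex) (use that ws in blast)
  show ?thesis
    unfolding is_spread_def
  proof (intro exI conjI)
    show "(length ws, p) \<in> polys ar A F" by (rule p(1))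
    show "length (map u ws) = length ws" by simp
    show "set (map u ws) \<subseteq> ?\<U>" using u by auto
    show "A = {p xs | xs. list_all2 (\<lambda>x U. x \<in> U) xs (map u ws)}"
    proof (intro equalityI subsetI)
      fix x assume "x \<in> A"
      then obtain i where i: "i \<in> ?I" "x = a i" using a by (auto simp: bij_betw_def)
      have "x = p (map (\<lambda>w. w i) ws)"
        using fun_cong[OF p0(2), of i] i p(2)[of "map (\<lambda>w. w i) ws"] by simp
      moreover have "list_all2 (\<lambda>x U. x \<in> U) (map (\<lambda>w. w i) ws) (map u ws)"
        using PiE_mem[OF conjunct2[OF u] i(1)] by (auto simp: list_all2_conv_all_nth)
      ultimately show "x \<in> {p xs | xs. list_all2 (\<lambda>x U. x \<in> U) xs (map u ws)}" by blast
    next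
      fix x assume "x \<in> {p xs | xs. list_all2 (\<lambda>x U. x \<in> U) xs (map u ws)}"
      then obtain xs where xs: "x = p xs" "list_all2 (\<lambda>x U. x \<in> U) xs (map u ws)" by blast
      have len: "length xs = length ws" using list_all2_lengthD[OF xs(2)] by simp
      have "set xs \<subseteq> A"
      proof
        fix y assume "y \<in> set xs"
        then obtain j where j: "j < length ws" "y = xs ! j" using len by (auto simp: in_set_conv_nth)
        have "y \<in> u (ws ! j)" using xs(2) j len by (auto simp: list_all2_conv_all_nth)
        then show "y \<in> A" using u[of "ws ! j"] UA j(1) by auto
      qed
      then show "x \<in> A" using pol_closed[OF p0(1) A.sub subset_refl len] p(2)[OF len] xs(1) by simp
    qed
  qed
qed

end
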